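(* Let $\mathcal{P}$ be an arbitrary nonempty family of nonempty subsets of $\{1,\dots,K\}$, let $\{p_{\mathcal{A}}\}_{\mathcal{A}\in\mathcal{P}}$ be fixed positive numbers (not depending on $\alpha,\beta$) with $\sum_{\mathcal{A}\in\mathcal{P}}p_{\mathcal{A}}=1$, and suppose that the thresholds of the M-SLRT $(\overline\tau,\overline d)$ are selected as $b=|\log\alpha|$ and $a=|\log\beta|-\min_{\mathcal{A}\in\mathcal{P}}(\log p_{\mathcal{A}})$, where $\alpha,\beta\in(0,1)$. Let $I_0^k,I_1^k$, $1\le k\le K$, be positive and finite numbers, and for $\mathcal{A}\subset\{1,\dots,K\}$ put $I_i^{\mathcal{A}}=\sum_{k\in\mathcal{A}}I_i^k$, $i=0,1$. Consider the asymptotic relations, as $\max(\alpha,\beta)\to0$, $$\mathsf{E}_0[\overline\tau^q]\sim\Big(\frac{|\log\beta|}{\min_{\mathcal{A}\in\mathcal{P}}I_0^{\mathcal{A}}}\Big)^q\sim\inf_{(\tau,d)\in\mathcal{C}_{\alpha,\beta}(\mathcal{P})}\mathsf{E}_0[\tau^q],\qquad(\ast)$$ $$\mathsf{E}^{\mathcal{A}}[\overline\tau^q]\sim\Big(\frac{|\log\alpha|}{I_1^{\mathcal{A}}}\Big)^q\sim\inf_{(\tau,d)\in\mathcal{C}_{\alpha,\beta}(\mathcal{P})}\mathsf{E}^{\mathcal{A}}[\tau^q]\quad\text{for every }\mathcal{A}\in\mathcal{P}.\qquad(\ast\ast)$$ (i) Let $r\in\mathbb{N}$. If for every $1\le k\le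 K$ and every $\varepsilon>0$ $$\sum_{t=1}^\infty t^{r-1}\,\mathsf{P}_0^k\Big(\Big|\tfrac1tZ_t^k+I_0^k\Big|>\varepsilon\Big)<\infty,\qquad \sum_{t=1}^\infty t^{r-1}\,\mathsf{P}_1^k\Big(\Big|\tfrac1tZ_t^k-I_1^k\Big|>\varepsilon\Big)<\infty,$$ then $(\ast)$ and $(\ast\ast)$ hold for all real $q$ with $1\le q\le r$. (ii) If for every $1\le k\le K$ the process $\{Z_t^k\}_{t\in\mathbb{N}}$ has independent increments under $\mathsf{P}_0^k$ and under $\mathsf{P}_1^k$, and $$\mathsf{P}_1^k\Big(\tfrac1t Z_t^k\to I_1^k \text{ as } t\to\infty\Big)=1,\qquad \mathsf{P}_0^k\Big(\tfrac1t Z_t^k\to -I_0^k\text{ as } t\to\infty\Big)=1,$$ then $(\ast)$ and $(\ast\ast)$ hold for every real $q>0$.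
   Context: $\mathbb{N}=\{1,2,\dots\}$; $x\sim y$ means that the ratio $x/y$ tends to $1$ in the indicated limit. There are $K$ channels; in channel $k$ one observes a discrete-time stochastic process $X^k=\{X_t^k\}_{t\in\mathbb{N}}$. For each $k$, $\mathsf{P}_0^k$ ("noise only") and $\mathsf{P}_1^k$ ("signal and noise") are distinct probability measures on the canonical space of $X^k$ that are mutually absolutely continuous when restricted to $\mathscr{F}_t^k=\sigma(X_s^k;1\le s\le t)$, for every $t\in\mathbb{N}$ (no other structure, such as i.i.d. observations, is assumed). The local likelihood ratio and log-likelihood ratio are $\Lambda_t^k=\frac{d\mathsf{P}_1^k}{d\mathsf{P}_0^k}\big|_{\mathscr{F}_t^k}$ and $Z_t^k=\log\Lambda_t^k$, with $Z_0^k=0$. Channels are independent: $\mathsf{P}_0=\mathsf{P}_0^1\times\cdots\times\mathsf{P}_0^K$ is the law of $(X^1,\dots,X^K)$ under the global null $\mathsf{H}_0$, and for $\mathcal{A}\subset\{1,\dots,K\}$, $\mathsf{P}^{\mathcal{A}}$ is the product measure whose $k$-th factor is $\mathsf{P}_1^k$ if $k\in\mathcal{A}$ and $\mathsf{P}_0^k$ if $k\notin\mathcal{A}$. $\mathsf{E}_0,\mathsf{E}^{\mathcal{A}}$ are the corresponding expectations. $\mathscr{F}_t=\sigma(X_s^k;1\le s\le t,1\le k\le K)$, and $\Lambda_t^{\mathcal{A}}=\frac{d\mathsf{P}^{\mathcal{A}}}{d\mathsf{P}_0}\big|_{\mathscr{F}_t}=\prod_{k\in\mathcal{A}}\Lambda_t^k$.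 A sequential test is a pair $(\tau,d)$ where $\tau$ is an $\{\mathscr{F}_t\}$-stopping time (possibly infinite) and $d\in\{0,1\}$ is an $\mathscr{F}_\tau$-measurable decision with $\{d=i\}=\{\tau<\infty,\ \mathsf{H}_i\text{ is selected}\}$, $i=0,1$. For $\alpha,\beta\in(0,1)$, $$\mathcal{C}_{\alpha,\beta}(\mathcal{P})=\Big\{(\tau,d):\ \mathsf{P}_0(d=1)\le\alpha\ \text{ and }\ \max_{\mathcal{A}\in\mathcal{P}}\mathsf{P}^{\mathcal{A}}(d=0)\le\beta\Big\}.$$ The Mixture Sequential Likelihood Ratio Test (M-SLRT) with weights $\{p_{\mathcal{A}}\}$ and thresholds $a,b>0$ is $$\overline\Lambda_t=\sum_{\mathcal{A}\in\mathcal{P}}p_{\mathcal{A}}\Lambda_t^{\mathcal{A}},\qquad \overline Z_t=\log\overline\Lambda_t,\qquad \overline\tau=\inf\{t\in\mathbb{N}:\overline Z_t\notin(-a,b)\},$$ with $\overline d=1$ when $\overline Z_{\overline\tau}\ge b$ and $\overline d=0$ when $\overline Z_{\overline\tau}\le-a$. *)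

theory Defs
  imports "HOL-Probability.Probability"
begin

section \<open>A single channel\<close>

text \<open>
  Observation times are \<open>1, 2, \<dots>\<close>, so a path is a function on \<open>{1..}\<close> and \<open>X\<^sub>s\<close> is the
  coordinate \<open>\<lambda>x. x s\<close>. The argument \<open>S\<close> is the (arbitrary) measurable state space.
\<close>

definition path_space :: "'a measure \<Rightarrow> (nat \<Rightarrow> 'a) measure" where
  "path_space S = PiM {1..} (\<lambda>_. S)"

definition channel_filtration :: "'a measure \<Rightarrow> nat \<Rightarrow> (nat \<Rightarrow> 'a) measure" where
  "channel_filtration S t =
     sigma (space (path_space S))
       {(\<lambda>x. x s) -` B \<inter> space (path_space S) | s B. 1 \<le> s \<and> s \<le> t \<and> B \<in> sets S}"

text \<open>
  A version of \<open>dN/dM\<close> restricted to the sub-sigma-algebra \<open>F\<close>. Which version is picked, and its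
  conversion to a real number, matters only on a null set.
\<close>

definition likelihood_ratio :: "'b measure \<Rightarrow> 'b measure \<Rightarrow> 'b measure \<Rightarrow> 'b \<Rightarrow> real" where
  "likelihood_ratio M N F x =
     enn2real (RN_deriv (restr_to_subalg M F) (restr_to_subalg N F) x)"

definition channel_model ::
  "'a measure \<Rightarrow> (nat \<Rightarrow> 'a) measure \<Rightarrow> (nat \<Rightarrow> 'a) measure \<Rightarrow> bool" where
  "channel_model S P0 P1 \<longleftrightarrow>
     prob_space P0 \<and> sets P0 = sets (path_space S) \<and>
     prob_space P1 \<and> sets P1 = sets (path_space S) \<and>
     P0 \<noteq> P1 \<and>
     (\<forall>t\<ge>1. absolutely_continuous (restr_to_subalg P0 (channel_filtration S t))
                                 (restr_to_subalg P1 (channel_filtration S t)) \<and>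
             absolutely_continuous (restr_to_subalg P1 (channel_filtration S t))
                                 (restr_to_subalg P0 (channel_filtration S t)))"

definition channel_llr ::
  "'a measure \<Rightarrow> (nat \<Rightarrow> 'a) measure \<Rightarrow> (nat \<Rightarrow> 'a) measure \<Rightarrow> nat \<Rightarrow> (nat \<Rightarrow> 'a) \<Rightarrow> real" where
  "channel_llr S P0 P1 t x =
     (if t = 0 then 0 else ln (likelihood_ratio P0 P1 (channel_filtration S t) x))"

text \<open>Independence of \<open>Z\<^sub>1 - Z\<^sub>0, Z\<^sub>2 - Z\<^sub>1, \<dots>\<close>; used with \<open>Z\<^sub>0 = 0\<close>.\<close>

definition independent_increments :: "'b measure \<Rightarrow> (nat \<Rightarrow> 'b \<Rightarrow> real) \<Rightarrow> bool" where
  "independent_increments M Z \<longleftrightarrow>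
     prob_space.indep_vars M (\<lambda>_. borel) (\<lambda>t x. Z (Suc t) x - Z t x) UNIV"


section \<open>All channels together\<close>

text \<open>
  The channels are \<open>{1..K}\<close>; channel \<open>k\<close> has state space \<open>S k\<close> and the two laws \<open>P0 k\<close>,
  \<open>P1 k\<close>. A sample point is \<open>\<omega>\<close> with \<open>\<omega> k s\<close> the observation in channel \<open>k\<close> at time \<open>s\<close>.
\<close>

definition sample_space :: "nat \<Rightarrow> (nat \<Rightarrow> 'a measure) \<Rightarrow> (nat \<Rightarrow> nat \<Rightarrow> 'a) measure" where
  "sample_space K S = PiM {1..K} (\<lambda>k. path_space (S k))"

definition null_law ::
  "nat \<Rightarrow> (nat \<Rightarrow> (nat \<Rightarrow> 'a) measure) \<Rightarrow> (nat \<Rightarrow> nat \<Rightarrow> 'a) measure" where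
  "null_law K P0 = PiM {1..K} P0"

definition signal_law ::
  "nat \<Rightarrow> (nat \<Rightarrow> (nat \<Rightarrow> 'a) measure) \<Rightarrow> (nat \<Rightarrow> (nat \<Rightarrow> 'a) measure) \<Rightarrow> nat set
     \<Rightarrow> (nat \<Rightarrow> nat \<Rightarrow> 'a) measure" where
  "signal_law K P0 P1 A = PiM {1..K} (\<lambda>k. if k \<in> A then P1 k else P0 k)"

text \<open>
  The index is extended by \<open>\<infinity>\<close> (all observations) because \<^const>\<open>stopping_time\<close> requires the
  time index to contain the values of the stopping time.
\<close>

definition joint_filtration ::
  "nat \<Rightarrow> (nat \<Rightarrow> 'a measure) \<Rightarrow> enat \<Rightarrow> (nat \<Rightarrow> nat \<Rightarrow> 'a) measure" where
  "joint_filtration K S t =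
     sigma (space (sample_space K S))
       {(\<lambda>\<omega>. \<omega> k s) -` B \<inter> space (sample_space K S) | k s B.
          k \<in> {1..K} \<and> 1 \<le> s \<and> enat s \<le> t \<and> B \<in> sets (S k)}"

definition joint_lr ::
  "nat \<Rightarrow> (nat \<Rightarrow> 'a measure) \<Rightarrow> (nat \<Rightarrow> (nat \<Rightarrow> 'a) measure) \<Rightarrow> (nat \<Rightarrow> (nat \<Rightarrow> 'a) measure)
     \<Rightarrow> nat set \<Rightarrow> nat \<Rightarrow> (nat \<Rightarrow> nat \<Rightarrow> 'a) \<Rightarrow> real" where
  "joint_lr K S P0 P1 A t \<omega> =
     likelihood_ratio (null_law K P0) (signal_law K P0 P1 A) (joint_filtration K S (enat t)) \<omega>"


section \<open>Sequential tests\<close>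

definition sequential_test ::
  "nat \<Rightarrow> (nat \<Rightarrow> 'a measure) \<Rightarrow> ((nat \<Rightarrow> nat \<Rightarrow> 'a) \<Rightarrow> enat) \<Rightarrow> ((nat \<Rightarrow> nat \<Rightarrow> 'a) \<Rightarrow> nat) \<Rightarrow> bool"
where
  "sequential_test K S \<tau> d \<longleftrightarrow>
     stopping_time (joint_filtration K S) \<tau> \<and>
     (\<forall>\<omega>\<in>space (sample_space K S). 1 \<le> \<tau> \<omega>) \<and>
     d \<in> filtration.pre_sigma (space (sample_space K S)) (joint_filtration K S) \<tau>
           \<rightarrow>\<^sub>M count_space {0, 1}"

text \<open>The event that hypothesis \<open>i\<close> is selected; the value of \<open>d\<close> on \<open>\<tau> = \<infinity>\<close> is irrelevant.\<close>

definition selects ::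
  "nat \<Rightarrow> (nat \<Rightarrow> 'a measure) \<Rightarrow> ((nat \<Rightarrow> nat \<Rightarrow> 'a) \<Rightarrow> enat) \<Rightarrow> ((nat \<Rightarrow> nat \<Rightarrow> 'a) \<Rightarrow> nat) \<Rightarrow> nat
     \<Rightarrow> (nat \<Rightarrow> nat \<Rightarrow> 'a) set" where
  "selects K S \<tau> d i = {\<omega> \<in> space (sample_space K S). \<tau> \<omega> < \<infinity> \<and> d \<omega> = i}"

definition test_class ::
  "nat \<Rightarrow> (nat \<Rightarrow> 'a measure) \<Rightarrow> (nat \<Rightarrow> (nat \<Rightarrow> 'a) measure) \<Rightarrow> (nat \<Rightarrow> (nat \<Rightarrow> 'a) measure)
     \<Rightarrow> nat set set \<Rightarrow> real \<Rightarrow> real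
     \<Rightarrow> (((nat \<Rightarrow> nat \<Rightarrow> 'a) \<Rightarrow> enat) \<times> ((nat \<Rightarrow> nat \<Rightarrow> 'a) \<Rightarrow> nat)) set" where
  "test_class K S P0 P1 \<P> \<alpha> \<beta> =
     {(\<tau>, d). sequential_test K S \<tau> d \<and>
        measure (null_law K P0) (selects K S \<tau> d 1) \<le> \<alpha> \<and>
        (MAX A\<in>\<P>. measure (signal_law K P0 P1 A) (selects K S \<tau> d 0)) \<le> \<beta>}"

definition mixture_llr ::
  "nat \<Rightarrow> (nat \<Rightarrow> 'a measure) \<Rightarrow> (nat \<Rightarrow> (nat \<Rightarrow> 'a) measure) \<Rightarrow> (nat \<Rightarrow> (nat \<Rightarrow> 'a) measure)
     \<Rightarrow> nat set set \<Rightarrow> (nat set \<Rightarrow> real) \<Rightarrow> nat \<Rightarrow> (nat \<Rightarrow> nat \<Rightarrow> 'a) \<Rightarrow> real" where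
  "mixture_llr K S P0 P1 \<P> p t \<omega> = ln (\<Sum>A\<in>\<P>. p A * joint_lr K S P0 P1 A t \<omega>)"

text \<open>On \<^typ>\<open>enat\<close> the infimum of the empty set is \<open>\<infinity>\<close>.\<close>

definition mslrt_time ::
  "nat \<Rightarrow> (nat \<Rightarrow> 'a measure) \<Rightarrow> (nat \<Rightarrow> (nat \<Rightarrow> 'a) measure) \<Rightarrow> (nat \<Rightarrow> (nat \<Rightarrow> 'a) measure)
     \<Rightarrow> nat set set \<Rightarrow> (nat set \<Rightarrow> real) \<Rightarrow> real \<Rightarrow> real \<Rightarrow> (nat \<Rightarrow> nat \<Rightarrow> 'a) \<Rightarrow> enat" where
  "mslrt_time K S P0 P1 \<P> p a b \<omega> =
     Inf {enat t | t. 1 \<le> t \<and> mixture_llr K S P0 P1 \<P> p t \<omega> \<notin> {-a<..<b}}"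

definition mslrt_a :: "nat set set \<Rightarrow> (nat set \<Rightarrow> real) \<Rightarrow> real \<Rightarrow> real" where
  "mslrt_a \<P> p \<beta> = \<bar>ln \<beta>\<bar> - (MIN A\<in>\<P>. ln (p A))"

definition mslrt_b :: "real \<Rightarrow> real" where
  "mslrt_b \<alpha> = \<bar>ln \<alpha>\<bar>"


section \<open>Asymptotic relations\<close>

definition enat_powr :: "enat \<Rightarrow> real \<Rightarrow> ennreal" where
  "enat_powr n q = (case n of enat m \<Rightarrow> ennreal (real m powr q) | \<infinity> \<Rightarrow> \<infinity>)"

definition moment :: "'b measure \<Rightarrow> ('b \<Rightarrow> enat) \<Rightarrow> real \<Rightarrow> ennreal" where
  "moment M \<tau> q = (\<integral>\<^sup>+ \<omega>. enat_powr (\<tau> \<omega>) q \<partial>M)"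

text \<open>The limit \<open>max(\<alpha>, \<beta>) \<rightarrow> 0\<close> with \<open>\<alpha>, \<beta> \<in> (0, 1)\<close> and no other constraint.\<close>

definition errors_to_zero :: "(real \<times> real) filter" where
  "errors_to_zero =
     inf (filtercomap (\<lambda>(\<alpha>, \<beta>). max \<alpha> \<beta>) (nhds 0)) (principal ({0<..<1} \<times> {0<..<1}))"

text \<open>
  The ratio is taken in \<^typ>\<open>ennreal\<close>, where \<open>0 / 0 = 0\<close> and \<open>\<infinity> / \<infinity> = 0\<close>; so it is near \<open>1\<close> only
  if numerator and denominator are both positive and finite.
\<close>

definition ratio_to_one ::
  "(real \<Rightarrow> real \<Rightarrow> ennreal) \<Rightarrow> (real \<Rightarrow> real \<Rightarrow> ennreal) \<Rightarrow> bool" where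
  "ratio_to_one f g \<longleftrightarrow> ((\<lambda>(\<alpha>, \<beta>). f \<alpha> \<beta> / g \<alpha> \<beta>) \<longlongrightarrow> 1) errors_to_zero"

definition null_moment_asymptotics ::
  "nat \<Rightarrow> (nat \<Rightarrow> 'a measure) \<Rightarrow> (nat \<Rightarrow> (nat \<Rightarrow> 'a) measure) \<Rightarrow> (nat \<Rightarrow> (nat \<Rightarrow> 'a) measure)
     \<Rightarrow> nat set set \<Rightarrow> (nat set \<Rightarrow> real) \<Rightarrow> (nat \<Rightarrow> real) \<Rightarrow> real \<Rightarrow> bool" where
  "null_moment_asymptotics K S P0 P1 \<P> p I0 q \<longleftrightarrow>
     ratio_to_one
       (\<lambda>\<alpha> \<beta>. moment (null_law K P0)
                (mslrt_time K S P0 P1 \<P> p (mslrt_a \<P> p \<beta>) (mslrt_b \<alpha>)) q)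
       (\<lambda>\<alpha> \<beta>. ennreal ((\<bar>ln \<beta>\<bar> / (MIN A\<in>\<P>. \<Sum>k\<in>A. I0 k)) powr q)) \<and>
     ratio_to_one
       (\<lambda>\<alpha> \<beta>. ennreal ((\<bar>ln \<beta>\<bar> / (MIN A\<in>\<P>. \<Sum>k\<in>A. I0 k)) powr q))
       (\<lambda>\<alpha> \<beta>. INF (\<tau>, d)\<in>test_class K S P0 P1 \<P> \<alpha> \<beta>. moment (null_law K P0) \<tau> q)"

definition signal_moment_asymptotics ::
  "nat \<Rightarrow> (nat \<Rightarrow> 'a measure) \<Rightarrow> (nat \<Rightarrow> (nat \<Rightarrow> 'a) measure) \<Rightarrow> (nat \<Rightarrow> (nat \<Rightarrow> 'a) measure)
     \<Rightarrow> nat set set \<Rightarrow> (nat set \<Rightarrow> real) \<Rightarrow> (nat \<Rightarrow> real) \<Rightarrow> real \<Rightarrow> bool" where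
  "signal_moment_asymptotics K S P0 P1 \<P> p I1 q \<longleftrightarrow>
     (\<forall>A\<in>\<P>.
       ratio_to_one
         (\<lambda>\<alpha> \<beta>. moment (signal_law K P0 P1 A)
                  (mslrt_time K S P0 P1 \<P> p (mslrt_a \<P> p \<beta>) (mslrt_b \<alpha>)) q)
         (\<lambda>\<alpha> \<beta>. ennreal ((\<bar>ln \<alpha>\<bar> / (\<Sum>k\<in>A. I1 k)) powr q)) \<and>
       ratio_to_one
         (\<lambda>\<alpha> \<beta>. ennreal ((\<bar>ln \<alpha>\<bar> / (\<Sum>k\<in>A. I1 k)) powr q))
         (\<lambda>\<alpha> \<beta>. INF (\<tau>, d)\<in>test_class K S P0 P1 \<P> \<alpha> \<beta>. moment (signal_law K P0 P1 A) \<tau> q))"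

end

theory Submission
  imports Defs
begin

text \<open>
  Since the mixture test belongs to the class over which the infimum is taken, both relations in
  each of the two displays follow from two bounds: no test in the class has a moment
  asymptotically smaller than the middle term, and the mixture test has a moment that is
  asymptotically at most the middle term.

  The two displays are the same statement read twice. Let \<open>M\<close> be the law under which the moment is
  taken, let \<open>N\<close> be a law against which \<open>M\<close> is tested, and let \<open>Y t\<close> be the log-likelihood ratio of
  \<open>M\<close> against \<open>N\<close> up to time \<open>t\<close>. Under the null law \<open>Y\<close> is the negative of the usual
  log-likelihood ratio and under a signal law it is the usual one; in both cases \<open>Y t\<close> is a sum
  over channels of processes with positive drifts, so it grows like \<open>J t\<close>, where \<open>J\<close> is the sum of
  the information numbers involved.

  Lower bound (\<open>measure_stopped_early_le\<close>, \<open>moment_lower_bound\<close>). To decide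
  for \<open>M\<close> is an error under \<open>N\<close>; let \<open>\<beta>\<close> be the bound on its probability. Passing from \<open>N\<close> to \<open>M\<close>
  on the event that the test decides for \<open>M\<close> by time \<open>L\<close> costs at most a factor \<open>exp c\<close>, unless \<open>Y\<close>
  reaches the level \<open>c\<close> by time \<open>L\<close>. With \<open>L\<close> slightly below \<open>\<bar>ln \<beta>\<bar> / J\<close> and \<open>c\<close> between
  \<open>J L\<close> and \<open>\<bar>ln \<beta>\<bar>\<close>, that event is unlikely because \<open>Y t / t\<close> converges to \<open>J\<close>, and \<open>exp c * \<beta>\<close> tends to \<open>0\<close>. So a test with small errors is unlikely to stop
  before \<open>L\<close>.

  Upper bound (\<open>moment_upper_bound\<close>). The mixture is at least each of its terms and at most
  the largest of the likelihood ratios, so if the mixture test has not stopped by time \<open>n\<close>,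
  then for some set \<open>A\<close> in play the sum of \<open>Y k n\<close> over \<open>k \<in> A\<close> lies below a threshold \<open>a\<close> that exceeds \<open>\<bar>ln \<beta>\<bar>\<close> by a constant.
  Once \<open>n\<close> is a little larger than \<open>a / J\<close>, some single channel must then satisfy
  \<open>Y k n < min (n I k / \<rho>) a\<close> with \<open>\<rho>\<close> slightly above \<open>1\<close>. Summing these probabilities with the
  weights \<open>n ^ (r - 1)\<close> controls the moments, and \<open>tail_negligible\<close> says that the result is of smaller
  order than \<open>a ^ r\<close>. This is a property of one channel under one law.

  In part (i) it is immediate from the assumed summability. In part (ii) it is the heart of the
  matter (\<open>lower_deviation_of_independent_increments\<close>): there are no moment assumptions, the
  increments need not be identically distributed, and the probability that \<open>Y n\<close> falls below a
  small multiple of \<open>n\<close> need not decay like a power of \<open>n\<close>. What is available is that increments of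
  a log-likelihood ratio satisfy \<open>E (exp (- (Y n - Y m))) = 1\<close>. Tilting by \<open>1 / a\<close> instead of by
  \<open>1\<close> yields \<open>G n = E (exp (- Y n / a))\<close>, which by independence is multiplied by a factor close to
  \<open>0\<close> each time \<open>n\<close> grows by a constant factor \<open>C\<close>. Hence \<open>G n\<close>, and with it the probability that
  \<open>Y n < a\<close>, decays faster than any prescribed power of \<open>n / a\<close>.
\<close>

section \<open>Moments of a random time and tail sums\<close>

lemma power_Suc_diff_le:
  fixes n r :: nat
  assumes "1 \<le> n"
  shows "real (Suc n) ^ r - real n ^ r \<le> real r * 2 ^ (r - 1) * real n ^ (r - 1)"
proof -
  have *: "real (Suc n) ^ r \<le> real n ^ r + real r * real (Suc n) ^ (r - 1)"
  proof (induction r)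
    case (Suc r)
    have "real (Suc n) ^ Suc r = real n * real (Suc n) ^ r + real (Suc n) ^ r"
      by (simp add: algebra_simps)
    also have "\<dots> \<le> real n * (real n ^ r + real r * real (Suc n) ^ (r - 1)) + real (Suc n) ^ r"
      using Suc by (intro add_mono mult_left_mono) auto
    also have "\<dots> \<le> real n ^ Suc r + real r * (real (Suc n) * real (Suc n) ^ (r - 1)) + real (Suc n) ^ r"
      by (simp add: algebra_simps)
    also have "real r * (real (Suc n) * real (Suc n) ^ (r - 1)) = real r * real (Suc n) ^ r"
      by (cases r) auto
    finally show ?case by (simp add: algebra_simps)
  qed simp
  have "real (Suc n) ^ (r - 1) \<le> (2 * real n) ^ (r - 1)"
    using assms by (intro power_mono) auto
  then have "real r * real (Suc n) ^ (r - 1) \<le> real r * (2 ^ (r - 1) * real n ^ (r - 1))"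
    by (intro mult_left_mono) (auto simp: power_mult_distrib)
  with * show ?thesis by (simp add: algebra_simps)
qed

lemma powr_diff_le_power_diff:
  fixes N m :: nat and q :: real
  assumes "1 \<le> N" "N \<le> m" "0 < q" "q \<le> real r"
  shows "real m powr q \<le> real N powr q + real N powr (q - real r) * (real m ^ r - real N ^ r)"
proof -
  define x where "x = real m / real N"
  have x: "1 \<le> x" "real m = real N * x" using assms by (auto simp: x_def)
  have "x powr q \<le> x powr real r" using x assms by (intro powr_mono) auto
  then have *: "real N powr q * x powr q \<le> real N powr q * x ^ r"
    using x by (intro mult_left_mono) (auto simp: powr_realpow)
  have N: "real N powr (q - real r) * real N ^ r = real N powr q"
    using assms by (simp add: powr_diff powr_realpow)
  have "real m powr q = real N powr q * x powr q" using x by (simp add: powr_mult)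
  also have "\<dots> \<le> real N powr q * x ^ r" by (rule *)
  also have "\<dots> = real N powr (q - real r) * real N ^ r * x ^ r" by (simp add: N)
  also have "\<dots> = real N powr (q - real r) * real m ^ r" using x by (simp add: power_mult_distrib)
  finally show ?thesis using N by (simp add: algebra_simps)
qed

text \<open>
  Telescoping \<open>n ^ r\<close> from \<open>N\<close> to \<open>T\<close> gives the case \<open>q = r\<close>. Smaller exponents reduce to it because
  the ratio \<open>x = T / N\<close> is at least \<open>1\<close> whenever the sum is not empty, so that
  \<open>x powr q - 1 \<le> x ^ r - 1\<close>. Therefore only natural exponents occur in the tail estimates below.
\<close>

lemma enat_powr_le_tail_sum:
  fixes T :: enat and q :: real
  assumes "1 \<le> N" "0 < q" "q \<le> real r" "1 \<le> r"
  shows "enat_powr T q \<le> ennreal (real N powr q) + ennreal (real N powr (q - real r) * (real r * 2 ^ (r - 1)))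
      * (\<Sum>n. ennreal (real n ^ (r - 1)) * indicator {n. N \<le> n \<and> enat n < T} n)"
    (is "_ \<le> _ + ennreal ?c * ?S")
proof (cases T)
  case (enat m)
  show ?thesis
  proof (cases "m \<le> N")
    case True
    then have "real m powr q \<le> real N powr q" using assms by (intro powr_mono2) auto
    then show ?thesis using enat by (auto simp: enat_powr_def intro: add_increasing2)
  next
    case False
    have "real m ^ r - real N ^ r = (\<Sum>n=N..<m. real (Suc n) ^ r - real n ^ r)"
      using False by (subst sum_Suc_diff') auto
    also have "\<dots> \<le> (\<Sum>n=N..<m. real r * 2 ^ (r - 1) * real n ^ (r - 1))"
      using assms by (intro sum_mono power_Suc_diff_le) auto
    finally have d: "real m ^ r - real N ^ r \<le> real r * 2 ^ (r - 1) * (\<Sum>n=N..<m. real n ^ (r - 1))"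
      by (simp add: sum_distrib_left)
    have "ennreal (\<Sum>n=N..<m. real n ^ (r - 1))
        = (\<Sum>n=N..<m. ennreal (real n ^ (r - 1)) * indicator {n. N \<le> n \<and> enat n < T} n)"
      using enat by (subst sum_ennreal[symmetric]) (auto intro!: sum.cong)
    also have "\<dots> \<le> ?S" by (intro sum_le_suminf) auto
    finally have S: "ennreal (\<Sum>n=N..<m. real n ^ (r - 1)) \<le> ?S" .
    have "real m powr q \<le> real N powr q + real N powr (q - real r) * (real m ^ r - real N ^ r)"
      using False assms by (intro powr_diff_le_power_diff) auto
    also have "\<dots> \<le> real N powr q + real N powr (q - real r) * (real r * 2 ^ (r - 1) * (\<Sum>n=N..<m. real n ^ (r - 1)))"
      using d by (intro add_mono mult_left_mono) auto
    also have "\<dots> = real N powr q + ?c * (\<Sum>n=N..<m. real n ^ (r - 1))" by simp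
    finally have "ennreal (real m powr q) \<le> ennreal (real N powr q + ?c * (\<Sum>n=N..<m. real n ^ (r - 1)))"
      by (rule ennreal_leI)
    also have "\<dots> = ennreal (real N powr q) + ennreal ?c * ennreal (\<Sum>n=N..<m. real n ^ (r - 1))"
      by (subst ennreal_plus) (auto simp: sum_nonneg ennreal_mult[symmetric])
    also have "\<dots> \<le> ennreal (real N powr q) + ennreal ?c * ?S"
      using S by (intro add_mono mult_left_mono) auto
    finally show ?thesis using enat by (simp add: enat_powr_def)
  qed
next
  case infinity
  \<comment> \<open>Each term from \<open>N\<close> on is at least \<open>1\<close>, so the sum diverges together with \<open>T\<close>.\<close>
  have le: "of_nat k \<le> ?S" for k
  proof -
    have "(of_nat k :: ennreal) = (\<Sum>n=N..<N+k. 1)" by simp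
    also have "\<dots> \<le> (\<Sum>n=N..<N+k. ennreal (real n ^ (r - 1)) * indicator {n. N \<le> n \<and> enat n < T} n)"
      using assms infinity by (intro sum_mono) auto
    also have "\<dots> \<le> ?S" by (intro sum_le_suminf) auto
    finally show ?thesis .
  qed
  have "?S = \<infinity>"
  proof (rule ccontr)
    assume "?S \<noteq> \<infinity>"
    then obtain k where "?S < of_nat k"
      using ennreal_Ex_less_of_nat[of ?S] by (auto simp: top.not_eq_extremum)
    with le show False by (simp add: leD)
  qed
  moreover have "ennreal ?c \<noteq> 0" using assms by simp
  ultimately have "ennreal ?c * ?S = \<top>" by (simp add: ennreal_mult_eq_top_iff)
  then show ?thesis by (simp only:) simp
qed

lemma moment_le_tail_sum:
  fixes q :: real
  assumes "prob_space M"
    and T: "\<And>n. {\<omega> \<in> space M. enat n < T \<omega>} \<in> sets M"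
    and "1 \<le> N" "0 < q" "q \<le> real r" "1 \<le> r"
  shows "moment M T q \<le> ennreal (real N powr q) + ennreal (real N powr (q - real r) * (real r * 2 ^ (r - 1)))
      * (\<Sum>n. ennreal (real n ^ (r - 1)) * emeasure M {\<omega> \<in> space M. N \<le> n \<and> enat n < T \<omega>})"
    (is "_ \<le> _ + ennreal ?c * _")
proof -
  interpret prob_space M by fact
  define B where "B n = {\<omega> \<in> space M. N \<le> n \<and> enat n < T \<omega>}" for n
  have B[measurable]: "B n \<in> sets M" for n
    unfolding B_def using T[of n] by (cases "N \<le> n") auto
  have "moment M T q \<le> (\<integral>\<^sup>+\<omega>. ennreal (real N powr q)
      + ennreal ?c * (\<Sum>n. ennreal (real n ^ (r - 1)) * indicator (B n) \<omega>) \<partial>M)"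
    unfolding moment_def
  proof (rule nn_integral_mono)
    fix \<omega> assume "\<omega> \<in> space M"
    then have "indicator (B n) \<omega> = (indicator {n. N \<le> n \<and> enat n < T \<omega>} n :: ennreal)" for n
      by (simp add: B_def indicator_def)
    then show "enat_powr (T \<omega>) q \<le> ennreal (real N powr q)
        + ennreal ?c * (\<Sum>n. ennreal (real n ^ (r - 1)) * indicator (B n) \<omega>)"
      using enat_powr_le_tail_sum[of N q r "T \<omega>"] assms by (simp only:)
  qed
  also have "\<dots> = (\<integral>\<^sup>+\<omega>. ennreal (real N powr q) \<partial>M)
      + ennreal ?c * (\<integral>\<^sup>+\<omega>. (\<Sum>n. ennreal (real n ^ (r - 1)) * indicator (B n) \<omega>) \<partial>M)"
    by (subst nn_integral_add, measurable, subst nn_integral_cmult, measurable)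
  also have "(\<integral>\<^sup>+\<omega>. ennreal (real N powr q) \<partial>M) = ennreal (real N powr q)"
    by (simp add: emeasure_space_1)
  also have "(\<integral>\<^sup>+\<omega>. (\<Sum>n. ennreal (real n ^ (r - 1)) * indicator (B n) \<omega>) \<partial>M)
      = (\<Sum>n. ennreal (real n ^ (r - 1)) * emeasure M (B n))"
    by (subst nn_integral_suminf, measurable)
       (intro suminf_cong nn_integral_cmult_indicator B)
  finally show ?thesis unfolding B_def .
qed

section \<open>Lower tails of a process with positive drift\<close>

lemma (in prob_space) measure_tendsto_0_of_AE:
  assumes A: "\<And>n. A n \<in> sets M" and ev: "AE x in M. \<forall>\<^sub>F n in sequentially. x \<notin> A n"
  shows "(\<lambda>n. measure M (A n)) \<longlonglongrightarrow> 0"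
proof -
  have "(\<lambda>n. \<integral>x. indicator (A n) x \<partial>M) \<longlonglongrightarrow> (\<integral>x. (0::real) \<partial>M)"
  proof (rule integral_dominated_convergence[where w="\<lambda>_. 1"])
    show "AE x in M. (\<lambda>n. indicator (A n) x :: real) \<longlonglongrightarrow> 0"
      using ev
    proof eventually_elim
      case (elim x)
      then have "\<forall>\<^sub>F n in sequentially. (indicator (A n) x :: real) = 0"
        by eventually_elim simp
      then show ?case by (rule tendsto_eventually)
    qed
  qed (use A in \<open>auto simp: indicator_def\<close>)
  then show ?thesis using A by simp
qed

text \<open>
  The minimum reflects the two ways in which one channel can do its share: while \<open>n\<close> is of order
  \<open>a\<close> it has to follow its drift up to the factor \<open>\<rho>\<close>, but as soon as it has reached the level \<open>a\<close>
  the other channels only have to stay nonnegative. Without the cut-off at \<open>a\<close> the property would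
  fail in general for independent increments.
\<close>

definition tail_negligible :: "'b measure \<Rightarrow> (nat \<Rightarrow> 'b \<Rightarrow> real) \<Rightarrow> real \<Rightarrow> nat \<Rightarrow> bool" where
  "tail_negligible M Y I r \<longleftrightarrow>
     (\<forall>\<rho>>1. \<forall>c>0. \<forall>\<delta>>0. \<forall>\<^sub>F a in at_top.
        (\<Sum>n. ennreal (real n ^ (r - 1)) *
           emeasure M {x \<in> space M. c * a \<le> real n \<and> Y n x < min (real n * I / \<rho>) a})
        \<le> ennreal (\<delta> * a ^ r))"

text \<open>
  The weighted sum is bounded by a convergent series that does not depend on \<open>a\<close>.
\<close>

lemma tail_negligible_of_summable:
  fixes I :: real
  assumes "prob_space M" "0 < I" "1 \<le> r"
    and [measurable]: "\<And>n. Y n \<in> borel_measurable M"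
    and sm: "\<And>\<epsilon>. 0 < \<epsilon> \<Longrightarrow> summable (\<lambda>n. real (Suc n) ^ (r - 1) *
         measure M {x \<in> space M. \<epsilon> < \<bar>Y (Suc n) x / real (Suc n) - I\<bar>})"
  shows "tail_negligible M Y I r"
  unfolding tail_negligible_def
proof (intro allI impI)
  fix \<rho> c \<delta> :: real assume "1 < \<rho>" "0 < c" "0 < \<delta>"
  interpret prob_space M by fact
  define \<epsilon> where "\<epsilon> = (I - I / \<rho>) / 2"
  have \<epsilon>: "0 < \<epsilon>" "I / \<rho> < I - \<epsilon>"
  proof -
    have "I / \<rho> < I" using \<open>1 < \<rho>\<close> \<open>0 < I\<close> by (simp add: field_simps)
    moreover have "u < v - (v - u) / 2" if "u < v" for u v :: real
      using that by (simp add: field_simps)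
    ultimately show "0 < \<epsilon>" "I / \<rho> < I - \<epsilon>"
      unfolding \<epsilon>_def by simp_all
  qed
  define g where "g n = real n ^ (r - 1) * measure M {x \<in> space M. \<epsilon> < \<bar>Y n x / real n - I\<bar>}" for n
  have "summable g" using sm[OF \<epsilon>(1)] unfolding g_def by (subst summable_Suc_iff[symmetric])
  have g0: "0 \<le> g n" for n by (simp add: g_def)
  have "\<forall>\<^sub>F a in at_top. suminf g \<le> \<delta> * a ^ r"
  proof -
    have "filterlim (\<lambda>a::real. \<delta> * a ^ r) at_top at_top"
      using \<open>0 < \<delta>\<close> \<open>1 \<le> r\<close>
      by (intro filterlim_tendsto_pos_mult_at_top[OF tendsto_const] filterlim_pow_at_top filterlim_ident) auto
    then show ?thesis by (simp add: filterlim_at_top)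
  qed
  then show "\<forall>\<^sub>F a in at_top.
        (\<Sum>n. ennreal (real n ^ (r - 1)) *
           emeasure M {x \<in> space M. c * a \<le> real n \<and> Y n x < min (real n * I / \<rho>) a})
        \<le> ennreal (\<delta> * a ^ r)"
    using eventually_gt_at_top[of 0]
  proof eventually_elim
    case (elim a)
    have "ennreal (real n ^ (r - 1)) *
           emeasure M {x \<in> space M. c * a \<le> real n \<and> Y n x < min (real n * I / \<rho>) a} \<le> ennreal (g n)" for n
    proof (cases "n = 0")
      case True
      have "{x \<in> space M. c * a \<le> real n \<and> Y n x < min (real n * I / \<rho>) a} = {}"
        using elim True \<open>0 < c\<close> by (auto simp: mult_le_0_iff)
      then show ?thesis by (simp only:) simp
    next
      case False
      have "{x \<in> space M. c * a \<le> real n \<and> Y n x < min (real n * I / \<rho>) a}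
          \<subseteq> {x \<in> space M. \<epsilon> < \<bar>Y n x / real n - I\<bar>}"
      proof safe
        fix x assume "Y n x < min (real n * I / \<rho>) a"
        then have "Y n x / real n < I / \<rho>" using False by (simp add: field_simps)
        then show "\<epsilon> < \<bar>Y n x / real n - I\<bar>" using \<epsilon> by linarith
      qed
      then have "emeasure M {x \<in> space M. c * a \<le> real n \<and> Y n x < min (real n * I / \<rho>) a}
          \<le> emeasure M {x \<in> space M. \<epsilon> < \<bar>Y n x / real n - I\<bar>}"
        by (intro emeasure_mono) auto
      then show ?thesis
        unfolding g_def by (subst ennreal_mult) (auto simp: emeasure_eq_measure intro!: mult_left_mono)
    qed
    then have "(\<Sum>n. ennreal (real n ^ (r - 1)) *
           emeasure M {x \<in> space M. c * a \<le> real n \<and> Y n x < min (real n * I / \<rho>) a}) \<le> (\<Sum>n. ennreal (g n))"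
      by (intro suminf_le) auto
    also have "\<dots> = ennreal (suminf g)" using g0 \<open>summable g\<close> by (intro suminf_ennreal2) auto
    also have "\<dots> \<le> ennreal (\<delta> * a ^ r)" using elim by (intro ennreal_leI) auto
    finally show ?case .
  qed
qed

text \<open>
  The first Borel-Cantelli lemma; the weights are at least \<open>1\<close>.
\<close>

lemma AE_tendsto_of_summable_deviations:
  fixes I :: real
  assumes "prob_space M" and "1 \<le> r" and [measurable]: "\<And>n. Y n \<in> borel_measurable M"
    and sm: "\<And>\<epsilon>. 0 < \<epsilon> \<Longrightarrow> summable (\<lambda>n. real (Suc n) ^ (r - 1) *
         measure M {x \<in> space M. \<epsilon> < \<bar>Y (Suc n) x / real (Suc n) - I\<bar>})"
  shows "AE x in M. (\<lambda>n. Y n x / real n) \<longlonglongrightarrow> I"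
proof -
  interpret prob_space M by fact
  have "AE x in M. \<forall>m. \<forall>\<^sub>F n in sequentially. \<bar>Y (Suc n) x / real (Suc n) - I\<bar> \<le> 1 / real (Suc m)"
    unfolding AE_all_countable
  proof
    fix m
    let ?\<epsilon> = "1 / real (Suc m)"
    define D where "D n = {x \<in> space M. ?\<epsilon> < \<bar>Y (Suc n) x / real (Suc n) - I\<bar>}" for n
    have [measurable]: "D n \<in> sets M" for n by (simp add: D_def)
    have "summable (\<lambda>n. measure M (D n))"
    proof (rule summable_comparison_test')
      show "summable (\<lambda>n. real (Suc n) ^ (r - 1) * measure M (D n))" unfolding D_def by (rule sm) simp
      fix n :: nat
      have "1 * measure M (D n) \<le> real (Suc n) ^ (r - 1) * measure M (D n)"
        by (intro mult_right_mono one_le_power) auto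
      then show "norm (measure M (D n)) \<le> real (Suc n) ^ (r - 1) * measure M (D n)"
        by simp
    qed
    then have "AE x in M. \<forall>\<^sub>F n in sequentially. x \<in> space M - D n"
      by (intro borel_cantelli_AE1) (auto simp: emeasure_eq_measure)
    then show "AE x in M. \<forall>\<^sub>F n in sequentially. \<bar>Y (Suc n) x / real (Suc n) - I\<bar> \<le> ?\<epsilon>"
      by (rule eventually_mono) (auto simp: D_def elim!: eventually_mono)
  qed
  then show ?thesis
  proof eventually_elim
    case (elim x)
    have "(\<lambda>n. Y (Suc n) x / real (Suc n)) \<longlonglongrightarrow> I"
    proof (rule tendstoI)
      fix e :: real assume "0 < e"
      then obtain m where "1 / real (Suc m) < e" using nat_approx_posE by blast
      moreover have "\<forall>\<^sub>F n in sequentially. \<bar>Y (Suc n) x / real (Suc n) - I\<bar> \<le> 1 / real (Suc m)"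
        using elim by blast
      ultimately show "\<forall>\<^sub>F n in sequentially. dist (Y (Suc n) x / real (Suc n)) I < e"
        by (elim eventually_mono) (simp add: dist_real_def)
    qed
    then show ?case by (rule LIMSEQ_imp_Suc)
  qed
qed

text \<open>
  Both sides are the product over single steps of the expectations of exponentials; this is the
  only place where independence of the increments enters.
\<close>

lemma nn_integral_exp_increment_mult:
  assumes "prob_space M" "independent_increments M Y" "m \<le> n"
  shows "(\<integral>\<^sup>+x. ennreal (exp (- (s * (Y n x - Y 0 x)))) \<partial>M)
    = (\<integral>\<^sup>+x. ennreal (exp (- (s * (Y m x - Y 0 x)))) \<partial>M)
      * (\<integral>\<^sup>+x. ennreal (exp (- (s * (Y n x - Y m x)))) \<partial>M)"
proof -
  interpret prob_space M by fact
  define w where "w i = (\<integral>\<^sup>+x. ennreal (exp (- (s * (Y (Suc i) x - Y i x)))) \<partial>M)" for i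
  have ind: "indep_vars (\<lambda>_. borel) (\<lambda>t x. Y (Suc t) x - Y t x) UNIV"
    using assms(2) by (simp add: independent_increments_def)
  have *: "(\<integral>\<^sup>+x. ennreal (exp (- (s * (Y l x - Y k x)))) \<partial>M) = (\<Prod>i=k..<l. w i)" if "k \<le> l" for k l
  proof -
    have "Y l x - Y k x = (\<Sum>i=k..<l. Y (Suc i) x - Y i x)" for x
      using that by (subst sum_Suc_diff') auto
    then have "ennreal (exp (- (s * (Y l x - Y k x)))) = (\<Prod>i=k..<l. ennreal (exp (- (s * (Y (Suc i) x - Y i x)))))" for x
      by (subst prod_ennreal) (auto simp: exp_sum[symmetric] sum_distrib_left sum_negf)
    moreover have "indep_vars (\<lambda>_. borel) (\<lambda>i x. ennreal (exp (- (s * (Y (Suc i) x - Y i x))))) {k..<l}"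
      by (rule indep_vars_compose2[OF indep_vars_subset[OF ind]]) auto
    ultimately show ?thesis
      unfolding w_def by (simp add: indep_vars_nn_integral)
  qed
  have "{0..<n} = {0..<m} \<union> {m..<n}" using assms(3) by auto
  then have "(\<Prod>i=0..<n. w i) = (\<Prod>i=0..<m. w i) * (\<Prod>i=m..<n. w i)"
    by (simp add: prod.union_disjoint)
  then show ?thesis using assms(3) by (simp add: *)
qed

text \<open>
  When \<open>d\<close> is negative, \<open>v = exp (- d / 2)\<close> dominates the left-hand side, and
  \<open>v \<le> \<theta> * v\<^sup>2 + 1 / \<theta>\<close>. The point is that the coefficient of \<open>exp (- d)\<close>, whose expectation is
  known, is as small as desired, and that the large term is confined to the rare event \<open>d < b\<close>.
\<close>

lemma exp_scaled_le:
  fixes d b a \<theta> :: real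
  assumes "2 \<le> a" "0 < \<theta>"
  shows "exp (- (1 / a * d)) \<le> exp (- (b / a)) + \<theta> * exp (- d) + (1 + 1 / \<theta>) * (if d < b then 1 else 0)"
proof (cases "d < b")
  case False
  then have "exp (- (1 / a * d)) \<le> exp (- (b / a))" using assms by (simp add: divide_right_mono)
  moreover have "0 \<le> \<theta> * exp (- d)" using assms by simp
  ultimately show ?thesis using False by (simp del: exp_le_cancel_iff)
next
  case True
  have "exp (- (1 / a * d)) \<le> 1 + \<theta> * exp (- d) + 1 / \<theta>"
  proof (cases "0 \<le> d")
    case True
    then have "exp (- (1 / a * d)) \<le> 1" using assms by simp
    moreover have "0 \<le> \<theta> * exp (- d) + 1 / \<theta>" using assms by simp
    ultimately show ?thesis by linarith
  next
    case False
    define v where "v = exp (- d / 2)"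
    have v: "0 < v" "exp (- d) = v * v" by (auto simp: v_def exp_add[symmetric])
    have "- (1 / a * d) \<le> - d / 2" using assms False by (simp add: field_simps)
    then have "exp (- (1 / a * d)) \<le> v" by (simp add: v_def)
    also have "v \<le> \<theta> * (v * v) + 1 / \<theta>"
    proof (cases "v \<le> 1 / \<theta>")
      case True
      then show ?thesis using v assms by (simp add: add_increasing)
    next
      case False
      then have "1 \<le> \<theta> * v" using assms by (simp add: field_simps)
      then have "1 * v \<le> \<theta> * v * v" using v by (intro mult_right_mono) auto
      moreover have "0 < 1 / \<theta>" using assms by simp
      ultimately show ?thesis unfolding mult.assoc by linarith
    qed
    finally show ?thesis using v by simp
  qed
  moreover have "0 < exp (- (b / a))" by simp
  ultimately show ?thesis using True by (simp del: exp_gt_zero)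
qed

lemma nn_integral_exp_scaled_le:
  fixes D :: "'b \<Rightarrow> real"
  assumes "prob_space M" and [measurable]: "D \<in> borel_measurable M"
    and D: "(\<integral>\<^sup>+x. ennreal (exp (- D x)) \<partial>M) \<le> 1" and "2 \<le> a" "0 < \<theta>"
  shows "(\<integral>\<^sup>+x. ennreal (exp (- (1 / a * D x))) \<partial>M)
    \<le> ennreal (exp (- (b / a)) + \<theta> + (1 + 1 / \<theta>) * measure M {x \<in> space M. D x < b})"
proof -
  interpret prob_space M by fact
  define B where "B = {x \<in> space M. D x < b}"
  have [measurable]: "B \<in> sets M" by (simp add: B_def)
  have "(\<integral>\<^sup>+x. ennreal (exp (- (1 / a * D x))) \<partial>M)
     \<le> (\<integral>\<^sup>+x. ennreal (exp (- (b / a))) + (ennreal \<theta> * ennreal (exp (- D x)) + ennreal (1 + 1 / \<theta>) * indicator B x) \<partial>M)"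
  proof (rule nn_integral_mono)
    fix x assume x: "x \<in> space M"
    have "ennreal (exp (- (1 / a * D x)))
      \<le> ennreal (exp (- (b / a)) + (\<theta> * exp (- D x) + (1 + 1 / \<theta>) * (if D x < b then 1 else 0)))"
      using exp_scaled_le[OF assms(4,5), of "D x" b] by (intro ennreal_leI) simp
    also have "\<dots> = ennreal (exp (- (b / a))) + (ennreal (\<theta> * exp (- D x)) + ennreal ((1 + 1 / \<theta>) * (if D x < b then 1 else 0)))"
      using assms by (subst ennreal_plus, simp, simp, subst ennreal_plus) auto
    also have "\<dots> = ennreal (exp (- (b / a))) + (ennreal \<theta> * ennreal (exp (- D x)) + ennreal (1 + 1 / \<theta>) * indicator B x)"
      using assms x by (simp add: ennreal_mult B_def indicator_def)
    finally show "ennreal (exp (- (1 / a * D x))) \<le> \<dots>" .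
  qed
  also have "\<dots> = ennreal (exp (- (b / a))) + (ennreal \<theta> * (\<integral>\<^sup>+x. ennreal (exp (- D x)) \<partial>M) + ennreal (1 + 1 / \<theta>) * emeasure M B)"
    by (subst nn_integral_add, measurable, subst nn_integral_add, measurable)
       (simp add: emeasure_space_1 nn_integral_cmult nn_integral_cmult_indicator)
  also have "\<dots> \<le> ennreal (exp (- (b / a))) + (ennreal \<theta> * 1 + ennreal (1 + 1 / \<theta>) * emeasure M B)"
    using D by (intro add_mono mult_left_mono order_refl) auto
  also have "\<dots> = ennreal (exp (- (b / a)) + \<theta> + (1 + 1 / \<theta>) * measure M B)"
    using assms by (simp add: emeasure_eq_measure ennreal_mult[symmetric] ennreal_plus[symmetric] add.assoc del: ennreal_plus)
  finally show ?thesis by (simp only: B_def)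
qed

text \<open>
  Compare with the telescoping sum of \<open>a / (n (n + 1))\<close>. The bound is uniform in \<open>a\<close> because the
  series starts at \<open>a\<close>.
\<close>

lemma sum_inverse_square_tail_le:
  fixes a :: real
  assumes "1 \<le> a"
  shows "(\<Sum>n\<le>k. if a \<le> real n then a / (real n)\<^sup>2 else 0) \<le> (if a \<le> real k then 2 - a / real k else 0)"
proof (induction k)
  case (Suc k)
  show ?case
  proof (cases "a \<le> real k")
    case True
    have k: "0 < real k" using True assms by linarith
    have "a / (real (Suc k))\<^sup>2 \<le> a / (real k * real (Suc k))"
      using k assms by (intro divide_left_mono) (auto simp: power2_eq_square)
    also have "\<dots> = a / real k - a / real (Suc k)" using k by (simp add: field_simps)
    finally show ?thesis using Suc True by simp
  next
    case False
    have "a / (real (Suc k))\<^sup>2 \<le> 2 - a / real (Suc k)" if "a \<le> real (Suc k)"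
    proof -
      have *: "a / real (Suc k) \<le> 1" using that by simp
      have "a / (real (Suc k))\<^sup>2 = a / real (Suc k) * (1 / real (Suc k))" by (simp add: power2_eq_square)
      also have "\<dots> \<le> 1 * 1" using * assms by (intro mult_mono) auto
      finally show ?thesis using * by linarith
    qed
    then show ?thesis using Suc False by auto
  qed
qed (use assms in auto)

lemma independent_increments_uminus:
  assumes "prob_space M" "independent_increments M Z"
  shows "independent_increments M (\<lambda>t x. - Z t x)"
proof -
  interpret prob_space M by fact
  have "indep_vars (\<lambda>_. borel) (\<lambda>t x. - (Z (Suc t) x - Z t x)) UNIV"
    using assms(2) unfolding independent_increments_def by (rule indep_vars_compose2) auto
  then show ?thesis by (simp add: independent_increments_def)
qed

text \<open>
  Let \<open>G n = E (exp (- Y n / a))\<close> and \<open>m = n div C\<close>. Independence gives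
  \<open>G n = G m * E (exp (- (Y n - Y m) / a))\<close>. If \<open>n \<ge> C a\<close>, then with high probability \<open>Y n - Y m\<close>
  exceeds \<open>n I / 4 \<ge> C a I / 4\<close>, which makes the exponential at most \<open>exp (- C I / 4)\<close>; on the
  exceptional event \<open>exp_scaled_le\<close> applies, because \<open>E (exp (- (Y n - Y m))) = 1\<close>. So each
  multiplication of \<open>n\<close> by \<open>C\<close> reduces \<open>G\<close> by a factor \<open>3 * \<kappa>\<close>, and \<open>\<kappa>\<close> can be taken much smaller
  than \<open>C ^ (- s)\<close>: the exponential beats every power of \<open>C\<close>, and the probability of the exceptional
  event tends to \<open>0\<close> as \<open>a\<close> grows while \<open>C\<close> is fixed.
\<close>

lemma lower_deviation_of_independent_increments:
  fixes I :: real and s :: nat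
  assumes "prob_space M" "0 < I"
    and [measurable]: "\<And>n. Y n \<in> borel_measurable M"
    and Y0: "\<And>x. Y 0 x = 0"
    and ind: "independent_increments M Y"
    and mgf: "\<And>n. (\<integral>\<^sup>+x. ennreal (exp (- Y n x)) \<partial>M) = 1"
    and conv: "AE x in M. (\<lambda>n. Y n x / real n) \<longlonglongrightarrow> I"
    and "0 < \<delta>"
  shows "\<exists>C\<ge>3. \<exists>a0\<ge>2. \<forall>a\<ge>a0. \<forall>n. real C * a \<le> real n \<longrightarrow>
           measure M {x \<in> space M. Y n x < a} \<le> \<delta> * (a / real n) ^ s"
proof -
  interpret prob_space M by fact
  have mult: "(\<integral>\<^sup>+x. ennreal (exp (- (u * Y n x))) \<partial>M)
      = (\<integral>\<^sup>+x. ennreal (exp (- (u * Y m x))) \<partial>M) * (\<integral>\<^sup>+x. ennreal (exp (- (u * (Y n x - Y m x)))) \<partial>M)"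
    if "m \<le> n" for u m n
    using nn_integral_exp_increment_mult[OF assms(1) ind that, of u] by (simp add: Y0)
  have mgf_incr: "(\<integral>\<^sup>+x. ennreal (exp (- (Y n x - Y m x))) \<partial>M) \<le> 1" if "m \<le> n" for m n
    using mult[OF that, of 1] mgf by simp
  \<comment> \<open>The constant is chosen so that \<open>\<kappa> = 1 / (K C ^ (2 s))\<close> closes the induction for \<open>G\<close>
    and leaves a factor \<open>\<delta>\<close> to spare.\<close>
  define K :: real where "K = 3 * 2 ^ s * (1 + 2 * exp 1 / \<delta>)"
  have K: "3 * 2 ^ s \<le> K" "6 * 2 ^ s * exp 1 \<le> \<delta> * K" "0 < K"
    using \<open>0 < \<delta>\<close> by (auto simp: K_def field_simps add_pos_pos)
  have "\<forall>\<^sub>F C in sequentially. K * real C ^ (2 * s) \<le> exp (real C * I / 4)"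
  proof -
    have "filterlim (\<lambda>C. real C * (I / 4)) at_top sequentially"
      using \<open>0 < I\<close> by (intro filterlim_at_top_mult_tendsto_pos[OF tendsto_const] filterlim_real_sequentially) auto
    then have "((\<lambda>C. (real C * (I / 4)) ^ (2 * s) / exp (real C * (I / 4))) \<longlongrightarrow> 0) sequentially"
      by (rule filterlim_compose[OF tendsto_power_div_exp_0])
    moreover have "0 < 1 / (K * (4 / I) ^ (2 * s))" using K \<open>0 < I\<close> by simp
    ultimately have "\<forall>\<^sub>F C in sequentially.
        (real C * (I / 4)) ^ (2 * s) / exp (real C * (I / 4)) < 1 / (K * (4 / I) ^ (2 * s))"
      by (rule order_tendstoD)
    then show ?thesis
    proof eventually_elim
      case (elim C)
      have "X * W < E" if "X / E < 1 / W" "0 < W" "0 < E" for X W E :: real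
        using that by (simp add: field_simps)
      from this[OF elim] have "(real C * (I / 4)) ^ (2 * s) * (K * (4 / I) ^ (2 * s)) < exp (real C * (I / 4))"
        using K \<open>0 < I\<close> by simp
      also have "(real C * (I / 4)) ^ (2 * s) * (K * (4 / I) ^ (2 * s)) = K * real C ^ (2 * s)"
        using \<open>0 < I\<close> by (simp add: power_mult_distrib power_divide field_simps)
      finally show ?case by simp
    qed
  qed
  then have "\<forall>\<^sub>F C in sequentially. K * real C ^ (2 * s) \<le> exp (real C * I / 4) \<and> 3 \<le> C"
    using eventually_ge_at_top[of 3] by eventually_elim simp
  then obtain C where C: "K * real C ^ (2 * s) \<le> exp (real C * I / 4)" "3 \<le> C"
    using eventually_happens'[OF sequentially_bot] by blast
  define \<kappa> where "\<kappa> = 1 / (K * real C ^ (2 * s))"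
  have \<kappa>: "0 < \<kappa>" using K C by (simp add: \<kappa>_def)
  have exp_C: "exp (- (real C * I / 4)) \<le> \<kappa>"
    using C K by (simp add: \<kappa>_def exp_minus field_simps)
  have eq: "3 * \<kappa> * (2 * real C) ^ s * real C ^ s = 3 * 2 ^ s / K"
  proof -
    have "real C ^ (2 * s) = real C ^ s * real C ^ s" by (simp add: mult_2 power_add)
    then show ?thesis using C K by (simp add: \<kappa>_def power_mult_distrib field_simps)
  qed
  have \<kappa>C: "3 * \<kappa> * (2 * real C) ^ s * real C ^ s \<le> 1" "3 * \<kappa> * (2 * real C) ^ s * real C ^ s * (2 * exp 1) \<le> \<delta>"
    unfolding eq using K by (simp_all add: field_simps)
  have "3 * \<kappa> * (2 * real C) ^ s * 1 \<le> 3 * \<kappa> * (2 * real C) ^ s * real C ^ s"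
    using C \<kappa> by (intro mult_left_mono) auto
  with \<kappa>C have \<kappa>C1: "3 * \<kappa> * (2 * real C) ^ s \<le> 1" by simp
  \<comment> \<open>The probability of the exceptional event that makes its contribution at most \<open>\<kappa>\<close>.\<close>
  define \<zeta> where "\<zeta> = \<kappa> / (1 + 1 / \<kappa>)"
  have "0 < 1 + 1 / \<kappa>" using \<kappa> by (intro add_pos_pos) auto
  then have \<zeta>: "0 < \<zeta>" "(1 + 1 / \<kappa>) * \<zeta> = \<kappa>" using \<kappa> by (simp_all add: \<zeta>_def)
  define E where "E n = {x \<in> space M. \<not> \<bar>Y n x / real n - I\<bar> < I / 4}" for n
  have [measurable]: "E n \<in> sets M" for n by (simp add: E_def)
  have "(\<lambda>n. measure M (E n)) \<longlonglongrightarrow> 0"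
  proof (rule measure_tendsto_0_of_AE)
    show "AE x in M. \<forall>\<^sub>F n in sequentially. x \<notin> E n"
      using conv
    proof eventually_elim
      case (elim x)
      then have "\<forall>\<^sub>F n in sequentially. dist (Y n x / real n) I < I / 4"
        using \<open>0 < I\<close> by (intro tendstoD) auto
      then show ?case by eventually_elim (simp add: E_def dist_real_def)
    qed
  qed simp
  moreover have "0 < \<zeta> / 2" using \<zeta> by simp
  ultimately have "\<forall>\<^sub>F n in sequentially. measure M (E n) < \<zeta> / 2"
    by (rule order_tendstoD)
  then obtain n0 where n0: "\<And>n. n0 \<le> n \<Longrightarrow> measure M (E n) < \<zeta> / 2"
    by (auto simp: eventually_sequentially)
  define a0 where "a0 = max 2 (real n0 + 1)"
  have main: "measure M {x \<in> space M. Y n x < a} \<le> \<delta> * (a / real n) ^ s"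
    if a: "a0 \<le> a" and nC: "real C * a \<le> real n" for a n
  proof -
    have a2: "2 \<le> a" and an0: "real n0 + 1 \<le> a" using a by (auto simp: a0_def)
    define G where "G n = (\<integral>\<^sup>+x. ennreal (exp (- (1 / a * Y n x))) \<partial>M)" for n
    have G2: "G n \<le> 2" for n
    proof -
      have "G n \<le> (\<integral>\<^sup>+x. 1 + ennreal (exp (- Y n x)) \<partial>M)"
        unfolding G_def
      proof (rule nn_integral_mono)
        fix x
        have "exp (- (1 / a * Y n x)) \<le> 1 + exp (- Y n x)"
        proof (cases "0 \<le> Y n x")
          case True
          then have "exp (- (1 / a * Y n x)) \<le> 1" using a2 by simp
          then show ?thesis by (simp add: add_increasing2)
        next
          case False
          then have "exp (- (1 / a * Y n x)) \<le> exp (- Y n x)" using a2 by (simp add: field_simps)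
          then show ?thesis by linarith
        qed
        then have "ennreal (exp (- (1 / a * Y n x))) \<le> ennreal (1 + exp (- Y n x))" by (rule ennreal_leI)
        then show "ennreal (exp (- (1 / a * Y n x))) \<le> 1 + ennreal (exp (- Y n x))" by simp
      qed
      also have "\<dots> = 2" by (subst nn_integral_add) (auto simp: mgf emeasure_space_1)
      finally show ?thesis .
    qed
    have recursion: "1 \<le> n div C \<and> real n \<le> 2 * real C * real (n div C) \<and> G n \<le> ennreal (3 * \<kappa>) * G (n div C)"
      if nC: "real C * a \<le> real n" for n
    proof -
      define m where "m = n div C"
      have "n mod C < C" using C by simp
      then have "n < C * m + C" using mult_div_mod_eq[of C n] unfolding m_def by linarith
      then have "n < C * (m + 1)" by simp
      then have *: "real n < real C * (real m + 1)" by (metis of_nat_1 of_nat_add of_nat_less_iff of_nat_mult)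
      then have "real C * a < real C * (real m + 1)" using nC by linarith
      then have am: "a < real m + 1" using C by simp
      then have m1: "1 \<le> m" "n0 \<le> m" using a2 an0 by linarith+
      have "C * m \<le> n" by (simp add: m_def)
      then have mn: "real C * real m \<le> real n" by (metis of_nat_le_iff of_nat_mult)
      have "real C * (real m + 1) \<le> 2 * real C * real m" using m1 C by (simp add: algebra_simps)
      then have n2: "real n \<le> 2 * real C * real m" using * by linarith
      have "m \<le> n" by (simp add: m_def)
      then have n1: "n0 \<le> n" "1 \<le> n" using m1 by linarith+
      define b where "b = real n * I / 4"
      define D where "D = {x \<in> space M. Y n x - Y m x < b}"
      have [measurable]: "D \<in> sets M" by (simp add: D_def)
      have "D \<subseteq>
          E n \<union> E m"
      \<comment> \<open>If \<open>Y n > 3/4 I n\<close> and \<open>Y m < 5/4 I m\<close>, then the increment exceeds \<open>b\<close>, because \<open>m \<le> n / 3\<close>.\<close>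
      proof (rule subsetI, rule ccontr)
        fix x assume x: "x \<in> D"
          "x \<notin> E n \<union> E m"
        then have "\<bar>Y n x / real n - I\<bar> < I / 4" "\<bar>Y m x / real m - I\<bar> < I / 4" by (auto simp: D_def E_def)
        then have "3 * I / 4 < Y n x / real n" "Y m x / real m < 5 * I / 4" by linarith+
        then have "3 * I / 4 * real n < Y n x" "Y m x < 5 * I / 4 * real m"
          using m1 n1 by (simp_all add: field_simps)
        moreover have "3 * real m \<le> real n"
          using mn C by (meson mult_right_mono of_nat_0_le_iff of_nat_le_iff order_trans of_nat_numeral numeral_le_real_of_nat_iff)
        then have "3 * real m * I \<le> real n * I" using \<open>0 < I\<close> by (intro mult_right_mono) auto
        moreover have "0 \<le> real m * I" using \<open>0 < I\<close> by simp
        ultimately show False using x(1) by (simp add: D_def b_def algebra_simps)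
      qed
      then have "measure M D \<le> \<zeta>"
        using n0[OF m1(2)] n0[OF n1(1)]
        by (intro order_trans[OF finite_measure_mono order_trans[OF measure_Un_le]]) auto
      then have "(1 + 1 / \<kappa>) * measure M D \<le> (1 + 1 / \<kappa>) * \<zeta>"
        using \<kappa> by (intro mult_left_mono) auto
      then have prob: "(1 + 1 / \<kappa>) * measure M D \<le> \<kappa>" using \<zeta> by simp
      have "real C * I / 4 \<le> b / a"
      proof -
        have "real C * a * I \<le> real n * I" using nC \<open>0 < I\<close> by (intro mult_right_mono) auto
        then show ?thesis using a2 by (simp add: b_def field_simps)
      qed
      then have "exp (- (b / a)) \<le> exp (- (real C * I / 4))" by simp
      with exp_C have eb: "exp (- (b / a)) \<le> \<kappa>" by (rule order_trans[rotated])
      have "(\<integral>\<^sup>+x. ennreal (exp (- (1 / a * (Y n x - Y m x)))) \<partial>M)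
          \<le> ennreal (exp (- (b / a)) + \<kappa> + (1 + 1 / \<kappa>) * measure M D)"
        using mgf_incr[OF \<open>m \<le> n\<close>] a2 \<kappa> assms(1) unfolding D_def by (intro nn_integral_exp_scaled_le) auto
      also have "\<dots> \<le> ennreal (3 * \<kappa>)" using prob eb by (intro ennreal_leI) linarith
      finally have "G m * (\<integral>\<^sup>+x. ennreal (exp (- (1 / a * (Y n x - Y m x)))) \<partial>M) \<le> G m * ennreal (3 * \<kappa>)"
        by (intro mult_left_mono) auto
      then have "G n \<le> ennreal (3 * \<kappa>) * G m"
        unfolding G_def mult[OF \<open>m \<le> n\<close>, of "1 / a"] by (simp add: mult.commute)
      then show ?thesis using m1 n2 by (simp add: m_def)
    qed
    have step: "(a / real (n div C)) ^ s \<le> (2 * real C) ^ s * (a / real n) ^ s" if "real C * a \<le> real n" for n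
    proof -
      have n: "0 < real n" "real n \<le> 2 * real C * real (n div C)" "1 \<le> n div C"
      proof -
        have "0 < real C * a" using C a2 by simp
        with that show "0 < real n" by linarith
      qed (use recursion[OF that] in auto)
      have "a * real n \<le> a * (2 * real C * real (n div C))" using n a2 by (intro mult_left_mono) auto
      then have "a / real (n div C) \<le> 2 * real C * (a / real n)" using n by (simp add: field_simps)
      then have "(a / real (n div C)) ^ s \<le> (2 * real C * (a / real n)) ^ s" using a2 by (intro power_mono) auto
      then show ?thesis unfolding power_mult_distrib[symmetric] .
    qed
    \<comment> \<open>For \<open>n < C a\<close> the right-hand side is at least \<open>2\<close>, which bounds \<open>G\<close> trivially.\<close>
    have G_le: "G n \<le> ennreal (2 * real C ^ s * (a / real n) ^ s)" if "1 \<le> n" for n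
      using that
    proof (induction n rule: less_induct)
      case (less n)
      show ?case
      proof (cases "real C * a \<le> real n")
        case True
        have lt: "n div C < n" using less.prems C by (intro div_less_dividend) auto
        have "G n \<le> ennreal (3 * \<kappa>) * G (n div C)" using recursion[OF True] by simp
        also have "\<dots> \<le> ennreal (3 * \<kappa>) * ennreal (2 * real C ^ s * (a / real (n div C)) ^ s)"
          using less.IH[OF lt] recursion[OF True] by (intro mult_left_mono) auto
        also have "\<dots> = ennreal (3 * \<kappa> * (2 * real C ^ s * (a / real (n div C)) ^ s))"
          using \<kappa> a2 by (subst ennreal_mult) auto
        also have "\<dots> \<le> ennreal (2 * real C ^ s * (a / real n) ^ s)"
        proof (rule ennreal_leI)
          have "3 * \<kappa> * (2 * real C ^ s * (a / real (n div C)) ^ s)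
            \<le> 3 * \<kappa> * (2 * real C ^ s * ((2 * real C) ^ s * (a / real n) ^ s))"
            using \<kappa> step[OF True] by (intro mult_left_mono) auto
          also have "\<dots> = 3 * \<kappa> * (2 * real C) ^ s * (2 * real C ^ s * (a / real n) ^ s)" by simp
          also have "\<dots> \<le> 1 * (2 * real C ^ s * (a / real n) ^ s)"
            using \<kappa>C1 a2 by (intro mult_right_mono) auto
          finally show "3 * \<kappa> * (2 * real C ^ s * (a / real (n div C)) ^ s) \<le> 2 * real C ^ s * (a / real n) ^ s"
            by simp
        qed
        finally show ?thesis .
      next
        case False
        have "1 \<le> (real C * a / real n) ^ s"
          using False less.prems by (intro one_le_power) (auto simp: field_simps)
        also have "\<dots> = real C ^ s * (a / real n) ^ s" by (simp add: power_mult_distrib[symmetric])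
        finally have "ennreal 2 \<le> ennreal (2 * real C ^ s * (a / real n) ^ s)" by (intro ennreal_leI) simp
        with G2[of n] show ?thesis by (simp only: ennreal_numeral)
      qed
    qed
    have "ennreal (measure M {x \<in> space M. Y n x < a}) = (\<integral>\<^sup>+x. indicator {x \<in> space M. Y n x < a} x \<partial>M)"
      by (simp add: emeasure_eq_measure)
    also have "\<dots> \<le> (\<integral>\<^sup>+x. ennreal (exp 1) * ennreal (exp (- (1 / a * Y n x))) \<partial>M)"
    proof (rule nn_integral_mono)
      fix x
      show "indicator {x \<in> space M. Y n x < a} x \<le> ennreal (exp 1) * ennreal (exp (- (1 / a * Y n x)))"
        using a2 by (auto simp: indicator_def ennreal_mult[symmetric] exp_add[symmetric] field_simps)
    qed
    also have "\<dots> = ennreal (exp 1) * G n" unfolding G_def by (rule nn_integral_cmult) simp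
    also have "\<dots> \<le> ennreal (exp 1) * (ennreal (3 * \<kappa>) * ennreal (2 * real C ^ s * (a / real (n div C)) ^ s))"
    proof (intro mult_left_mono)
      have "G n \<le> ennreal (3 * \<kappa>) * G (n div C)" using recursion[OF nC] by simp
      also have "\<dots> \<le> ennreal (3 * \<kappa>) * ennreal (2 * real C ^ s * (a / real (n div C)) ^ s)"
        using recursion[OF nC] by (intro mult_left_mono G_le) auto
      finally show "G n \<le> ennreal (3 * \<kappa>) * ennreal (2 * real C ^ s * (a / real (n div C)) ^ s)" .
    qed simp
    also have "\<dots> = ennreal (exp 1 * (3 * \<kappa> * (2 * real C ^ s * (a / real (n div C)) ^ s)))"
      using \<kappa> a2 by (subst ennreal_mult[of "exp 1"], simp, simp, subst ennreal_mult[of "3 * \<kappa>"]) auto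
    finally have "measure M {x \<in> space M. Y n x < a} \<le> exp 1 * (3 * \<kappa> * (2 * real C ^ s * (a / real (n div C)) ^ s))"
      using \<kappa> a2 by (subst (asm) ennreal_le_iff) auto
    also have "\<dots> \<le> exp 1 * (3 * \<kappa> * (2 * real C ^ s * ((2 * real C) ^ s * (a / real n) ^ s)))"
      using \<kappa> step[OF nC] by (intro mult_left_mono) auto
    also have "\<dots> = 3 * \<kappa> * (2 * real C) ^ s * real C ^ s * (2 * exp 1) * (a / real n) ^ s" by simp
    also have "\<dots> \<le> \<delta> * (a / real n) ^ s" using \<kappa>C a2 by (intro mult_right_mono) auto
    finally show ?thesis .
  qed
  have "2 \<le> a0" by (simp add: a0_def)
  with main C(2) show ?thesis by blast
qed

text \<open>
  The sum is split at \<open>n = C a\<close>. Below, there are of order \<open>a\<close> many terms, each with a weight of order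
  at most \<open>a ^ (r - 1)\<close> and a probability that tends to \<open>0\<close> by the law of large numbers assumed for
  \<open>Y\<close>. Above, only the level \<open>a\<close> matters, and the previous lemma with exponent \<open>r + 1\<close> leaves the
  summable \<open>a ^ (r + 1) / n\<^sup>2\<close>.
\<close>

lemma tail_negligible_of_independent_increments:
  fixes I :: real
  assumes "prob_space M" "0 < I" "1 \<le> r"
    and [measurable]: "\<And>n. Y n \<in> borel_measurable M"
    and Y0: "\<And>x. Y 0 x = 0"
    and ind: "independent_increments M Y"
    and mgf: "\<And>n. (\<integral>\<^sup>+x. ennreal (exp (- Y n x)) \<partial>M) = 1"
    and conv: "AE x in M. (\<lambda>n. Y n x / real n) \<longlonglongrightarrow> I"
  shows "tail_negligible M Y I r"
  unfolding tail_negligible_def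
proof (intro allI impI)
  fix \<rho> c \<delta> :: real assume "1 < \<rho>" "0 < c" "0 < \<delta>"
  interpret prob_space M by fact
  obtain C a0 where C: "3 \<le> C" "2 \<le> a0" and dev: "\<And>a n. a0 \<le> a \<Longrightarrow> real C * a \<le> real n \<Longrightarrow>
           measure M {x \<in> space M. Y n x < a} \<le> \<delta> / 4 * (a / real n) ^ (r + 1)"
    using lower_deviation_of_independent_increments[OF assms(1,2,4) Y0 ind mgf conv, of "\<delta> / 4" "r + 1"] \<open>0 < \<delta>\<close>
    by auto
  define \<zeta> where "\<zeta> = \<delta> / (2 * (2 * real C) ^ r)"
  have \<zeta>: "0 < \<zeta>" "\<zeta> * (2 * real C) ^ r = \<delta> / 2" using \<open>0 < \<delta>\<close> C by (auto simp: \<zeta>_def)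
  have "I / \<rho> < I" using \<open>1 < \<rho>\<close> \<open>0 < I\<close> by (simp add: field_simps)
  have "(\<lambda>n. measure M {x \<in> space M. \<not> I / \<rho> < Y n x / real n}) \<longlonglongrightarrow> 0"
  proof (rule measure_tendsto_0_of_AE)
    show "AE x in M. \<forall>\<^sub>F n in sequentially. x \<notin> {x \<in> space M. \<not> I / \<rho> < Y n x / real n}"
      using conv
    proof eventually_elim
      case (elim x)
      then have "\<forall>\<^sub>F n in sequentially. I / \<rho> < Y n x / real n"
        using \<open>I / \<rho> < I\<close> by (rule order_tendstoD)
      then show ?case by eventually_elim simp
    qed
  qed simp
  then have "\<forall>\<^sub>F n in sequentially. measure M {x \<in> space M. \<not> I / \<rho> < Y n x / real n} < \<zeta>"
    using \<zeta> by (intro order_tendstoD) auto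
  then obtain n0 where n0: "\<And>n. n0 \<le> n \<Longrightarrow> measure M {x \<in> space M. \<not> I / \<rho> < Y n x / real n} < \<zeta>"
    by (auto simp: eventually_sequentially)
  define a1 where "a1 = max a0 (real n0 / c)"
  show "\<forall>\<^sub>F a in at_top.
        (\<Sum>n. ennreal (real n ^ (r - 1)) *
           emeasure M {x \<in> space M. c * a \<le> real n \<and> Y n x < min (real n * I / \<rho>) a})
        \<le> ennreal (\<delta> * a ^ r)"
    using eventually_ge_at_top[of a1]
  proof eventually_elim
    case (elim a)
    then have a: "a0 \<le> a" "2 \<le> a" "real n0 \<le> c * a" using \<open>0 < c\<close> C by (auto simp: a1_def field_simps)
    define p where "p n = measure M {x \<in> space M. c * a \<le> real n \<and> Y n x < min (real n * I / \<rho>) a}" for n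
    define u where "u n = (if real n < real C * a then \<zeta> * (real C * a) ^ (r - 1) else 0)" for n
    define v where "v n = (if a \<le> real n then \<delta> / 4 * a ^ r * (a / (real n)\<^sup>2) else 0)" for n
    have "1 * 1 \<le> real C * a" using a C by (intro mult_mono) auto
    then have ca: "0 < c * a" "1 \<le> real C * a" using \<open>0 < c\<close> a by auto
    have u0: "0 \<le> u n" and v0: "0 \<le> v n" for n using \<zeta> a \<open>0 < \<delta>\<close> by (auto simp: u_def v_def)
    have puv: "real n ^ (r - 1) * p n \<le> u n + v n" for n
    proof (cases "c * a \<le> real n")
      case False
      then have "p n = 0" by (simp add: p_def)
      then show ?thesis using u0[of n] v0[of n] by simp
    next
      case True
      have n: "0 < real n" "n0 \<le> n" using True ca a by linarith+
      show ?thesis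
      proof (cases "real n < real C * a")
        case True
        have "p n \<le> measure M {x \<in> space M. \<not> I / \<rho> < Y n x / real n}"
          unfolding p_def using n by (intro finite_measure_mono) (auto simp: field_simps)
        also have "\<dots> \<le> \<zeta>" using n0[OF n(2)] by simp
        finally have "real n ^ (r - 1) * p n \<le> (real C * a) ^ (r - 1) * \<zeta>"
          using True by (intro mult_mono power_mono) (auto simp: p_def)
        then show ?thesis using True v0[of n] by (simp add: u_def mult.commute)
      next
        case False
        have "1 * a \<le> real C * a" using C a by (intro mult_right_mono) auto
        then have "a \<le> real n" using False by linarith
        have "p n \<le> measure M {x \<in> space M. Y n x < a}"
          unfolding p_def by (intro finite_measure_mono) auto
        also have "\<dots> \<le> \<delta> / 4 * (a / real n) ^ (r + 1)" using dev[OF a(1)] False by simp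
        finally have "real n ^ (r - 1) * p n \<le> real n ^ (r - 1) * (\<delta> / 4 * (a / real n) ^ (r + 1))"
          by (intro mult_left_mono) auto
        also have "\<dots> = \<delta> / 4 * a ^ r * (a / (real n)\<^sup>2)"
        proof -
          obtain r' where r': "r = Suc r'" using \<open>1 \<le> r\<close> by (cases r) auto
          show ?thesis using n by (simp add: r' power_divide power2_eq_square field_simps)
        qed
        finally show ?thesis using \<open>a \<le> real n\<close> u0[of n] by (simp add: v_def)
      qed
    qed
    have "(\<Sum>n. ennreal (real n ^ (r - 1)) *
           emeasure M {x \<in> space M. c * a \<le> real n \<and> Y n x < min (real n * I / \<rho>) a})
       = (\<Sum>n. ennreal (real n ^ (r - 1) * p n))"
      by (simp add: p_def emeasure_eq_measure ennreal_mult)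
    also have "\<dots> \<le> ennreal (\<delta> * a ^ r)"
    proof (rule suminf_le_const)
      fix k
      have "(\<Sum>n<k. real n ^ (r - 1) * p n) \<le> (\<Sum>n<k. u n + v n)" by (intro sum_mono puv)
      also have "\<dots> = (\<Sum>n<k. u n) + (\<Sum>n<k. v n)" by (rule sum.distrib)
      also have "(\<Sum>n<k. u n) \<le> \<delta> / 2 * a ^ r"
      proof -
        have "(\<Sum>n<k. u n) = (\<Sum>n\<in>{n\<in>{..<k}. real n < real C * a}. \<zeta> * (real C * a) ^ (r - 1))"
          unfolding u_def by (subst sum.inter_filter) auto
        also have "\<dots> = real (card {n\<in>{..<k}. real n < real C * a}) * (\<zeta> * (real C * a) ^ (r - 1))" by simp
        also have "\<dots> \<le> (2 * (real C * a)) * (\<zeta> * (real C * a) ^ (r - 1))"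
        proof (rule mult_right_mono)
          have "{n\<in>{..<k}. real n < real C * a} \<subseteq> {..nat \<lfloor>real C * a\<rfloor>}"
            by (auto simp: le_nat_floor)
          then have "card {n\<in>{..<k}. real n < real C * a} \<le> card {..nat \<lfloor>real C * a\<rfloor>}" by (intro card_mono) auto
          also have "\<dots> = nat \<lfloor>real C * a\<rfloor> + 1" by simp
          finally have "real (card {n\<in>{..<k}. real n < real C * a}) \<le> real (nat \<lfloor>real C * a\<rfloor>) + 1" by linarith
          also have "real (nat \<lfloor>real C * a\<rfloor>) \<le> real C * a" using ca by linarith
          finally show "real (card {n\<in>{..<k}. real n < real C * a}) \<le> 2 * (real C * a)" using ca by linarith
        qed (use \<zeta> a in auto)
        also have "\<dots> = 2 * \<zeta> * (real C * a) ^ r" using \<open>1 \<le> r\<close> by (cases r) auto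
        also have "\<dots> \<le> 2 ^ r * \<zeta> * (real C * a) ^ r"
          using \<zeta> a \<open>1 \<le> r\<close> power_increasing[of 1 r "2::real"] by (intro mult_right_mono) auto
        also have "\<dots> = \<zeta> * (2 * real C) ^ r * a ^ r" by (simp add: power_mult_distrib)
        finally show ?thesis unfolding \<zeta>(2) .
      qed
      also have "(\<Sum>n<k. v n) \<le> \<delta> / 2 * a ^ r"
      proof -
        have "(\<Sum>n<k. v n) \<le> (\<Sum>n\<le>k. v n)" using v0 by (intro sum_mono2) auto
        also have "\<dots> = \<delta> / 4 * a ^ r * (\<Sum>n\<le>k. if a \<le> real n then a / (real n)\<^sup>2 else 0)"
          unfolding v_def sum_distrib_left by (intro sum.cong) auto
        also have "\<dots> \<le> \<delta> / 4 * a ^ r * 2"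
          using sum_inverse_square_tail_le[of a k] a \<open>0 < \<delta>\<close>
          by (intro mult_left_mono order_trans[OF sum_inverse_square_tail_le]) auto
        finally show ?thesis by simp
      qed
      finally have "(\<Sum>n<k. real n ^ (r - 1) * p n) \<le> \<delta> * a ^ r" by simp
      then have "ennreal (\<Sum>n<k. real n ^ (r - 1) * p n) \<le> ennreal (\<delta> * a ^ r)" by (rule ennreal_leI)
      then show "(\<Sum>n<k. ennreal (real n ^ (r - 1) * p n)) \<le> ennreal (\<delta> * a ^ r)"
        by (subst sum_ennreal) (auto simp: p_def)
    qed simp
    finally show ?case .
  qed
qed

lemma emeasure_PiM_component:
  assumes M: "\<And>i. i \<in> I \<Longrightarrow> prob_space (M i)" and k: "k \<in> I"
    and B: "{x \<in> space (M k). P x} \<in> sets (M k)"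
  shows "emeasure (PiM I M) {\<omega> \<in> space (PiM I M). P (\<omega> k)} = emeasure (M k) {x \<in> space (M k). P x}"
proof -
  have m: "(\<lambda>\<omega>. \<omega> k) \<in> measurable (PiM I M) (M k)" using k by (rule measurable_component_singleton)
  have "emeasure (M k) {x \<in> space (M k). P x} = emeasure (distr (PiM I M) (M k) (\<lambda>\<omega>. \<omega> k)) {x \<in> space (M k). P x}"
    by (subst distr_PiM_component[OF M k]) auto
  also have "\<dots> = emeasure (PiM I M) ((\<lambda>\<omega>. \<omega> k) -` {x \<in> space (M k). P x} \<inter> space (PiM I M))"
    using m B by (rule emeasure_distr)
  also have "(\<lambda>\<omega>. \<omega> k) -` {x \<in> space (M k). P x} \<inter> space (PiM I M) = {\<omega> \<in> space (PiM I M). P (\<omega> k)}"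
    using measurable_space[OF m] by auto
  finally show ?thesis by simp
qed

lemma tail_negligible_PiM_component:
  assumes M: "\<And>i. i \<in> J \<Longrightarrow> prob_space (M i)" and k: "k \<in> J"
    and [measurable]: "\<And>n. Y n \<in> borel_measurable (M k)"
    and tail: "tail_negligible (M k) Y I r"
  shows "tail_negligible (PiM J M) (\<lambda>n \<omega>. Y n (\<omega> k)) I r"
proof -
  have "emeasure (PiM J M) {\<omega> \<in> space (PiM J M). c * a \<le> real n \<and> Y n (\<omega> k) < min (real n * I / \<rho>) a}
      = emeasure (M k) {x \<in> space (M k). c * a \<le> real n \<and> Y n x < min (real n * I / \<rho>) a}" for a c \<rho> n
    by (rule emeasure_PiM_component[OF M k, where P = "\<lambda>x. c * a \<le> real n \<and> Y n x < min (real n * I / \<rho>) a"]) measurable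
  with tail show ?thesis unfolding tail_negligible_def by simp
qed

section \<open>Log-likelihood ratio processes\<close>

text \<open>
  \<open>Y t\<close> is a version of \<open>ln (dM/dN)\<close> on \<open>F t\<close>. It is expressed through the density of \<open>N\<close> with
  respect to \<open>M\<close>, since expectations are always taken under \<open>M\<close>, the law under which \<open>Y\<close> drifts
  upwards.
\<close>

definition llr_process :: "'b measure \<Rightarrow> 'b measure \<Rightarrow> (nat \<Rightarrow> 'b measure) \<Rightarrow> (nat \<Rightarrow> 'b \<Rightarrow> real) \<Rightarrow> bool" where
  "llr_process M N F Y \<longleftrightarrow> (\<forall>t. subalgebra M (F t) \<and> subalgebra N (F t) \<and> Y t \<in> borel_measurable (F t) \<and>
     restr_to_subalg N (F t) = density (restr_to_subalg M (F t)) (\<lambda>x. ennreal (exp (- Y t x))))"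

lemma llr_process_measurable:
  assumes "llr_process M N F Y"
  shows "Y t \<in> borel_measurable M" "Y t \<in> borel_measurable (F t)" "subalgebra M (F t)" "subalgebra N (F t)"
  using assms measurable_from_subalg[of M "F t" "Y t"] by (auto simp: llr_process_def)

lemma llr_process_emeasure:
  assumes Y: "llr_process M N F Y" and B: "B \<in> sets (F t)"
  shows "emeasure N B = (\<integral>\<^sup>+x. ennreal (exp (- Y t x)) * indicator B x \<partial>M)"
proof -
  note m = llr_process_measurable[OF Y]
  have [measurable]: "Y t \<in> borel_measurable (restr_to_subalg M (F t))" "B \<in> sets (restr_to_subalg M (F t))"
    using m B by (auto simp: sets_restr_to_subalg intro: measurable_in_subalg)
  have "emeasure N B = emeasure (restr_to_subalg N (F t)) B"
    using m B by (simp add: emeasure_restr_to_subalg)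
  also have "\<dots> = emeasure (density (restr_to_subalg M (F t)) (\<lambda>x. ennreal (exp (- Y t x)))) B"
    using Y by (simp add: llr_process_def)
  also have "\<dots> = (\<integral>\<^sup>+x. ennreal (exp (- Y t x)) * indicator B x \<partial>(restr_to_subalg M (F t)))"
    by (rule emeasure_density) auto
  also have "\<dots> = (\<integral>\<^sup>+x. ennreal (exp (- Y t x)) * indicator B x \<partial>M)"
    using m B by (intro nn_integral_subalgebra2) auto
  finally show ?thesis .
qed

lemma llr_process_swap:
  assumes Y: "llr_process M N F Y"
  shows "llr_process N M F (\<lambda>t x. - Y t x)"
  unfolding llr_process_def
proof (intro allI conjI)
  fix t
  note m = llr_process_measurable[OF Y]
  show "subalgebra N (F t)" "subalgebra M (F t)" "(\<lambda>x. - Y t x) \<in> borel_measurable (F t)" using m by auto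
  have [measurable]: "Y t \<in> borel_measurable (restr_to_subalg M (F t))"
    using m by (auto intro: measurable_in_subalg)
  have "restr_to_subalg N (F t) = density (restr_to_subalg M (F t)) (\<lambda>x. ennreal (exp (- Y t x)))"
    using Y by (simp add: llr_process_def)
  then have "density (restr_to_subalg N (F t)) (\<lambda>x. ennreal (exp (- (- Y t x))))
     = density (restr_to_subalg M (F t)) (\<lambda>x. ennreal (exp (- Y t x)) * ennreal (exp (- (- Y t x))))"
    by (simp only:) (subst density_density_eq, auto)
  also have "(\<lambda>x. ennreal (exp (- Y t x)) * ennreal (exp (- (- Y t x)))) = (\<lambda>_. 1)"
    by (simp add: ennreal_mult[symmetric] exp_add[symmetric])
  finally show "restr_to_subalg M (F t) = density (restr_to_subalg N (F t)) (\<lambda>x. ennreal (exp (- (- Y t x))))"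
    by (simp add: density_1)
qed

lemma llr_process_nn_integral_exp:
  assumes Y: "llr_process M N F Y" and N: "prob_space N"
  shows "(\<integral>\<^sup>+x. ennreal (exp (- Y t x)) \<partial>M) = 1"
proof -
  have sp: "space M = space N" "space M \<in> sets (F t)"
    using llr_process_measurable(3,4)[OF Y, of t] sets.top[of "F t"] by (auto simp: subalgebra_def)
  have "emeasure N (space N) = (\<integral>\<^sup>+x. ennreal (exp (- Y t x)) * indicator (space M) x \<partial>M)"
    using llr_process_emeasure[OF Y sp(2)] sp(1) by simp
  also have "\<dots> = (\<integral>\<^sup>+x. ennreal (exp (- Y t x)) \<partial>M)" by (intro nn_integral_cong) simp
  finally show ?thesis using prob_space.emeasure_space_1[OF N] by simp
qed

lemma AE_likelihood_ratio_llr_process: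
  assumes "prob_space M" and Y: "llr_process M N F Y"
  shows "AE x in restr_to_subalg M (F t). likelihood_ratio M N (F t) x = exp (- Y t x)"
proof -
  note m = llr_process_measurable[OF Y]
  interpret R: prob_space "restr_to_subalg M (F t)"
    using m assms by (intro prob_space_restr_to_subalg)
  have [measurable]: "Y t \<in> borel_measurable (restr_to_subalg M (F t))"
    using m by (auto intro: measurable_in_subalg)
  have "AE x in restr_to_subalg M (F t). ennreal (exp (- Y t x))
      = RN_deriv (restr_to_subalg M (F t)) (restr_to_subalg N (F t)) x"
    using Y by (intro R.RN_deriv_unique) (auto simp: llr_process_def)
  then show ?thesis
    by eventually_elim (simp add: likelihood_ratio_def flip: enn2real_ennreal)
qed

lemma llr_process_refl:
  assumes "\<And>t. subalgebra M (F t)"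
  shows "llr_process M M F (\<lambda>_ _. 0)"
  using assms by (simp add: llr_process_def density_1)

text \<open>
  Both sides agree on rectangles by Fubini's theorem.
\<close>

lemma density_PiM:
  assumes "finite I" and M: "\<And>k. k \<in> I \<Longrightarrow> prob_space (M k)"
    and d: "\<And>k. k \<in> I \<Longrightarrow> prob_space (density (M k) (f k))"
    and f: "\<And>k. k \<in> I \<Longrightarrow> f k \<in> borel_measurable (M k)"
  shows "PiM I (\<lambda>k. density (M k) (f k)) = density (PiM I M) (\<lambda>\<omega>. \<Prod>k\<in>I. f k (\<omega> k))"
proof -
  \<comment> \<open>The product locale asks for a probability measure at every index, inside \<open>I\<close> or not.\<close>
  define M' where "M' k = (if k \<in> I then M k else return (count_space UNIV) undefined)" for k
  define D where "D k = (if k \<in> I then density (M k) (f k) else return (count_space UNIV) undefined)" for k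
  have pM: "prob_space (M' k)" and pD: "prob_space (D k)" for k
    using M d by (auto simp: M'_def D_def prob_space_return)
  interpret M': product_prob_space M' I using pM by (rule product_prob_spaceI)
  interpret D: product_prob_space D I using pD by (rule product_prob_spaceI)
  have [measurable]: "k \<in> I \<Longrightarrow> f k \<in> borel_measurable (M' k)" for k using f by (simp add: M'_def)
  have sets_D: "k \<in> I \<Longrightarrow> sets (D k) = sets (M' k)" for k by (simp add: D_def M'_def)
  have "density (PiM I M') (\<lambda>\<omega>. \<Prod>k\<in>I. f k (\<omega> k)) = PiM I D"
  proof (rule D.PiM_eqI)
    show "sets (density (PiM I M') (\<lambda>\<omega>. \<Prod>k\<in>I. f k (\<omega> k))) = sets (PiM I D)"
      using sets_D by (auto intro!: sets_PiM_cong)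
    fix A assume A: "\<And>k. k \<in> I \<Longrightarrow> A k \<in> sets (D k)"
    then have A': "\<And>k. k \<in> I \<Longrightarrow> A k \<in> sets (M' k)" using sets_D by auto
    have "emeasure (density (PiM I M') (\<lambda>\<omega>. \<Prod>k\<in>I. f k (\<omega> k))) (Pi\<^sub>E I A)
      = (\<integral>\<^sup>+\<omega>. (\<Prod>k\<in>I. f k (\<omega> k)) * indicator (Pi\<^sub>E I A) \<omega> \<partial>PiM I M')"
      using A' \<open>finite I\<close> by (intro emeasure_density) (auto intro!: sets_PiM_I_finite)
    also have "\<dots> = (\<integral>\<^sup>+\<omega>. (\<Prod>k\<in>I. f k (\<omega> k) * indicator (A k) (\<omega> k)) \<partial>PiM I M')"
    proof (rule nn_integral_cong)
      fix \<omega> assume "\<omega> \<in> space (PiM I M')"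
      then have "(indicator (Pi\<^sub>E I A) \<omega> :: ennreal) = (\<Prod>k\<in>I. indicator (A k) (\<omega> k))"
        using \<open>finite I\<close> by (auto simp: indicator_def space_PiM PiE_def Pi_def prod_zero_iff)
      then show "(\<Prod>k\<in>I. f k (\<omega> k)) * indicator (Pi\<^sub>E I A) \<omega> = (\<Prod>k\<in>I. f k (\<omega> k) * indicator (A k) (\<omega> k))"
        by (simp add: prod.distrib)
    qed
    also have "\<dots> = (\<Prod>k\<in>I. \<integral>\<^sup>+x. f k x * indicator (A k) x \<partial>M' k)"
      using A' \<open>finite I\<close> by (intro M'.product_nn_integral_prod) auto
    also have "\<dots> = (\<Prod>k\<in>I. emeasure (D k) (A k))"
    proof (rule prod.cong[OF refl])
      fix k assume k: "k \<in> I"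
      then show "(\<integral>\<^sup>+x. f k x * indicator (A k) x \<partial>M' k) = emeasure (D k) (A k)"
        using A'[OF k] f[OF k] by (simp add: D_def M'_def emeasure_density)
    qed
    finally show "emeasure (density (PiM I M') (\<lambda>\<omega>. \<Prod>k\<in>I. f k (\<omega> k))) (Pi\<^sub>E I A) = (\<Prod>k\<in>I. emeasure (D k) (A k))" .
  qed fact
  moreover have "PiM I D = PiM I (\<lambda>k. density (M k) (f k))" by (rule PiM_cong) (auto simp: D_def)
  moreover have "PiM I M' = PiM I M" by (rule PiM_cong) (auto simp: M'_def)
  ultimately show ?thesis by simp
qed

lemma restr_to_subalg_PiM:
  assumes "finite I" and M: "\<And>k. k \<in> I \<Longrightarrow> prob_space (M k)"
    and F: "\<And>k. k \<in> I \<Longrightarrow> subalgebra (M k) (F k)"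
    and G: "sets G = sets (PiM I F)"
  shows "subalgebra (PiM I M) G"
    and "restr_to_subalg (PiM I M) G = PiM I (\<lambda>k. restr_to_subalg (M k) (F k))"
proof -
  define M' where "M' k = (if k \<in> I then M k else return (count_space UNIV) undefined)" for k
  define R where "R k = (if k \<in> I then restr_to_subalg (M k) (F k) else return (count_space UNIV) undefined)" for k
  have pM: "prob_space (M' k)" and pR: "prob_space (R k)" for k
    using M F by (auto simp: M'_def R_def prob_space_return prob_space_restr_to_subalg)
  interpret M': product_prob_space M' I using pM by (rule product_prob_spaceI)
  interpret R: product_prob_space R I using pR by (rule product_prob_spaceI)
  have M'M: "PiM I M' = PiM I M" by (rule PiM_cong) (auto simp: M'_def)
  have "(\<lambda>\<omega>. \<omega>) \<in> measurable (PiM I M) (PiM I F)"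
  proof (rule measurable_PiM_single')
    fix k assume k: "k \<in> I"
    have "(\<lambda>\<omega>. \<omega> k) \<in> measurable (PiM I M) (M k)" using k by (rule measurable_component_singleton)
    then show "(\<lambda>\<omega>. \<omega> k) \<in> measurable (PiM I M) (F k)"
      using F[OF k] by (auto simp: measurable_def subalgebra_def)
  qed (use F in \<open>auto simp: space_PiM subalgebra_def PiE_def Pi_def extensional_def\<close>)
  then have sub: "sets (PiM I F) \<subseteq> sets (PiM I M)"
  proof (intro subsetI)
    fix B assume B: "B \<in> sets (PiM I F)"
    have "space (PiM I F) = space (PiM I M)" using F by (auto simp: space_PiM subalgebra_def intro!: PiE_cong)
    then have "(\<lambda>\<omega>. \<omega>) -` B \<inter> space (PiM I M) = B" using sets.sets_into_space[OF B] by auto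
    with measurable_sets[OF \<open>(\<lambda>\<omega>. \<omega>) \<in> measurable (PiM I M) (PiM I F)\<close> B] show "B \<in> sets (PiM I M)" by simp
  qed
  have "space G = space (PiM I F)" using G by (rule sets_eq_imp_space_eq)
  also have "\<dots> = space (PiM I M)" using F by (auto simp: space_PiM subalgebra_def intro!: PiE_cong)
  finally show subG: "subalgebra (PiM I M) G" using sub G by (simp add: subalgebra_def)
  have sets_R: "k \<in> I \<Longrightarrow> sets (R k) = sets (F k)" for k using F by (simp add: R_def sets_restr_to_subalg)
  have "restr_to_subalg (PiM I M) G = PiM I R"
  proof (rule R.PiM_eqI)
    show sets_eq: "sets (restr_to_subalg (PiM I M) G) = sets (PiM I R)"
      using subG G sets_R by (auto simp: sets_restr_to_subalg intro!: sets_PiM_cong)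
    fix A assume A: "\<And>k. k \<in> I \<Longrightarrow> A k \<in> sets (R k)"
    then have AF: "A k \<in> sets (F k)" if "k \<in> I" for k using sets_R that by blast
    have AM: "A k \<in> sets (M' k)" if "k \<in> I" for k
      using AF[OF that] F[OF that] that by (auto simp: M'_def subalgebra_def)
    have "Pi\<^sub>E I A \<in> sets G" unfolding G using AF \<open>finite I\<close> by (intro sets_PiM_I_finite) auto
    then have "emeasure (restr_to_subalg (PiM I M) G) (Pi\<^sub>E I A) = emeasure (PiM I M') (Pi\<^sub>E I A)"
      using subG by (simp add: emeasure_restr_to_subalg M'M)
    also have "\<dots> = (\<Prod>k\<in>I. emeasure (M' k) (A k))"
      using \<open>finite I\<close> AM by (intro M'.emeasure_PiM) auto
    also have "\<dots> = (\<Prod>k\<in>I. emeasure (R k) (A k))"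
      using AF F by (intro prod.cong) (auto simp: M'_def R_def emeasure_restr_to_subalg)
    finally show "emeasure (restr_to_subalg (PiM I M) G) (Pi\<^sub>E I A) = (\<Prod>k\<in>I. emeasure (R k) (A k))" .
  qed fact
  also have "PiM I R = PiM I (\<lambda>k. restr_to_subalg (M k) (F k))" by (rule PiM_cong) (auto simp: R_def)
  finally show "restr_to_subalg (PiM I M) G = PiM I (\<lambda>k. restr_to_subalg (M k) (F k))" .
qed

text \<open>
  Restriction to a sub-sigma-algebra and passage to a density both commute with finite products.
\<close>

lemma llr_process_PiM:
  assumes "finite I" and M: "\<And>k. k \<in> I \<Longrightarrow> prob_space (M k)" "\<And>k. k \<in> I \<Longrightarrow> prob_space (N k)"
    and Y: "\<And>k. k \<in> I \<Longrightarrow> llr_process (M k) (N k) (F k) (Y k)"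
    and G: "\<And>t. sets (G t) = sets (PiM I (\<lambda>k. F k t))"
  shows "llr_process (PiM I M) (PiM I N) G (\<lambda>t \<omega>. \<Sum>k\<in>I. Y k t (\<omega> k))"
  unfolding llr_process_def
proof (intro allI conjI)
  fix t
  note m = llr_process_measurable[OF Y]
  have GF: "sets (G t) = sets (PiM I (\<lambda>k. F k t))" by (rule G)
  have rM: "subalgebra (PiM I M) (G t)"
      "restr_to_subalg (PiM I M) (G t) = PiM I (\<lambda>k. restr_to_subalg (M k) (F k t))"
    by (rule restr_to_subalg_PiM[OF assms(1) _ _ GF], simp add: M, simp add: m)+
  have rN: "subalgebra (PiM I N) (G t)"
      "restr_to_subalg (PiM I N) (G t) = PiM I (\<lambda>k. restr_to_subalg (N k) (F k t))"
    by (rule restr_to_subalg_PiM[OF assms(1) _ _ GF], simp add: M, simp add: m)+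
  show "subalgebra (PiM I M) (G t)" "subalgebra (PiM I N) (G t)" using rM(1) rN(1) by auto
  have [measurable]: "k \<in> I \<Longrightarrow> Y k t \<in> borel_measurable (F k t)" for k using m(2) .
  have "(\<lambda>\<omega>. \<Sum>k\<in>I. Y k t (\<omega> k)) \<in> borel_measurable (PiM I (\<lambda>k. F k t))" by measurable
  then show "(\<lambda>\<omega>. \<Sum>k\<in>I. Y k t (\<omega> k)) \<in> borel_measurable (G t)"
    unfolding measurable_cong_sets[OF G refl] .
  have d: "restr_to_subalg (N k) (F k t) = density (restr_to_subalg (M k) (F k t)) (\<lambda>x. ennreal (exp (- Y k t x)))"
    if "k \<in> I" for k using Y[OF that] by (simp add: llr_process_def)
  have "restr_to_subalg (PiM I N) (G t) = PiM I (\<lambda>k. density (restr_to_subalg (M k) (F k t)) (\<lambda>x. ennreal (exp (- Y k t x))))"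
    unfolding rN(2) by (rule PiM_cong) (auto simp: d)
  also have "\<dots> = density (PiM I (\<lambda>k. restr_to_subalg (M k) (F k t))) (\<lambda>\<omega>. \<Prod>k\<in>I. ennreal (exp (- Y k t (\<omega> k))))"
  proof (rule density_PiM[OF assms(1)])
    fix k assume k: "k \<in> I"
    show "prob_space (restr_to_subalg (M k) (F k t))" using m(3) M k by (intro prob_space_restr_to_subalg)
    show "prob_space (density (restr_to_subalg (M k) (F k t)) (\<lambda>x. ennreal (exp (- Y k t x))))"
      using m(4) M k by (subst d[symmetric]) (auto intro: prob_space_restr_to_subalg)
    have "Y k t \<in> borel_measurable (restr_to_subalg (M k) (F k t))"
      using m(2,3) k by (auto intro: measurable_in_subalg)
    then show "(\<lambda>x. ennreal (exp (- Y k t x))) \<in> borel_measurable (restr_to_subalg (M k) (F k t))" by measurable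
  qed
  also have "PiM I (\<lambda>k. restr_to_subalg (M k) (F k t)) = restr_to_subalg (PiM I M) (G t)" using rM(2) by simp
  also have "(\<lambda>\<omega>. \<Prod>k\<in>I. ennreal (exp (- Y k t (\<omega> k)))) = (\<lambda>\<omega>. ennreal (exp (- (\<Sum>k\<in>I. Y k t (\<omega> k)))))"
    using assms(1) by (auto simp: prod_ennreal exp_sum[symmetric] sum_negf fun_eq_iff)
  finally show "restr_to_subalg (PiM I N) (G t)
      = density (restr_to_subalg (PiM I M) (G t)) (\<lambda>\<omega>. ennreal (exp (- (\<Sum>k\<in>I. Y k t (\<omega> k)))))" .
qed

section \<open>Upper and lower bounds on the moments\<close>

text \<open>
  Let \<open>U\<close> be the union of \<open>Q\<close>, \<open>J\<close> the smallest total drift and \<open>a = x + c0\<close>. If \<open>n \<ge> \<rho> a / J\<close> and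
  every channel satisfies \<open>Y k n \<ge> min (n I k / \<rho>) a\<close>, then every sum over a set \<open>A \<in> Q\<close> is at least
  \<open>a\<close>: either one channel of \<open>A\<close> reaches \<open>a\<close> alone and the others are nonnegative, or all of them
  follow their drift. So past \<open>N = \<rho> a / J\<close> the event \<open>n < T\<close> is covered by the events whose weighted
  sum is negligible, and the moment is at most \<open>N powr q\<close> plus a remainder of smaller order.
\<close>

lemma moment_upper_bound:
  fixes I :: "nat \<Rightarrow> real" and Y :: "nat \<Rightarrow> nat \<Rightarrow> 'b \<Rightarrow> real" and q \<eta> c0 :: real
  assumes "prob_space M" and Q: "finite Q" "Q \<noteq> {}"
    and A: "\<And>A. A \<in> Q \<Longrightarrow> finite A \<and> A \<noteq> {}"
    and I: "\<And>k. k \<in> \<Union>Q \<Longrightarrow> 0 < I k"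
    and Ym: "\<And>k n. k \<in> \<Union>Q \<Longrightarrow> Y k n \<in> borel_measurable M"
    and tail: "\<And>k. k \<in> \<Union>Q \<Longrightarrow> tail_negligible M (Y k) (I k) r"
    and q: "1 \<le> r" "0 < q" "q \<le> real r" and "0 < \<eta>"
  shows "\<forall>\<^sub>F x in at_top. \<forall>T.
      (\<forall>n. {\<omega> \<in> space M. enat n < T \<omega>} \<in> sets M) \<longrightarrow>
      (\<forall>n\<ge>1. AE \<omega> in M. enat n < T \<omega> \<longrightarrow> (\<exists>A\<in>Q. (\<Sum>k\<in>A. Y k n \<omega>) < x + c0)) \<longrightarrow>
      moment M T q \<le> ennreal ((1 + \<eta>) * (x / (MIN A\<in>Q. \<Sum>k\<in>A. I k)) powr q)"
proof -
  interpret prob_space M by fact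
  define U where "U = \<Union>Q"
  define J where "J = (MIN A\<in>Q. \<Sum>k\<in>A. I k)"
  have U: "finite U" "U \<noteq> {}" using Q A by (auto simp: U_def)
  have J_le: "J \<le> (\<Sum>k\<in>A. I k)" if "A \<in> Q" for A
    unfolding J_def using Q that by (intro Min_le) auto
  have "0 < J"
    unfolding J_def using Q A I by (subst Min_gr_iff) (auto intro!: sum_pos)
  \<comment> \<open>The factor \<open>\<rho>\<close> is lost twice in \<open>N\<close> (drift, then \<open>c0\<close> and rounding), hence \<open>2 q\<close> times in
    \<open>N powr q\<close>, and once more for the remainder.\<close>
  define \<rho> where "\<rho> = (1 + \<eta>) powr (1 / (2 * q + 1))"
  have \<rho>: "1 < \<rho>" "\<rho> powr (2 * q + 1) = 1 + \<eta>"
  proof -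
    have "(1 + \<eta>) powr 0 < (1 + \<eta>) powr (1 / (2 * q + 1))" using q \<open>0 < \<eta>\<close> by (intro powr_less_mono) auto
    then show "1 < \<rho>" using \<open>0 < \<eta>\<close> by (simp add: \<rho>_def)
    show "\<rho> powr (2 * q + 1) = 1 + \<eta>" using \<open>0 < \<eta>\<close> q by (simp add: \<rho>_def powr_powr)
  qed
  define cr where "cr = real r * 2 ^ (r - 1)"
  define \<delta> where "\<delta> = (\<rho> - 1) / (cr * real (card U) * J ^ r)"
  have cr: "0 < cr" using q by (simp add: cr_def)
  have cU: "0 < real (card U)" using U by (simp add: card_gt_0_iff)
  have \<delta>: "0 < \<delta>" "cr * (real (card U) * \<delta>) * J ^ r = \<rho> - 1"
    using \<rho> cr cU \<open>0 < J\<close> by (auto simp: \<delta>_def)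
  have shift: "filterlim (\<lambda>x. x + c0) at_top (at_top :: real filter)"
    using filterlim_tendsto_add_at_top[OF tendsto_const[of c0] filterlim_ident] by (simp add: add.commute)
  have "\<forall>\<^sub>F x in at_top. \<forall>k\<in>U. (\<Sum>n. ennreal (real n ^ (r - 1)) *
           emeasure M {\<omega> \<in> space M. \<rho> / J * (x + c0) \<le> real n \<and> Y k n \<omega> < min (real n * I k / \<rho>) (x + c0)})
        \<le> ennreal (\<delta> * (x + c0) ^ r)"
  proof (rule eventually_ball_finite[OF U(1)], rule ballI)
    fix k assume "k \<in> U"
    then have "tail_negligible M (Y k) (I k) r" using tail by (simp add: U_def)
    moreover have "0 < \<rho> / J" using \<rho> \<open>0 < J\<close> by simp
    ultimately show "\<forall>\<^sub>F x in at_top. (\<Sum>n. ennreal (real n ^ (r - 1)) *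
           emeasure M {\<omega> \<in> space M. \<rho> / J * (x + c0) \<le> real n \<and> Y k n \<omega> < min (real n * I k / \<rho>) (x + c0)})
        \<le> ennreal (\<delta> * (x + c0) ^ r)"
      using \<rho> \<delta> unfolding tail_negligible_def by (intro eventually_compose_filterlim[OF _ shift]) blast
  qed
  moreover have "\<forall>\<^sub>F x in at_top. \<rho> / J * (x + c0) + 1 \<le> \<rho>\<^sup>2 * (x / J)"
  proof -
    have "filterlim (\<lambda>x. x * ((\<rho>\<^sup>2 - \<rho>) / J)) at_top at_top"
      using \<rho> \<open>0 < J\<close>
      by (intro filterlim_at_top_mult_tendsto_pos[OF tendsto_const] filterlim_ident) (auto simp: power2_eq_square)
    then have "\<forall>\<^sub>F x in at_top. \<rho> / J * c0 + 1 \<le> x * ((\<rho>\<^sup>2 - \<rho>) / J)" by (simp add: filterlim_at_top)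
    then show ?thesis
    proof eventually_elim
      case (elim x)
      have "x * ((\<rho>\<^sup>2 - \<rho>) / J) = \<rho>\<^sup>2 * (x / J) - \<rho> / J * x" using \<open>0 < J\<close> by (simp add: field_simps)
      with elim show ?case by (simp add: distrib_left)
    qed
  qed
  ultimately show ?thesis
    using eventually_gt_at_top[of 0] eventually_gt_at_top[of "- c0"]
  proof eventually_elim
    case (elim x)
    define a where "a = x + c0"
    have a: "0 < a" using elim by (simp add: a_def)
    define N where "N = nat \<lceil>\<rho> / J * a\<rceil>"
    have pos: "0 < \<rho> / J * a" using a \<rho> \<open>0 < J\<close> by simp
    then have N: "\<rho> / J * a \<le> real N" "real N \<le> \<rho> / J * a + 1" "1 \<le> N"
      unfolding N_def by linarith+
    have aN: "a \<le> J * real N"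
    proof -
      have "1 * a \<le> \<rho> * a" using \<rho> a by (intro mult_right_mono) auto
      also have "\<rho> * a = J * (\<rho> / J * a)" using \<open>0 < J\<close> by simp
      also have "\<dots> \<le> J * real N" using N \<open>0 < J\<close> by (intro mult_left_mono) auto
      finally show ?thesis by simp
    qed
    define Z where "Z k n = {\<omega> \<in> space M. \<rho> / J * a \<le> real n \<and> Y k n \<omega> < min (real n * I k / \<rho>) a}" for k n
    define e where "e k n = emeasure M (Z k n)" for k n
    have e: "(\<Sum>n. ennreal (real n ^ (r - 1)) * e k n) \<le> ennreal (\<delta> * a ^ r)" if "k \<in> U" for k
      using elim(1) that unfolding e_def Z_def a_def by blast
    show ?case
    proof (intro allI impI)
      fix T :: "'b \<Rightarrow> enat"
      assume Tm: "\<forall>n. {\<omega> \<in> space M. enat n < T \<omega>} \<in> sets M"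
        and T: "\<forall>n\<ge>1. AE \<omega> in M. enat n < T \<omega> \<longrightarrow> (\<exists>A\<in>Q. (\<Sum>k\<in>A. Y k n \<omega>) < x + c0)"
      have prob_le: "emeasure M {\<omega> \<in> space M. N \<le> n \<and> enat n < T \<omega>} \<le> (\<Sum>k\<in>U. e k n)" for n
      proof (cases "N \<le> n")
        case False
        then have "{\<omega> \<in> space M. N \<le> n \<and> enat n < T \<omega>} = {}" by auto
        then show ?thesis by (simp only:) simp
      next
        case True
        then have n: "1 \<le> n" "\<rho> / J * a \<le> real n" using N by linarith+
        have m[measurable]: "Z k n \<in> sets M" if "k \<in> U" for k
        proof -
          have [measurable]: "Y k n \<in> borel_measurable M" using Ym that by (simp add: U_def)
          show ?thesis unfolding Z_def by measurable
        qed
        have "emeasure M {\<omega> \<in> space M. N \<le> n \<and> enat n < T \<omega>}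
          \<le> emeasure M (\<Union>k\<in>U. Z k n)"
        proof (rule emeasure_mono_AE)
          have "AE \<omega> in M. enat n < T \<omega> \<longrightarrow> (\<exists>A\<in>Q. (\<Sum>k\<in>A. Y k n \<omega>) < x + c0)" using T n by simp
          then show "AE \<omega> in M. \<omega> \<in> {\<omega> \<in> space M. N \<le> n \<and> enat n < T \<omega>} \<longrightarrow>
            \<omega> \<in> (\<Union>k\<in>U. Z k n)"
          proof eventually_elim
            case (elim \<omega>)
            show ?case
            proof (intro impI, rule ccontr)
              assume "\<omega> \<in> {\<omega> \<in> space M. N \<le> n \<and> enat n < T \<omega>}"
                and *: "\<omega> \<notin> (\<Union>k\<in>U. Z k n)"
              then have \<omega>: "\<omega> \<in> space M" "enat n < T \<omega>" by auto
              then obtain B where B: "B \<in> Q" "(\<Sum>k\<in>B. Y k n \<omega>) < a" using elim by (auto simp: a_def)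
              have Bp: "finite B" "B \<subseteq> U" using A B by (auto simp: U_def)
              have lb: "min (real n * I k / \<rho>) a \<le> Y k n \<omega>" if "k \<in> B" for k
              proof -
                have "k \<in> U" using Bp that by blast
                with * have "\<not> Y k n \<omega> < min (real n * I k / \<rho>) a" using \<omega> n unfolding Z_def by blast
                then show ?thesis by (rule leI)
              qed
              have nI: "0 \<le> real n * I k / \<rho>" if "k \<in> B" for k
              proof -
                have "0 < I k" using I[of k] that B(1) by blast
                then show ?thesis using \<rho> by simp
              qed
              have Y0: "0 \<le> Y k n \<omega>" if "k \<in> B" for k
                using lb[OF that] nI[OF that] a by linarith
              have "a \<le> (\<Sum>k\<in>B. Y k n \<omega>)"
              proof (cases "\<exists>k\<in>B. a \<le> real n * I k / \<rho>")
                case True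
                then obtain k where k: "k \<in> B" "a \<le> real n * I k / \<rho>" by blast
                then have "a \<le> Y k n \<omega>" using lb[OF k(1)] by linarith
                also have "\<dots> \<le> (\<Sum>k\<in>B. Y k n \<omega>)" using k Y0 Bp by (intro member_le_sum) auto
                finally show ?thesis .
              next
                case False
                have "a = J * (\<rho> / J * a) / \<rho>" using \<open>0 < J\<close> \<rho> by simp
                also have "\<dots> \<le> J * real n / \<rho>" using n \<open>0 < J\<close> \<rho> by (intro divide_right_mono mult_left_mono) auto
                also have "\<dots> \<le> (\<Sum>k\<in>B. I k) * real n / \<rho>"
                  using J_le[OF B(1)] \<rho> by (intro divide_right_mono mult_right_mono) auto
                also have "\<dots> = (\<Sum>k\<in>B. real n * I k / \<rho>)"
                  by (simp add: sum_distrib_left sum_divide_distrib mult.commute)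
                also have "\<dots> \<le> (\<Sum>k\<in>B. Y k n \<omega>)"
                proof (rule sum_mono)
                  fix k assume k: "k \<in> B"
                  then have "real n * I k / \<rho> < a" using False by (auto simp: not_le)
                  then show "real n * I k / \<rho> \<le> Y k n \<omega>" using lb[OF k] by linarith
                qed
                finally show ?thesis .
              qed
              with B show False by linarith
            qed
          qed
        next
          show "(\<Union>k\<in>U. Z k n) \<in> sets M"
            by (intro sets.finite_UN[OF U(1)] m)
        qed
        also have "\<dots> \<le> (\<Sum>k\<in>U. e k n)"
          unfolding e_def by (intro emeasure_subadditive_finite[OF U(1)] image_subsetI m)
        finally show ?thesis .
      qed
      have "(\<Sum>n. ennreal (real n ^ (r - 1)) * emeasure M {\<omega> \<in> space M. N \<le> n \<and> enat n < T \<omega>})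
        \<le> (\<Sum>n. ennreal (real n ^ (r - 1)) * (\<Sum>k\<in>U. e k n))"
        by (intro suminf_le mult_left_mono prob_le) auto
      also have "\<dots> = (\<Sum>k\<in>U. \<Sum>n. ennreal (real n ^ (r - 1)) * e k n)"
        unfolding sum_distrib_left by (rule suminf_sum) auto
      also have "\<dots> \<le> (\<Sum>k\<in>U. ennreal (\<delta> * a ^ r))" by (intro sum_mono e)
      also have "\<dots> = ennreal (real (card U) * (\<delta> * a ^ r))"
        using \<delta> a by (simp add: ennreal_mult ennreal_of_nat_eq_real_of_nat)
      finally have S: "(\<Sum>n. ennreal (real n ^ (r - 1)) * emeasure M {\<omega> \<in> space M. N \<le> n \<and> enat n < T \<omega>})
        \<le> ennreal (real (card U) * (\<delta> * a ^ r))" .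
      have "moment M T q \<le> ennreal (real N powr q) + ennreal (real N powr (q - real r) * cr)
        * (\<Sum>n. ennreal (real n ^ (r - 1)) * emeasure M {\<omega> \<in> space M. N \<le> n \<and> enat n < T \<omega>})"
        unfolding cr_def using Tm N q by (intro moment_le_tail_sum assms(1)) auto
      also have "\<dots> \<le> ennreal (real N powr q) + ennreal (real N powr (q - real r) * cr) * ennreal (real (card U) * (\<delta> * a ^ r))"
        using S by (intro add_mono mult_left_mono) auto
      also have "\<dots> = ennreal (real N powr q + real N powr (q - real r) * cr * (real (card U) * (\<delta> * a ^ r)))"
        using \<delta> a cr by (subst ennreal_plus) (auto simp: ennreal_mult[symmetric])
      also have "\<dots> \<le> ennreal ((1 + \<eta>) * (x / J) powr q)"
      proof (rule ennreal_leI)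
        have "a ^ r \<le> (J * real N) ^ r" using aN a by (intro power_mono) auto
        then have "real N powr (q - real r) * cr * (real (card U) * (\<delta> * a ^ r))
          \<le> real N powr (q - real r) * cr * (real (card U) * (\<delta> * (J * real N) ^ r))"
          using cr cU \<delta> by (intro mult_left_mono) auto
        also have "\<dots> = real N powr (q - real r) * real N ^ r * (cr * (real (card U) * \<delta>) * J ^ r)"
          by (simp add: power_mult_distrib)
        also have "\<dots> = real N powr q * (\<rho> - 1)"
          using N by (subst \<delta>(2)) (simp add: powr_diff powr_realpow)
        finally have "real N powr q + real N powr (q - real r) * cr * (real (card U) * (\<delta> * a ^ r)) \<le> real N powr q * \<rho>"
          by (simp add: algebra_simps)
        also have "\<dots> \<le> (\<rho>\<^sup>2 * (x / J)) powr q * \<rho>"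
          using N elim(2) q \<rho> by (intro mult_right_mono powr_mono2) (auto simp: a_def)
        also have "\<dots> = (\<rho> powr (2 * q) * \<rho>) * (x / J) powr q"
        proof -
          have "\<rho>\<^sup>2 = \<rho> powr 2" using \<rho> by (simp add: powr_numeral)
          then have "(\<rho>\<^sup>2) powr q = \<rho> powr (2 * q)" by (simp only: powr_powr)
          moreover have "(\<rho>\<^sup>2 * (x / J)) powr q = (\<rho>\<^sup>2) powr q * (x / J) powr q" by (rule powr_mult)
          ultimately show ?thesis by simp
        qed
        also have "\<rho> powr (2 * q) * \<rho> = \<rho> powr (2 * q + 1)" using \<rho> by (simp add: powr_add)
        finally show "real N powr q + real N powr (q - real r) * cr * (real (card U) * (\<delta> * a ^ r)) \<le> (1 + \<eta>) * (x / J) powr q"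
          using \<rho> by simp
      qed
      finally show "moment M T q \<le> ennreal ((1 + \<eta>) * (x / (MIN A\<in>Q. \<Sum>k\<in>A. I k)) powr q)"
        unfolding J_def .
    qed
  qed
qed

text \<open>
  On a path along which \<open>Y t / t\<close> converges to \<open>J < c\<close>, only finitely many \<open>t\<close> can violate
  \<open>Y t < c t\<close>, and those are harmless once \<open>c L\<close> exceeds the finitely many values concerned.
\<close>

lemma (in prob_space) measure_linear_exceedance_tendsto_0:
  fixes J c :: real
  assumes [measurable]: "\<And>t. Y t \<in> borel_measurable M"
    and conv: "AE x in M. (\<lambda>t. Y t x / real t) \<longlonglongrightarrow> J" and "0 < J" "J < c"
  shows "(\<lambda>L. measure M {x \<in> space M. \<exists>t\<in>{1..L}. c * real L \<le> Y t x}) \<longlonglongrightarrow> 0"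
proof (rule measure_tendsto_0_of_AE)
  show "AE x in M. \<forall>\<^sub>F L in sequentially. x \<notin> {x \<in> space M. \<exists>t\<in>{1..L}. c * real L \<le> Y t x}"
    using conv
  proof eventually_elim
    case (elim x)
    then have "\<forall>\<^sub>F t in sequentially. Y t x / real t < c" using \<open>J < c\<close> by (rule order_tendstoD)
    then obtain t0 where t0: "\<And>t. t0 \<le> t \<Longrightarrow> Y t x / real t < c" by (auto simp: eventually_sequentially)
    define B where "B = (\<Sum>t<t0. \<bar>Y t x\<bar>)"
    have B: "Y t x \<le> B" if "t < t0" for t
    proof -
      have "\<bar>Y t x\<bar> \<le> B" unfolding B_def using that by (intro member_le_sum) auto
      then show ?thesis by linarith
    qed
    have "0 < c" using assms by linarith
    have "\<forall>\<^sub>F L in sequentially. B < c * real L"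
    proof -
      have "filterlim (\<lambda>L. c * real L) at_top sequentially"
        using \<open>0 < c\<close> by (intro filterlim_tendsto_pos_mult_at_top[OF tendsto_const] filterlim_real_sequentially) auto
      then show ?thesis by (simp add: filterlim_at_top_dense)
    qed
    then show ?case
    proof eventually_elim
      case (elim L)
      have "Y t x < c * real L" if "t \<in> {1..L}" for t
      proof (cases "t < t0")
        case True
        then show ?thesis using B[OF True] elim by linarith
      next
        case False
        then have "Y t x < c * real t" using t0[of t] that by (simp add: field_simps)
        also have "\<dots> \<le> c * real L" using that \<open>0 < c\<close> by (intro mult_left_mono) auto
        finally show ?thesis .
      qed
      then show ?case by (auto simp: not_le)
    qed
  qed
qed simp

text \<open>
  The change of measure behind the lower bound, carried out separately on each event \<open>\<tau> = t\<close>, where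
  the density is that of time \<open>t\<close>.
\<close>

lemma measure_stopped_early_le:
  fixes \<tau> :: "'b \<Rightarrow> enat"
  assumes "prob_space M" "prob_space N" and Y: "llr_process M N F Y"
    and D: "D \<subseteq> space M" "D \<in> sets N" "\<And>t. {x \<in> D. \<tau> x = enat t} \<in> sets (F t)"
    and \<tau>: "\<And>x. x \<in> D \<Longrightarrow> 1 \<le> \<tau> x"
  shows "measure M {x \<in> D. \<tau> x \<le> enat L}
    \<le> exp c * measure N D + measure M {x \<in> space M. \<exists>t\<in>{1..L}. c \<le> Y t x}"
proof -
  interpret M: prob_space M by fact
  interpret N: prob_space N by fact
  note [measurable] = llr_process_measurable(1)[OF Y]
  have sub: "sets (F t) \<subseteq> sets M" "sets (F t) \<subseteq> sets N" for t
    using llr_process_measurable[OF Y] by (auto simp: subalgebra_def)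
  define B where "B t = {x \<in> D. \<tau> x = enat t}" for t
  have BM[measurable]: "B t \<in> sets M" and BN: "B t \<in> sets N" for t using D(3) sub unfolding B_def by blast+
  define W where "W t = B t \<inter> {x \<in> space M. Y t x < c}" for t
  have [measurable]: "W t \<in> sets M" for t by (simp add: W_def)
  have W: "measure M (W t) \<le> exp c * measure N (B t)" for t
  proof -
    have "emeasure M (W t) = (\<integral>\<^sup>+x. indicator (W t) x \<partial>M)" by simp
    also have "\<dots> \<le> (\<integral>\<^sup>+x. ennreal (exp c) * (ennreal (exp (- Y t x)) * indicator (B t) x) \<partial>M)"
      by (intro nn_integral_mono) (auto simp: W_def indicator_def ennreal_mult[symmetric] exp_add[symmetric])
    also have "\<dots> = ennreal (exp c) * (\<integral>\<^sup>+x. ennreal (exp (- Y t x)) * indicator (B t) x \<partial>M)"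
      by (rule nn_integral_cmult) measurable
    also have "(\<integral>\<^sup>+x. ennreal (exp (- Y t x)) * indicator (B t) x \<partial>M) = emeasure N (B t)"
      using D(3) unfolding B_def by (rule llr_process_emeasure[OF Y, symmetric])
    finally show ?thesis
      by (simp add: M.emeasure_eq_measure N.emeasure_eq_measure ennreal_mult[symmetric])
  qed
  have disj: "disjoint_family_on B {1..L}" by (auto simp: disjoint_family_on_def B_def)
  have "{x \<in> D. \<tau> x \<le> enat L} \<subseteq> (\<Union>t\<in>{1..L}. W t) \<union> {x \<in> space M. \<exists>t\<in>{1..L}. c \<le> Y t x}"
  proof
    fix x assume x: "x \<in> {x \<in> D. \<tau> x \<le> enat L}"
    then obtain t where t: "\<tau> x = enat t" by (cases "\<tau> x") auto
    then have tL: "t \<in> {1..L}" using x \<tau>[of x] by (auto simp: one_enat_def)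
    show "x \<in> (\<Union>t\<in>{1..L}. W t) \<union> {x \<in> space M. \<exists>t\<in>{1..L}. c \<le> Y t x}"
    proof (cases "Y t x < c")
      case True
      then have "x \<in> W t" using x t D by (auto simp: W_def B_def)
      then show ?thesis using tL by blast
    next
      case False
      then show ?thesis using x t tL D by (auto simp: not_less)
    qed
  qed
  then have "measure M {x \<in> D. \<tau> x \<le> enat L}
      \<le> measure M ((\<Union>t\<in>{1..L}. W t) \<union> {x \<in> space M. \<exists>t\<in>{1..L}. c \<le> Y t x})"
    by (rule M.finite_measure_mono) measurable
  also have "\<dots> \<le> measure M (\<Union>t\<in>{1..L}. W t) + measure M {x \<in> space M. \<exists>t\<in>{1..L}. c \<le> Y t x}"
    by (rule measure_Un_le) measurable
  also have "measure M (\<Union>t\<in>{1..L}. W t) \<le> (\<Sum>t\<in>{1..L}. measure M (W t))"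
    by (rule measure_UNION_le) auto
  also have "\<dots> \<le> (\<Sum>t\<in>{1..L}. exp c * measure N (B t))" by (intro sum_mono W)
  also have "\<dots> = exp c * measure N (\<Union>t\<in>{1..L}. B t)"
    using BN disj by (subst N.finite_measure_finite_Union) (auto simp: sum_distrib_left)
  also have "\<dots> \<le> exp c * measure N D"
    using D BN by (intro mult_left_mono N.finite_measure_mono) (auto simp: B_def)
  finally show ?thesis by simp
qed

text \<open>
  For a test, \<open>D\<close> is the decision for \<open>M\<close>, an error under \<open>N\<close>, and \<open>D'\<close> the opposite decision. The
  number \<open>\<delta>\<close> is chosen before the test, so the bound passes to the infimum over all tests.
\<close>

lemma moment_lower_bound:
  fixes J q \<eta> :: real
  assumes "prob_space M" "prob_space N" and Y: "llr_process M N F Y"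
    and conv: "AE x in M. (\<lambda>t. Y t x / real t) \<longlonglongrightarrow> J" and "0 < J" "0 < q" "0 < \<eta>" "\<eta> < 1"
  shows "\<exists>\<delta>>0. \<forall>\<alpha> \<beta> \<tau> D D'. \<alpha> < \<delta> \<longrightarrow> 0 < \<beta> \<longrightarrow> \<beta> < \<delta> \<longrightarrow>
      (\<forall>n. {x \<in> space M. enat n < \<tau> x} \<in> sets M) \<longrightarrow>
      D \<in> sets M \<longrightarrow> D \<in> sets N \<longrightarrow> D' \<in> sets M \<longrightarrow>
      (\<forall>t. {x \<in> D. \<tau> x = enat t} \<in> sets (F t)) \<longrightarrow>
      (\<forall>x\<in>space M. 1 \<le> \<tau> x \<and> (\<tau> x < \<infinity> \<longrightarrow> x \<in> D \<union> D')) \<longrightarrow>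
      measure M D' \<le> \<alpha> \<longrightarrow> measure N D \<le> \<beta> \<longrightarrow>
      ennreal ((1 - \<eta>) * (\<bar>ln \<beta>\<bar> / J) powr q) \<le> moment M \<tau> q"
proof -
  interpret M: prob_space M by fact
  note [measurable] = llr_process_measurable(1)[OF Y]
  have "((\<lambda>\<epsilon>. (1 - \<epsilon>) powr q * (1 - 3 * \<epsilon>)) \<longlongrightarrow> (1 - 0) powr q * (1 - 3 * 0)) (at_right (0::real))"
    by (intro tendsto_intros) auto
  then have "\<forall>\<^sub>F \<epsilon> in at_right 0. 1 - \<eta> < (1 - \<epsilon>) powr q * (1 - 3 * \<epsilon>)"
    using \<open>0 < \<eta>\<close> by (intro order_tendstoD) auto
  moreover have "\<forall>\<^sub>F \<epsilon> in at_right (0::real). \<epsilon> \<in> {0<..<1}" by (rule eventually_at_right_real) simp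
  ultimately have "\<forall>\<^sub>F \<epsilon> in at_right 0. 1 - \<eta> < (1 - \<epsilon>) powr q * (1 - 3 * \<epsilon>) \<and> \<epsilon> \<in> {0<..<1}"
    by eventually_elim simp
  then obtain \<epsilon> :: real where \<epsilon>: "1 - \<eta> < (1 - \<epsilon>) powr q * (1 - 3 * \<epsilon>)" "0 < \<epsilon>" "\<epsilon> < 1"
    using eventually_happens'[OF trivial_limit_at_right_real] by auto
  define X where "X L = {x \<in> space M. \<exists>t\<in>{1..L}. (1 + \<epsilon>) * J * real L \<le> Y t x}" for L :: nat
  have [measurable]: "X L \<in> sets M" for L by (simp add: X_def)
  have "J < (1 + \<epsilon>) * J" using \<open>0 < J\<close> \<epsilon> by simp
  then have "(\<lambda>L. measure M (X L)) \<longlonglongrightarrow> 0"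
    unfolding X_def using \<open>0 < J\<close> by (intro M.measure_linear_exceedance_tendsto_0[OF _ conv]) auto
  then have "\<forall>\<^sub>F L in sequentially. measure M (X L) < \<epsilon>"
    using \<epsilon> by (intro order_tendstoD) auto
  then obtain L0 where L0: "\<And>L. L0 \<le> L \<Longrightarrow> measure M (X L) < \<epsilon>"
    by (auto simp: eventually_sequentially)
  define x0 where "x0 = max ((real L0 + 1) * J / (1 - \<epsilon>)) (- ln \<epsilon> / \<epsilon>\<^sup>2)"
  define \<delta> where "\<delta> = min \<epsilon> (exp (- x0))"
  have "ennreal ((1 - \<eta>) * (\<bar>ln \<beta>\<bar> / J) powr q) \<le> moment M \<tau> q"
    if \<alpha>: "\<alpha> < \<delta>" and \<beta>: "0 < \<beta>" "\<beta> < \<delta>"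
      and \<tau>: "\<forall>n. {x \<in> space M. enat n < \<tau> x} \<in> sets M"
      and D: "D \<in> sets M" "D \<in> sets N" "D' \<in> sets M"
      and DF: "\<forall>t. {x \<in> D. \<tau> x = enat t} \<in> sets (F t)"
      and cover: "\<forall>x\<in>space M. 1 \<le> \<tau> x \<and> (\<tau> x < \<infinity> \<longrightarrow> x \<in> D \<union> D')"
      and err: "measure M D' \<le> \<alpha>" "measure N D \<le> \<beta>" for \<alpha> \<beta> \<tau> D D'
  proof -
    define x where "x = \<bar>ln \<beta>\<bar>"
    have "\<beta> < \<epsilon>" "\<beta> < exp (- x0)" using \<beta> by (auto simp: \<delta>_def)
    then have "ln \<beta> < 0" using \<beta> \<epsilon> by simp
    then have x: "\<beta> = exp (- x)" "x0 < x" "0 < x"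
    proof -
      have "ln \<beta> < ln (exp (- x0))" using \<beta> \<open>\<beta> < exp (- x0)\<close> by (subst ln_less_cancel_iff) auto
      then show "x0 < x" using \<open>ln \<beta> < 0\<close> by (simp add: x_def)
    qed (use \<beta> in \<open>auto simp: x_def\<close>)
    \<comment> \<open>The exponent \<open>c\<close> below satisfies \<open>(1 + \<epsilon>) J L \<le> c = (1 - \<epsilon>\<^sup>2) x < x\<close>.\<close>
    define L where "L = nat \<lfloor>(1 - \<epsilon>) * x / J\<rfloor>"
    have pos: "0 \<le> (1 - \<epsilon>) * x / J" using \<epsilon> x \<open>0 < J\<close> by simp
    then have L: "real L \<le> (1 - \<epsilon>) * x / J" "(1 - \<epsilon>) * x / J \<le> real L + 1" unfolding L_def by linarith+
    have "(real L0 + 1) * J / (1 - \<epsilon>) < x" using x by (simp add: x0_def)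
    then have "real L0 + 1 < (1 - \<epsilon>) * x / J" using \<epsilon> \<open>0 < J\<close> by (simp add: field_simps)
    then have "L0 \<le> L" using L by linarith
    define c where "c = (1 + \<epsilon>) * (1 - \<epsilon>) * x"
    have cL: "(1 + \<epsilon>) * J * real L \<le> c"
    proof -
      have "(1 + \<epsilon>) * J * real L \<le> (1 + \<epsilon>) * J * ((1 - \<epsilon>) * x / J)"
        using L \<epsilon> \<open>0 < J\<close> by (intro mult_left_mono) auto
      then show ?thesis using \<open>0 < J\<close> by (simp add: c_def)
    qed
    have sub: "{y \<in> space M. \<tau> y \<le> enat L} \<subseteq> D' \<union> {y \<in> D. \<tau> y \<le> enat L}"
    proof
      fix y assume y: "y \<in> {y \<in> space M. \<tau> y \<le> enat L}"
      then have "\<tau> y < \<infinity>" by (cases "\<tau> y") auto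
      then show "y \<in> D' \<union> {y \<in> D. \<tau> y \<le> enat L}" using y cover by auto
    qed
    have le_sets: "{y \<in> D. \<tau> y \<le> enat L} \<in> sets M"
    proof -
      have "{y \<in> D. \<tau> y \<le> enat L} = D - {y \<in> space M. enat L < \<tau> y}"
        using sets.sets_into_space[OF D(1)] by auto
      then show ?thesis using D \<tau> by auto
    qed
    have "measure M {y \<in> space M. \<tau> y \<le> enat L} \<le> measure M (D' \<union> {y \<in> D. \<tau> y \<le> enat L})"
      using D le_sets by (intro M.finite_measure_mono[OF sub] sets.Un)
    also have "\<dots> \<le> measure M D' + measure M {y \<in> D. \<tau> y \<le> enat L}"
      using D le_sets by (intro measure_Un_le)
    also have "measure M {y \<in> D. \<tau> y \<le> enat L} \<le> exp c * measure N D + measure M {y \<in> space M. \<exists>t\<in>{1..L}. c \<le> Y t y}"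
      using D DF cover sets.sets_into_space[OF D(1)] by (intro measure_stopped_early_le[OF assms(1-2) Y]) auto
    also have "measure M {y \<in> space M. \<exists>t\<in>{1..L}. c \<le> Y t y} \<le> measure M (X L)"
      using cL by (intro M.finite_measure_mono) (force simp: X_def, measurable)
    also have "\<dots> \<le> \<epsilon>" using L0[OF \<open>L0 \<le> L\<close>] by simp
    also have "exp c * measure N D \<le> exp c * exp (- x)" using err x by (intro mult_left_mono) auto
    also have "\<dots> \<le> \<epsilon>"
    proof -
      have "- ln \<epsilon> / \<epsilon>\<^sup>2 < x" using x by (simp add: x0_def)
      then have "- ln \<epsilon> < x * \<epsilon>\<^sup>2" using \<epsilon> by (simp add: field_simps)
      moreover have "c - x = - (x * \<epsilon>\<^sup>2)" by (simp add: c_def power2_eq_square algebra_simps)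
      ultimately have "exp (c - x) \<le> exp (ln \<epsilon>)" by simp
      then show ?thesis using \<epsilon> by (simp add: exp_diff exp_minus field_simps)
    qed
    also have "measure M D' \<le> \<epsilon>" using err \<alpha> by (simp add: \<delta>_def)
    finally have early: "measure M {y \<in> space M. \<tau> y \<le> enat L} \<le> 3 * \<epsilon>" by simp
    have "{y \<in> space M. enat L < \<tau> y} = space M - {y \<in> space M. \<tau> y \<le> enat L}"
      and "{y \<in> space M. \<tau> y \<le> enat L} = space M - {y \<in> space M. enat L < \<tau> y}" by auto
    then have late: "1 - 3 * \<epsilon> \<le> measure M {y \<in> space M. enat L < \<tau> y}"
      using early \<tau> M.prob_compl[of "{y \<in> space M. enat L < \<tau> y}"] by simp
    have "(1 - \<eta>) * (x / J) powr q \<le> (1 - \<epsilon>) powr q * (1 - 3 * \<epsilon>) * (x / J) powr q"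
      using \<epsilon> by (intro mult_right_mono) auto
    also have "\<dots> = ((1 - \<epsilon>) * x / J) powr q * (1 - 3 * \<epsilon>)"
      using powr_mult[of "1 - \<epsilon>" "x / J" q] by simp
    also have "\<dots> \<le> ((1 - \<epsilon>) * x / J) powr q * measure M {y \<in> space M. enat L < \<tau> y}"
      using late by (intro mult_left_mono) auto
    finally have "ennreal ((1 - \<eta>) * (x / J) powr q)
        \<le> ennreal (((1 - \<epsilon>) * x / J) powr q * measure M {y \<in> space M. enat L < \<tau> y})"
      by (rule ennreal_leI)
    also have "\<dots> = (\<integral>\<^sup>+y. ennreal (((1 - \<epsilon>) * x / J) powr q) * indicator {y \<in> space M. enat L < \<tau> y} y \<partial>M)"
      using \<tau> by (subst nn_integral_cmult_indicator) (auto simp: M.emeasure_eq_measure ennreal_mult)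
    also have "\<dots> \<le> moment M \<tau> q"
      unfolding moment_def
    proof (rule nn_integral_mono)
      fix y
      show "ennreal (((1 - \<epsilon>) * x / J) powr q) * indicator {y \<in> space M. enat L < \<tau> y} y \<le> enat_powr (\<tau> y) q"
      proof (cases "enat L < \<tau> y")
        case True
        show ?thesis
        proof (cases "\<tau> y")
          case (enat m)
          then have "(1 - \<epsilon>) * x / J \<le> real m" using True L by simp
          then have "((1 - \<epsilon>) * x / J) powr q \<le> real m powr q" using pos \<open>0 < q\<close> by (intro powr_mono2) auto
          then show ?thesis using enat by (auto simp: enat_powr_def indicator_def intro!: ennreal_leI)
        qed (simp add: enat_powr_def)
      qed simp
    qed
    finally show ?thesis by (simp only: x_def)
  qed
  moreover have "0 < \<delta>" using \<epsilon> by (simp add: \<delta>_def)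
  ultimately show ?thesis by blast
qed

section \<open>Likelihood ratios of the channels\<close>

lemma subalgebra_channel_filtration:
  assumes "sets P = sets (path_space S)"
  shows "subalgebra P (channel_filtration S t)"
proof -
  have sp: "space P = space (path_space S)" using assms by (rule sets_eq_imp_space_eq)
  have "sets (channel_filtration S t) \<subseteq> sets (path_space S)"
    unfolding channel_filtration_def
  proof (subst sets_measure_of)
    show "sigma_sets (space (path_space S))
        {(\<lambda>x. x s) -` B \<inter> space (path_space S) |s B. 1 \<le> s \<and> s \<le> t \<and> B \<in> sets S} \<subseteq> sets (path_space S)"
    proof (rule sets.sigma_sets_subset, safe)
      fix s :: nat and B assume "1 \<le> s" "B \<in> sets S"
      then have "(\<lambda>x. x s) \<in> measurable (path_space S) S"
        unfolding path_space_def by (intro measurable_component_singleton) auto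
      then show "(\<lambda>x. x s) -` B \<inter> space (path_space S) \<in> sets (path_space S)"
        using \<open>B \<in> sets S\<close> by (rule measurable_sets)
    qed
  qed auto
  then show ?thesis using assms sp by (simp add: subalgebra_def channel_filtration_def space_measure_of_conv)
qed

text \<open>
  The exponential of the logarithm returns the derivative only where it is positive and finite.
  Mutual absolute continuity makes the complement a null set.
\<close>

lemma density_eq_of_ln_RN_deriv:
  assumes "finite_measure M" "finite_measure N" "sets N = sets M"
    and ac: "absolutely_continuous M N" "absolutely_continuous N M"
  shows "N = density M (\<lambda>x. ennreal (exp (ln (enn2real (RN_deriv M N x)))))"
proof -
  interpret M: finite_measure M by fact
  interpret N: finite_measure N by fact
  have dens: "density M (RN_deriv M N) = N" using ac assms by (intro M.density_RN_deriv) auto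
  have fin: "AE x in M. RN_deriv M N x \<noteq> \<infinity>"
    using ac assms by (intro M.RN_deriv_finite N.sigma_finite_measure_axioms) auto
  have pos: "AE x in M. RN_deriv M N x \<noteq> 0"
  proof -
    define B where "B = {x \<in> space M. RN_deriv M N x = 0}"
    have B: "B \<in> sets M" by (simp add: B_def)
    have "emeasure N B = (\<integral>\<^sup>+x. RN_deriv M N x * indicator B x \<partial>M)"
      using B by (subst dens[symmetric], subst emeasure_density) auto
    also have "\<dots> = (\<integral>\<^sup>+x. 0 \<partial>M)" by (intro nn_integral_cong) (auto simp: B_def indicator_def)
    finally have "B \<in> null_sets N" using B assms by (auto simp: null_sets_def)
    then have "B \<in> null_sets M" using ac by (auto simp: absolutely_continuous_def)
    then show ?thesis by (rule AE_I') (auto simp: B_def)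
  qed
  have "density M (RN_deriv M N) = density M (\<lambda>x. ennreal (exp (ln (enn2real (RN_deriv M N x)))))"
  proof (rule density_cong)
    show "AE x in M. RN_deriv M N x = ennreal (exp (ln (enn2real (RN_deriv M N x))))"
      using fin pos
    proof eventually_elim
      case (elim x)
      then have "0 < enn2real (RN_deriv M N x)"
        by (simp add: enn2real_positive_iff top.not_eq_extremum zero_less_iff_neq_zero)
      then show ?case using elim by (simp add: exp_ln top.not_eq_extremum)
    qed
  qed auto
  with dens show ?thesis by simp
qed

lemma llr_process_channel:
  assumes "channel_model S P0 P1"
  shows "llr_process P0 P1 (channel_filtration S) (\<lambda>t x. - channel_llr S P0 P1 t x)"
  unfolding llr_process_def
proof (intro allI conjI)
  fix t
  let ?F = "channel_filtration S t"
  have P: "prob_space P0" "prob_space P1" "sets P0 = sets (path_space S)" "sets P1 = sets (path_space S)"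
    using assms by (auto simp: channel_model_def)
  show sub: "subalgebra P0 ?F" "subalgebra P1 ?F" using P by (auto intro: subalgebra_channel_filtration)
  interpret M: prob_space "restr_to_subalg P0 ?F" using P sub by (intro prob_space_restr_to_subalg)
  interpret N: prob_space "restr_to_subalg P1 ?F" using P sub by (intro prob_space_restr_to_subalg)
  have sets_eq: "sets (restr_to_subalg P0 ?F) = sets ?F" "sets (restr_to_subalg P1 ?F) = sets ?F"
    using sub by (simp_all add: sets_restr_to_subalg)
  have "RN_deriv (restr_to_subalg P0 ?F) (restr_to_subalg P1 ?F) \<in> borel_measurable (restr_to_subalg P0 ?F)"
    by (rule borel_measurable_RN_deriv)
  then have [measurable]: "RN_deriv (restr_to_subalg P0 ?F) (restr_to_subalg P1 ?F) \<in> borel_measurable ?F"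
    unfolding measurable_cong_sets[OF sets_eq(1) refl] .
  show "(\<lambda>x. - channel_llr S P0 P1 t x) \<in> borel_measurable ?F"
    unfolding channel_llr_def likelihood_ratio_def by measurable
  show "restr_to_subalg P1 ?F = density (restr_to_subalg P0 ?F) (\<lambda>x. ennreal (exp (- (- channel_llr S P0 P1 t x))))"
  proof (cases "t = 0")
    case False
    then have "restr_to_subalg P1 ?F = density (restr_to_subalg P0 ?F)
        (\<lambda>x. ennreal (exp (ln (enn2real (RN_deriv (restr_to_subalg P0 ?F) (restr_to_subalg P1 ?F) x)))))"
      using assms sets_eq
      by (intro density_eq_of_ln_RN_deriv M.finite_measure_axioms N.finite_measure_axioms)
         (auto simp: channel_model_def)
    then show ?thesis using False by (simp add: channel_llr_def likelihood_ratio_def)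
  next
    case True
    then have triv: "sets ?F = {{}, space (path_space S)}"
      by (auto simp: channel_filtration_def sigma_sets_empty_eq)
    have sp: "space P0 = space (path_space S)" "space P1 = space (path_space S)"
      using P(3,4) by (blast dest: sets_eq_imp_space_eq)+
    have "restr_to_subalg P1 ?F = restr_to_subalg P0 ?F"
    proof (rule measure_eqI)
      fix B assume "B \<in> sets (restr_to_subalg P1 ?F)"
      then have "B \<in> sets ?F" by (simp add: sets_eq)
      then show "emeasure (restr_to_subalg P1 ?F) B = emeasure (restr_to_subalg P0 ?F) B"
        using triv sub P sp prob_space.emeasure_space_1[OF P(1)] prob_space.emeasure_space_1[OF P(2)]
        by (auto simp: emeasure_restr_to_subalg)
    qed (simp add: sets_eq)
    then show ?thesis using True by (simp add: channel_llr_def density_1)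
  qed
qed

lemma space_joint_filtration: "space (joint_filtration K S t) = space (sample_space K S)"
  by (simp add: joint_filtration_def space_measure_of_conv)

lemma sets_joint_filtration_mono:
  assumes "s \<le> t"
  shows "sets (joint_filtration K S s) \<subseteq> sets (joint_filtration K S t)"
  unfolding joint_filtration_def
  using assms by (subst (1 2) sets_measure_of) (auto intro!: sigma_sets_mono' intro: order_trans)

lemma filtration_joint: "filtration (space (sample_space K S)) (joint_filtration K S)"
  by (simp add: filtration_def space_joint_filtration sets_joint_filtration_mono)

text \<open>
  At a finite time the joint filtration is the product of the channel filtrations. This makes the
  joint likelihood ratio factorize over channels.
\<close>

lemma sets_joint_filtration:
  "sets (joint_filtration K S (enat t)) = sets (PiM {1..K} (\<lambda>k. channel_filtration (S k) t))"
proof -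
  let ?P = "PiM {1..K} (\<lambda>k. channel_filtration (S k) t)"
  let ?J = "joint_filtration K S (enat t)"
  have spc: "space (channel_filtration (S k) t) = space (path_space (S k))" for k
    by (simp add: channel_filtration_def space_measure_of_conv)
  have sp: "space ?P = space (sample_space K S)"
    by (simp add: sample_space_def space_PiM spc)
  show ?thesis
  proof (rule subset_antisym)
    show "sets ?J \<subseteq> sets ?P"
      unfolding joint_filtration_def
    proof (subst sets_measure_of)
      show "sigma_sets (space (sample_space K S))
         {(\<lambda>\<omega>. \<omega> k s) -` B \<inter> space (sample_space K S) |k s B. k \<in> {1..K} \<and> 1 \<le> s \<and> enat s \<le> enat t \<and> B \<in> sets (S k)}
         \<subseteq> sets ?P"
        unfolding sp[symmetric]
      proof (rule sets.sigma_sets_subset, safe)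
        fix k s :: nat and B assume k: "k \<in> {1..K}" and s: "1 \<le> s" "enat s \<le> enat t" and B: "B \<in> sets (S k)"
        let ?B = "(\<lambda>x. x s) -` B \<inter> space (path_space (S k))"
        have "?B \<in> sets (channel_filtration (S k) t)"
          unfolding channel_filtration_def using s B
          by (subst sets_measure_of) (auto intro!: sigma_sets.Basic)
        then have "(\<lambda>\<omega>. \<omega> k) -` ?B \<inter> space ?P \<in> sets ?P"
          using k by (intro measurable_sets[OF measurable_component_singleton]) auto
        also have "(\<lambda>\<omega>. \<omega> k) -` ?B \<inter> space ?P = (\<lambda>\<omega>. \<omega> k s) -` B \<inter> space ?P"
          using k by (auto simp: space_PiM spc PiE_iff)
        finally show "(\<lambda>\<omega>. \<omega> k s) -` B \<inter> space ?P \<in> sets ?P" .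
      qed
    qed auto
    have "(\<lambda>\<omega>. \<omega>) \<in> measurable ?J ?P"
    proof (rule measurable_PiM_single')
      fix k assume k: "k \<in> {1..K}"
      show "(\<lambda>\<omega>. \<omega> k) \<in> measurable ?J (channel_filtration (S k) t)"
        unfolding channel_filtration_def
      proof (rule measurable_sigma_sets)
        show "sets (sigma (space (path_space (S k)))
            {(\<lambda>x. x s) -` B \<inter> space (path_space (S k)) |s B. 1 \<le> s \<and> s \<le> t \<and> B \<in> sets (S k)})
          = sigma_sets (space (path_space (S k)))
            {(\<lambda>x. x s) -` B \<inter> space (path_space (S k)) |s B. 1 \<le> s \<and> s \<le> t \<and> B \<in> sets (S k)}"
          by (rule sets_measure_of) auto
        show "(\<lambda>\<omega>. \<omega> k) \<in> space ?J \<rightarrow> space (path_space (S k))"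
          using k by (auto simp: space_joint_filtration sample_space_def space_PiM PiE_iff)
        fix A assume "A \<in> {(\<lambda>x. x s) -` B \<inter> space (path_space (S k)) |s B. 1 \<le> s \<and> s \<le> t \<and> B \<in> sets (S k)}"
        then obtain s B where s: "1 \<le> s" "s \<le> t" "B \<in> sets (S k)"
          and A: "A = (\<lambda>x. x s) -` B \<inter> space (path_space (S k))" by auto
        have "(\<lambda>\<omega>. \<omega> k) -` A \<inter> space ?J = (\<lambda>\<omega>. \<omega> k s) -` B \<inter> space (sample_space K S)"
          using k by (auto simp: A space_joint_filtration sample_space_def space_PiM PiE_iff)
        also have "\<dots> \<in> sets ?J"
          unfolding joint_filtration_def using k s
          by (subst sets_measure_of) (auto intro!: sigma_sets.Basic)
        finally show "(\<lambda>\<omega>. \<omega> k) -` A \<inter> space ?J \<in> sets ?J" .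
      qed auto
    qed (auto simp: space_joint_filtration sample_space_def space_PiM spc PiE_iff)
    show "sets ?P \<subseteq> sets ?J"
    proof
      fix B assume B: "B \<in> sets ?P"
      then have "(\<lambda>\<omega>. \<omega>) -` B \<inter> space ?J = B"
        using sets.sets_into_space[OF B] sp by (auto simp: space_joint_filtration)
      with measurable_sets[OF \<open>(\<lambda>\<omega>. \<omega>) \<in> measurable ?J ?P\<close> B] show "B \<in> sets ?J" by simp
    qed
  qed
qed

lemma null_law_eq_signal_law: "null_law K P0 = signal_law K P0 P1 {}"
  by (simp add: null_law_def signal_law_def)

lemma prob_space_signal_law:
  assumes "\<And>k. k \<in> {1..K} \<Longrightarrow> channel_model (S k) (P0 k) (P1 k)"
  shows "prob_space (signal_law K P0 P1 A)"
  unfolding signal_law_def using assms by (intro prob_space_PiM) (auto simp: channel_model_def)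

lemma sets_signal_law:
  assumes "\<And>k. k \<in> {1..K} \<Longrightarrow> channel_model (S k) (P0 k) (P1 k)"
  shows "sets (signal_law K P0 P1 A) = sets (sample_space K S)"
  unfolding signal_law_def sample_space_def using assms
  by (intro sets_PiM_cong) (auto simp: channel_model_def)

lemma sets_joint_filtration_subset: "sets (joint_filtration K S t) \<subseteq> sets (sample_space K S)"
  unfolding joint_filtration_def
proof (subst sets_measure_of)
  show "sigma_sets (space (sample_space K S))
     {(\<lambda>\<omega>. \<omega> k s) -` B \<inter> space (sample_space K S) |k s B. k \<in> {1..K} \<and> 1 \<le> s \<and> enat s \<le> t \<and> B \<in> sets (S k)}
     \<subseteq> sets (sample_space K S)"
  proof (rule sets.sigma_sets_subset, safe)
    fix k s :: nat and B assume "k \<in> {1..K}" "1 \<le> s" "B \<in> sets (S k)"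
    then have "(\<lambda>\<omega>. \<omega> k s) \<in> measurable (sample_space K S) (S k)"
      unfolding sample_space_def path_space_def
      by (intro measurable_compose[OF measurable_component_singleton[of k] measurable_component_singleton[of s]]) auto
    then show "(\<lambda>\<omega>. \<omega> k s) -` B \<inter> space (sample_space K S) \<in> sets (sample_space K S)"
      using \<open>B \<in> sets (S k)\<close> by (rule measurable_sets)
  qed
qed auto

lemma llr_process_null_signal:
  assumes ch: "\<And>k. k \<in> {1..K} \<Longrightarrow> channel_model (S k) (P0 k) (P1 k)" and A: "A \<subseteq> {1..K}"
  shows "llr_process (null_law K P0) (signal_law K P0 P1 A) (\<lambda>t. joint_filtration K S (enat t))
     (\<lambda>t \<omega>. \<Sum>k\<in>A. - channel_llr (S k) (P0 k) (P1 k) t (\<omega> k))"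
proof -
  have "llr_process (PiM {1..K} P0) (PiM {1..K} (\<lambda>k. if k \<in> A then P1 k else P0 k)) (\<lambda>t. joint_filtration K S (enat t))
     (\<lambda>t \<omega>. \<Sum>k\<in>{1..K}. (if k \<in> A then (\<lambda>t x. - channel_llr (S k) (P0 k) (P1 k) t x) else (\<lambda>_ _. 0)) t (\<omega> k))"
  proof (rule llr_process_PiM[where F = "\<lambda>k. channel_filtration (S k)"])
    fix k assume "k \<in> {1..K}"
    note c = ch[OF this]
    show "prob_space (P0 k)" "prob_space (if k \<in> A then P1 k else P0 k)"
      using c by (auto simp: channel_model_def)
    have "subalgebra (P0 k) (channel_filtration (S k) t)" for t
      using c by (intro subalgebra_channel_filtration) (auto simp: channel_model_def)
    then show "llr_process (P0 k) (if k \<in> A then P1 k else P0 k) (channel_filtration (S k))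
        (if k \<in> A then (\<lambda>t x. - channel_llr (S k) (P0 k) (P1 k) t x) else (\<lambda>_ _. 0))"
      using llr_process_channel[OF c] llr_process_refl[of "P0 k" "channel_filtration (S k)"] by simp
  qed (auto simp: sets_joint_filtration)
  moreover have "(\<Sum>k\<in>{1..K}. (if k \<in> A then (\<lambda>t x. - channel_llr (S k) (P0 k) (P1 k) t x) else (\<lambda>_ _. 0)) t (\<omega> k))
      = (\<Sum>k\<in>A. - channel_llr (S k) (P0 k) (P1 k) t (\<omega> k))" for t and \<omega> :: "nat \<Rightarrow> nat \<Rightarrow> 'a"
    using A by (intro sum.mono_neutral_cong_right) auto
  ultimately show ?thesis by (simp add: null_law_def signal_law_def)
qed

lemma llr_process_signal_null:
  assumes "\<And>k. k \<in> {1..K} \<Longrightarrow> channel_model (S k) (P0 k) (P1 k)" and "A \<subseteq> {1..K}"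
  shows "llr_process (signal_law K P0 P1 A) (null_law K P0) (\<lambda>t. joint_filtration K S (enat t))
     (\<lambda>t \<omega>. \<Sum>k\<in>A. channel_llr (S k) (P0 k) (P1 k) t (\<omega> k))"
  using llr_process_swap[OF llr_process_null_signal[OF assms]] by (simp add: sum_negf)

text \<open>
  The equation holds almost everywhere under the null law by uniqueness of densities. Both sides
  are to be compared within the sub-sigma-algebra, where the signal law has a density with respect
  to the null law, so that the equation carries over to every signal law.
\<close>

lemma AE_joint_lr:
  fixes S :: "nat \<Rightarrow> 'a measure"
  assumes ch: "\<And>k. k \<in> {1..K} \<Longrightarrow> channel_model (S k) (P0 k) (P1 k)"
    and A: "A \<subseteq> {1..K}" and B: "B \<subseteq> {1..K}"
  shows "AE \<omega> in signal_law K P0 P1 B.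
    joint_lr K S P0 P1 A t \<omega> = exp (\<Sum>k\<in>A. channel_llr (S k) (P0 k) (P1 k) t (\<omega> k))"
proof -
  let ?F = "joint_filtration K S (enat t)"
  have p0: "prob_space (null_law K P0)"
    using prob_space_signal_law[OF ch] unfolding null_law_eq_signal_law[of K P0 P1] .
  have ae: "AE \<omega> in restr_to_subalg (null_law K P0) ?F.
    joint_lr K S P0 P1 A t \<omega> = exp (\<Sum>k\<in>A. channel_llr (S k) (P0 k) (P1 k) t (\<omega> k))"
    using AE_likelihood_ratio_llr_process[OF p0 llr_process_null_signal[OF ch A], where t = t]
    by (simp add: joint_lr_def sum_negf)
  have Y: "llr_process (null_law K P0) (signal_law K P0 P1 B) (\<lambda>t. joint_filtration K S (enat t))
     (\<lambda>t \<omega>. \<Sum>k\<in>B. - channel_llr (S k) (P0 k) (P1 k) t (\<omega> k))"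
    by (rule llr_process_null_signal[OF _ B]) (rule ch)
  note m = llr_process_measurable[OF Y, where t = t]
  define W where "W \<omega> = (\<Sum>k\<in>B. - channel_llr (S k) (P0 k) (P1 k) t (\<omega> k))" for \<omega> :: "nat \<Rightarrow> nat \<Rightarrow> 'a"
  have [measurable]: "W \<in> borel_measurable (restr_to_subalg (null_law K P0) ?F)"
    unfolding W_def using m(2,3) by (auto intro: measurable_in_subalg)
  have "restr_to_subalg (signal_law K P0 P1 B) ?F
      = density (restr_to_subalg (null_law K P0) ?F) (\<lambda>\<omega>. ennreal (exp (- W \<omega>)))"
    using Y by (simp add: llr_process_def W_def)
  moreover have "AE \<omega> in density (restr_to_subalg (null_law K P0) ?F) (\<lambda>\<omega>. ennreal (exp (- W \<omega>))).
    joint_lr K S P0 P1 A t \<omega> = exp (\<Sum>k\<in>A. channel_llr (S k) (P0 k) (P1 k) t (\<omega> k))"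
    using ae by (subst AE_density) (auto elim: eventually_mono)
  ultimately have "AE \<omega> in restr_to_subalg (signal_law K P0 P1 B) ?F.
    joint_lr K S P0 P1 A t \<omega> = exp (\<Sum>k\<in>A. channel_llr (S k) (P0 k) (P1 k) t (\<omega> k))"
    by (simp only:)
  then show ?thesis by (rule AE_restr_to_subalg[OF m(4)])
qed

lemma measurable_joint_lr:
  assumes ch: "\<And>k. k \<in> {1..K} \<Longrightarrow> channel_model (S k) (P0 k) (P1 k)"
    and A: "A \<subseteq> {1..K}"
  shows "joint_lr K S P0 P1 A t \<in> borel_measurable (joint_filtration K S (enat t))"
proof -
  let ?F = "joint_filtration K S (enat t)"
  have sub: "subalgebra (null_law K P0) ?F"
    using llr_process_measurable(3)[OF llr_process_null_signal[OF ch A]] .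
  have "RN_deriv (restr_to_subalg (null_law K P0) ?F) (restr_to_subalg (signal_law K P0 P1 A) ?F)
      \<in> borel_measurable (restr_to_subalg (null_law K P0) ?F)"
    by (rule borel_measurable_RN_deriv)
  then have [measurable]: "RN_deriv (restr_to_subalg (null_law K P0) ?F) (restr_to_subalg (signal_law K P0 P1 A) ?F)
      \<in> borel_measurable ?F"
    unfolding measurable_cong_sets[OF sets_restr_to_subalg[OF sub] refl] .
  show ?thesis
    unfolding joint_lr_def[abs_def] likelihood_ratio_def by measurable
qed

section \<open>Small error probabilities\<close>

lemma errors_to_zeroI:
  assumes "0 < \<delta>" and "\<And>\<alpha> \<beta>. 0 < \<alpha> \<Longrightarrow> \<alpha> < \<delta> \<Longrightarrow> \<alpha> < 1 \<Longrightarrow> 0 < \<beta> \<Longrightarrow> \<beta> < \<delta> \<Longrightarrow> \<beta> < 1 \<Longrightarrow> P (\<alpha>, \<beta>)"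
  shows "eventually P errors_to_zero"
proof -
  have "eventually (\<lambda>u::real. u < \<delta>) (nhds 0)"
    using \<open>0 < \<delta>\<close> by (intro order_tendstoD(2)[OF filterlim_ident])
  then have "eventually (\<lambda>(\<alpha>, \<beta>). max \<alpha> \<beta> < \<delta>) (filtercomap (\<lambda>(\<alpha>, \<beta>). max \<alpha> \<beta>) (nhds (0::real)))"
    by (auto simp: eventually_filtercomap)
  then show ?thesis
    unfolding errors_to_zero_def eventually_inf_principal
    by eventually_elim (auto intro!: assms(2))
qed

lemma eventually_errors_to_zero_ln:
  assumes "eventually P at_top"
  shows "eventually (\<lambda>(\<alpha>, \<beta>). P \<bar>ln \<alpha>\<bar> \<and> P \<bar>ln \<beta>\<bar>) errors_to_zero"
proof -
  obtain x0 where x0: "\<And>x. x0 \<le> x \<Longrightarrow> P x" using assms by (auto simp: eventually_at_top_linorder)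
  show ?thesis
  proof (rule errors_to_zeroI[of "exp (- x0)"])
    fix \<alpha> \<beta> :: real
    assume "0 < \<alpha>" "\<alpha> < exp (- x0)" "\<alpha> < 1" "0 < \<beta>" "\<beta> < exp (- x0)" "\<beta> < 1"
    moreover have "x0 \<le> \<bar>ln u\<bar>" if "0 < u" "u < exp (- x0)" for u
    proof -
      have "ln u < ln (exp (- x0))" using that by (subst ln_less_cancel_iff) auto
      then show ?thesis by simp
    qed
    ultimately show "case (\<alpha>, \<beta>) of (\<alpha>, \<beta>) \<Rightarrow> P \<bar>ln \<alpha>\<bar> \<and> P \<bar>ln \<beta>\<bar>"
      unfolding prod.case by (blast intro: x0)
  qed simp
qed

text \<open>
  The bounds make all quantities finite and positive eventually, so that the division of extended
  reals agrees with the division of reals.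
\<close>

lemma ratio_to_one_sandwich:
  fixes U V :: "real \<Rightarrow> real \<Rightarrow> ennreal" and g :: "real \<Rightarrow> real \<Rightarrow> real"
  assumes pos: "\<forall>\<^sub>F (\<alpha>, \<beta>) in errors_to_zero. 0 < g \<alpha> \<beta> \<and> V \<alpha> \<beta> \<le> U \<alpha> \<beta>"
    and upper: "\<And>\<eta>. 0 < \<eta> \<Longrightarrow> \<forall>\<^sub>F (\<alpha>, \<beta>) in errors_to_zero. U \<alpha> \<beta> \<le> ennreal ((1 + \<eta>) * g \<alpha> \<beta>)"
    and lower: "\<And>\<eta>. 0 < \<eta> \<Longrightarrow> \<eta> < 1 \<Longrightarrow> \<forall>\<^sub>F (\<alpha>, \<beta>) in errors_to_zero. ennreal ((1 - \<eta>) * g \<alpha> \<beta>) \<le> V \<alpha> \<beta>"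
  shows "ratio_to_one U (\<lambda>\<alpha> \<beta>. ennreal (g \<alpha> \<beta>)) \<and> ratio_to_one (\<lambda>\<alpha> \<beta>. ennreal (g \<alpha> \<beta>)) V"
proof -
  have real_lim: "((\<lambda>z. enn2real (W z) / g (fst z) (snd z)) \<longlongrightarrow> 1) errors_to_zero"
    if W: "\<And>z. W z = U (fst z) (snd z) \<or> W z = V (fst z) (snd z)" for W
  proof (rule tendstoI)
    fix e :: real assume "0 < e"
    define \<eta> where "\<eta> = min (e / 2) (1 / 2)"
    have \<eta>: "0 < \<eta>" "\<eta> < 1" "\<eta> < e" using \<open>0 < e\<close> by (auto simp: \<eta>_def)
    show "\<forall>\<^sub>F z in errors_to_zero. dist (enn2real (W z) / g (fst z) (snd z)) 1 < e"
      using pos upper[OF \<eta>(1)] lower[OF \<eta>(1,2)]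
    proof eventually_elim
      case (elim z)
      obtain \<alpha> \<beta> where z: "z = (\<alpha>, \<beta>)" by (cases z)
      have g: "0 < g \<alpha> \<beta>" using elim z by simp
      have "ennreal ((1 - \<eta>) * g \<alpha> \<beta>) \<le> W z \<and> W z \<le> ennreal ((1 + \<eta>) * g \<alpha> \<beta>)"
        using W[of z] elim z by (auto intro: order_trans)
      then have b: "ennreal ((1 - \<eta>) * g \<alpha> \<beta>) \<le> W z" "W z \<le> ennreal ((1 + \<eta>) * g \<alpha> \<beta>)" by auto
      then have "W z \<noteq> \<top>" using ennreal_neq_top[of "(1 + \<eta>) * g \<alpha> \<beta>"] by (auto simp: top_unique)
      then obtain w where w: "W z = ennreal w" "0 \<le> w" by (cases "W z") auto
      have "(1 - \<eta>) * g \<alpha> \<beta> \<le> w" "w \<le> (1 + \<eta>) * g \<alpha> \<beta>"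
        using b w g \<eta> by (auto simp: ennreal_le_iff)
      then have "1 - \<eta> \<le> w / g \<alpha> \<beta>" "w / g \<alpha> \<beta> \<le> 1 + \<eta>" using g by (auto simp: field_simps)
      then show ?case using w z \<eta> by (auto simp: dist_real_def)
    qed
  qed
  have fin: "\<forall>\<^sub>F z in errors_to_zero. 0 < g (fst z) (snd z) \<and> 0 < V (fst z) (snd z) \<and>
      U (fst z) (snd z) \<noteq> \<top> \<and> V (fst z) (snd z) \<noteq> \<top>"
    using pos upper[OF zero_less_one] lower[of "1 / 2", simplified]
  proof eventually_elim
    case (elim z)
    obtain \<alpha> \<beta> where z: "z = (\<alpha>, \<beta>)" by (cases z)
    have g: "0 < ennreal (g \<alpha> \<beta> / 2)" using elim z by simp
    have "ennreal (g \<alpha> \<beta> / 2) \<le> V \<alpha> \<beta>" using elim z by simp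
    with g have "0 < V \<alpha> \<beta>" by (rule less_le_trans)
    moreover have "U \<alpha> \<beta> < \<top>" using elim z by (auto intro: le_less_trans[OF _ ennreal_less_top])
    ultimately show ?case using elim z by (auto dest: le_less_trans)
  qed
  have "((\<lambda>z. ennreal (enn2real (U (fst z) (snd z)) / g (fst z) (snd z))) \<longlongrightarrow> ennreal 1) errors_to_zero"
    by (intro tendsto_ennrealI real_lim) auto
  then have "((\<lambda>(\<alpha>, \<beta>). U \<alpha> \<beta> / ennreal (g \<alpha> \<beta>)) \<longlongrightarrow> ennreal 1) errors_to_zero"
  proof (rule Lim_transform_eventually)
    show "\<forall>\<^sub>F z in errors_to_zero. ennreal (enn2real (U (fst z) (snd z)) / g (fst z) (snd z))
        = (case z of (\<alpha>, \<beta>) \<Rightarrow> U \<alpha> \<beta> / ennreal (g \<alpha> \<beta>))"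
      using fin
    proof eventually_elim
      case (elim z)
      obtain u where u: "U (fst z) (snd z) = ennreal u" "0 \<le> u" using elim by (cases "U (fst z) (snd z)") auto
      show ?case using elim u by (simp add: case_prod_beta divide_ennreal)
    qed
  qed
  moreover have "((\<lambda>z. inverse (enn2real (V (fst z) (snd z)) / g (fst z) (snd z))) \<longlongrightarrow> inverse 1) errors_to_zero"
    by (intro tendsto_inverse real_lim) auto
  then have "((\<lambda>z. ennreal (inverse (enn2real (V (fst z) (snd z)) / g (fst z) (snd z)))) \<longlongrightarrow> ennreal (inverse 1)) errors_to_zero"
    by (rule tendsto_ennrealI)
  then have "((\<lambda>(\<alpha>, \<beta>). ennreal (g \<alpha> \<beta>) / V \<alpha> \<beta>) \<longlongrightarrow> ennreal (inverse 1)) errors_to_zero"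
  proof (rule Lim_transform_eventually)
    show "\<forall>\<^sub>F z in errors_to_zero. ennreal (inverse (enn2real (V (fst z) (snd z)) / g (fst z) (snd z)))
        = (case z of (\<alpha>, \<beta>) \<Rightarrow> ennreal (g \<alpha> \<beta>) / V \<alpha> \<beta>)"
      using fin
    proof eventually_elim
      case (elim z)
      obtain v where v: "V (fst z) (snd z) = ennreal v" "0 \<le> v" using elim by (cases "V (fst z) (snd z)") auto
      then have "0 < v" using elim by (simp add: ennreal_less_zero_iff)
      then show ?case using elim v by (simp add: case_prod_beta divide_ennreal)
    qed
  qed
  ultimately show ?thesis by (simp add: ratio_to_one_def)
qed

section \<open>The mixture test\<close>

lemma sequential_test_measurable:
  assumes T: "sequential_test K S \<tau> d" and i: "i \<in> {0, 1}"
  shows "{\<omega> \<in> space (sample_space K S). enat n < \<tau> \<omega>} \<in> sets (sample_space K S)"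
    and "{\<omega> \<in> selects K S \<tau> d i. \<tau> \<omega> = enat t} \<in> sets (joint_filtration K S (enat t))"
    and "selects K S \<tau> d i \<in> sets (sample_space K S)"
proof -
  let ?\<Omega> = "space (sample_space K S)" and ?F = "joint_filtration K S"
  interpret filtration ?\<Omega> ?F by (rule filtration_joint)
  have st: "stopping_time ?F \<tau>" and d: "d \<in> measurable (pre_sigma \<tau>) (count_space {0, 1})"
    using T by (auto simp: sequential_test_def)
  have le: "{\<omega> \<in> ?\<Omega>. \<tau> \<omega> \<le> t} \<in> sets (?F t)" for t
    using stopping_timeD[OF st, of t] by (simp add: pred_def space_F)
  have "?\<Omega> - {\<omega> \<in> ?\<Omega>. \<tau> \<omega> \<le> enat n} \<in> sets (?F (enat n))"
    using sets.compl_sets[OF le[of "enat n"]] by (simp add: space_F)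
  moreover have "?\<Omega> - {\<omega> \<in> ?\<Omega>. \<tau> \<omega> \<le> enat n} = {\<omega> \<in> ?\<Omega>. enat n < \<tau> \<omega>}" by auto
  ultimately show "{\<omega> \<in> ?\<Omega>. enat n < \<tau> \<omega>} \<in> sets (sample_space K S)"
    using sets_joint_filtration_subset by (metis subsetD)
  have "d -` {i} \<inter> space (pre_sigma \<tau>) \<in> sets (pre_sigma \<tau>)" using i by (intro measurable_sets[OF d]) auto
  then have D: "{\<omega> \<in> d -` {i} \<inter> ?\<Omega>. \<tau> \<omega> \<le> t} \<in> sets (?F t)" for t
    unfolding space_pre_sigma by (rule sets_pre_sigmaD[OF st])
  show sel: "{\<omega> \<in> selects K S \<tau> d i. \<tau> \<omega> = enat t} \<in> sets (?F (enat t))" for t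
  proof (cases t)
    case 0
    then have "{\<omega> \<in> selects K S \<tau> d i. \<tau> \<omega> = enat t} = {\<omega> \<in> d -` {i} \<inter> ?\<Omega>. \<tau> \<omega> \<le> enat t}"
      by (auto simp: selects_def enat_0_iff zero_enat_def[symmetric])
    then show ?thesis using D by simp
  next
    case (Suc s)
    have "{\<omega> \<in> ?\<Omega>. \<tau> \<omega> \<le> enat s} \<in> sets (?F (enat t))"
      using le[of "enat s"] sets_F_mono[of "enat s" "enat t"] Suc by auto
    moreover have "\<tau> \<omega> = enat t \<longleftrightarrow> \<tau> \<omega> \<le> enat t \<and> \<not> \<tau> \<omega> \<le> enat s" for \<omega>
      using Suc by (cases "\<tau> \<omega>") auto
    then have "{\<omega> \<in> selects K S \<tau> d i. \<tau> \<omega> = enat t}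
        = {\<omega> \<in> d -` {i} \<inter> ?\<Omega>. \<tau> \<omega> \<le> enat t} - {\<omega> \<in> ?\<Omega>. \<tau> \<omega> \<le> enat s}"
      by (auto simp: selects_def intro: le_less_trans)
    ultimately show ?thesis using D by auto
  qed
  have "selects K S \<tau> d i = (\<Union>t. {\<omega> \<in> selects K S \<tau> d i. \<tau> \<omega> = enat t})"
    by (auto simp: selects_def)
  also have "\<dots> \<in> sets (sample_space K S)"
    using sel sets_joint_filtration_subset[of K S] by (intro sets.countable_UN) blast
  finally show "selects K S \<tau> d i \<in> sets (sample_space K S)" .
qed

locale multichannel_problem =
  fixes K :: nat
    and S :: "nat \<Rightarrow> 'a measure"
    and P0 P1 :: "nat \<Rightarrow> (nat \<Rightarrow> 'a) measure"
    and \<P> :: "nat set set"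
    and p :: "nat set \<Rightarrow> real"
  assumes channels: "\<And>k. k \<in> {1..K} \<Longrightarrow> channel_model (S k) (P0 k) (P1 k)"
    and family: "\<P> \<noteq> {}" "\<P> \<subseteq> Pow {1..K}" "{} \<notin> \<P>"
    and weights: "\<And>A. A \<in> \<P> \<Longrightarrow> 0 < p A" "(\<Sum>A\<in>\<P>. p A) = 1"
begin

abbreviation law :: "nat set \<Rightarrow> (nat \<Rightarrow> nat \<Rightarrow> 'a) measure" where "law A \<equiv> signal_law K P0 P1 A"

abbreviation \<F> :: "enat \<Rightarrow> (nat \<Rightarrow> nat \<Rightarrow> 'a) measure" where "\<F> \<equiv> joint_filtration K S"

abbreviation mix :: "nat \<Rightarrow> (nat \<Rightarrow> nat \<Rightarrow> 'a) \<Rightarrow> real" where "mix \<equiv> mixture_llr K S P0 P1 \<P> p"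

abbreviation \<tau>\<^sub>m :: "real \<Rightarrow> real \<Rightarrow> (nat \<Rightarrow> nat \<Rightarrow> 'a) \<Rightarrow> enat" where
  "\<tau>\<^sub>m \<equiv> mslrt_time K S P0 P1 \<P> p"

lemma mslrt_time_le_iff:
  "\<tau>\<^sub>m a b \<omega> \<le> enat n \<longleftrightarrow>
     (\<exists>s\<in>{1..n}. mix s \<omega> \<notin> {-a<..<b})"
proof -
  let ?E = "{enat t | t. 1 \<le> t \<and> mix t \<omega> \<notin> {-a<..<b}}"
  have attained: "Inf ?E \<in> ?E" if "?E \<noteq> {}"
    using that wellorder_InfI[of _ ?E] by blast
  show ?thesis
  proof
    assume le: "\<tau>\<^sub>m a b \<omega> \<le> enat n"
    have "Inf ?E = \<infinity>" if "?E = {}" unfolding that by (simp add: Inf_enat_def)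
    then have "?E \<noteq> {}" using le unfolding mslrt_time_def by fastforce
    then obtain t where "Inf ?E = enat t" "1 \<le> t" "mix t \<omega> \<notin> {-a<..<b}"
      using attained by blast
    then show "\<exists>s\<in>{1..n}. mix s \<omega> \<notin> {-a<..<b}"
      using le by (intro bexI[of _ t]) (auto simp: mslrt_time_def)
  next
    assume "\<exists>s\<in>{1..n}. mix s \<omega> \<notin> {-a<..<b}"
    then obtain s where "s \<in> {1..n}" "mix s \<omega> \<notin> {-a<..<b}" by blast
    then have "Inf ?E \<le> enat s" by (intro Inf_lower) auto
    also have "enat s \<le> enat n" using \<open>s \<in> {1..n}\<close> by simp
    finally show "\<tau>\<^sub>m a b \<omega> \<le> enat n" by (simp add: mslrt_time_def)
  qed
qed

lemma one_le_mslrt_time: "1 \<le> \<tau>\<^sub>m a b \<omega>"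
  unfolding mslrt_time_def by (intro Inf_greatest) (auto simp: one_enat_def)

lemma mslrt_time_eqD:
  assumes "\<tau>\<^sub>m a b \<omega> = enat t"
  shows "mix t \<omega> \<notin> {-a<..<b}"
proof -
  obtain s where s: "s \<in> {1..t}" "mix s \<omega> \<notin> {-a<..<b}"
    using assms mslrt_time_le_iff[of a b \<omega> t] by auto
  then have "\<tau>\<^sub>m a b \<omega> \<le> enat s"
    by (subst mslrt_time_le_iff) auto
  then have "s = t" using assms s by auto
  with s show "mix t \<omega> \<notin> {-a<..<b}" by simp
qed

text \<open>
  Written with an existential quantifier so that the decision needs no value of the statistic at
  an infinite stopping time.
\<close>

definition d\<^sub>m ::
  "real \<Rightarrow> real \<Rightarrow> (nat \<Rightarrow> nat \<Rightarrow> 'a) \<Rightarrow> nat" where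
  "d\<^sub>m a b \<omega> =
     (if \<exists>t. \<tau>\<^sub>m a b \<omega> = enat t \<and> b \<le> mix t \<omega> then 1 else 0)"

definition LLR :: "nat set \<Rightarrow> nat \<Rightarrow> (nat \<Rightarrow> nat \<Rightarrow> 'a) \<Rightarrow> real" where
  "LLR A t \<omega> = (\<Sum>k\<in>A. channel_llr (S k) (P0 k) (P1 k) t (\<omega> k))"

lemma finite_family: "finite \<P>"
  using family(2) by (rule finite_subset) simp

lemma family_subset: "A \<in> \<P> \<Longrightarrow> A \<subseteq> {1..K}"
  using family(2) by auto

lemma prob_space_law: "prob_space (law A)"
  by (rule prob_space_signal_law) (rule channels)

lemma sets_law: "sets (law A) = sets (sample_space K S)"
  by (rule sets_signal_law) (rule channels)

lemma space_law: "space (law A) = space (sample_space K S)"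
  by (rule sets_eq_imp_space_eq) (rule sets_law)

lemma llr_process_null: "A \<subseteq> {1..K} \<Longrightarrow>
    llr_process (law {}) (law A) (\<lambda>t. \<F> (enat t)) (\<lambda>t \<omega>. - LLR A t \<omega>)"
  using llr_process_null_signal[of K S P0 P1 A, OF channels]
  by (simp add: LLR_def sum_negf null_law_eq_signal_law[of K P0 P1])

lemma llr_process_signal: "A \<subseteq> {1..K} \<Longrightarrow>
    llr_process (law A) (law {}) (\<lambda>t. \<F> (enat t)) (LLR A)"
  using llr_process_signal_null[of K S P0 P1 A, OF channels]
  by (simp add: LLR_def[abs_def] null_law_eq_signal_law[of K P0 P1])

lemma emeasure_law:
  assumes "A \<subseteq> {1..K}" "B \<in> sets (\<F> (enat t))"
  shows "emeasure (law A) B = (\<integral>\<^sup>+\<omega>. ennreal (exp (LLR A t \<omega>)) * indicator B \<omega> \<partial>law {})"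
  using llr_process_emeasure[OF llr_process_null[OF assms(1)] assms(2)] by simp

lemma measurable_LLR: "A \<subseteq> {1..K} \<Longrightarrow> LLR A t \<in> borel_measurable (law B)"
  using llr_process_measurable(1)[OF llr_process_signal, of A t]
  by (simp add: measurable_cong_sets[OF sets_law[of A] refl] measurable_cong_sets[OF sets_law[of B] refl])

lemma measurable_mix: "mix t \<in> borel_measurable (\<F> (enat t))"
proof -
  have [measurable]: "A \<in> \<P> \<Longrightarrow> joint_lr K S P0 P1 A t \<in> borel_measurable (\<F> (enat t))" for A
    by (rule measurable_joint_lr[OF _ family_subset]) (rule channels)
  show ?thesis unfolding mixture_llr_def[abs_def] by measurable
qed

lemma mixture_pos: "0 < (\<Sum>A\<in>\<P>. p A * exp (LLR A t \<omega>))"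
  using finite_family family(1) weights(1) by (intro sum_pos) auto

lemma AE_mix:
  assumes "B \<subseteq> {1..K}"
  shows "AE \<omega> in law B. mix t \<omega> = ln (\<Sum>A\<in>\<P>. p A * exp (LLR A t \<omega>))"
proof -
  have "AE \<omega> in law B. \<forall>A\<in>\<P>. joint_lr K S P0 P1 A t \<omega> = exp (LLR A t \<omega>)"
    unfolding LLR_def
    by (rule AE_finite_allI[OF finite_family], rule AE_joint_lr, rule channels, assumption)
       (rule family_subset, assumption, rule assms)
  then show ?thesis by eventually_elim (simp add: mixture_llr_def)
qed

lemma stopping_time_mslrt: "stopping_time \<F> (\<tau>\<^sub>m a b)"
proof
  fix t :: enat
  show "Measurable.pred (\<F> t) (\<lambda>\<omega>. \<tau>\<^sub>m a b \<omega> \<le> t)"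
  proof (cases t)
    case (enat n)
    have mm: "Measurable.pred (\<F> t) (\<lambda>\<omega>. mix s \<omega> \<notin> {-a<..<b})" if "s \<in> {1..n}" for s
    proof -
      have "sets (\<F> (enat s)) \<subseteq> sets (\<F> t)"
        using that enat by (intro sets_joint_filtration_mono) simp
      then have [measurable]: "mix s \<in> borel_measurable (\<F> t)"
        using measurable_mix[of s] by (auto simp: measurable_def space_joint_filtration)
      show ?thesis by measurable
    qed
    show ?thesis unfolding enat mslrt_time_le_iff unfolding enat[symmetric]
      by (intro pred_intros_finite mm finite_atLeastAtMost) assumption
  qed simp
qed

lemma sequential_test_mslrt: "sequential_test K S (\<tau>\<^sub>m a b) (d\<^sub>m a b)"
proof -
  let ?\<Omega> = "space (sample_space K S)"
  interpret filtration ?\<Omega> \<F> by (rule filtration_joint)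
  note st = stopping_time_mslrt[of a b]
  define W where "W s = {\<omega> \<in> ?\<Omega>. \<tau>\<^sub>m a b \<omega> = enat s \<and> b \<le> mix s \<omega>}" for s
  have W: "W s \<in> sets (\<F> (enat s))" for s
  proof -
    have le: "Measurable.pred (\<F> (enat s)) (\<lambda>\<omega>. \<tau>\<^sub>m a b \<omega> \<le> enat r)" if "r \<le> s" for r
      using that by (intro stopping_time_le_const[OF st]) simp
    have eq: "\<tau>\<^sub>m a b \<omega> = enat s \<longleftrightarrow> \<tau>\<^sub>m a b \<omega> \<le> enat s \<and> (\<forall>r<s. \<not> \<tau>\<^sub>m a b \<omega> \<le> enat r)" for \<omega>
      by (cases "\<tau>\<^sub>m a b \<omega>") (auto simp: not_le, metis le_neq_implies_less less_irrefl)
    have "Measurable.pred (\<F> (enat s)) (\<lambda>\<omega>. (\<tau>\<^sub>m a b \<omega> \<le> enat s \<and> (\<forall>r\<in>{..<s}. \<not> \<tau>\<^sub>m a b \<omega> \<le> enat r)) \<and> b \<le> mix s \<omega>)"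
      using measurable_mix[of s]
      by (intro pred_intros_logic pred_intros_finite le borel_measurable_pred_less borel_measurable_le) auto
    then show ?thesis by (simp add: W_def eq pred_def space_F Ball_def)
  qed
  have "{\<omega> \<in> ?\<Omega>. d\<^sub>m a b \<omega> = 1} \<in> sets (pre_sigma (\<tau>\<^sub>m a b))"
  proof (rule sets_pre_sigmaI[OF st])
    fix t
    have "{\<omega> \<in> {\<omega> \<in> ?\<Omega>. d\<^sub>m a b \<omega> = 1}. \<tau>\<^sub>m a b \<omega> \<le> t} = (\<Union>s\<in>{s. enat s \<le> t}. W s)"
      by (auto simp: W_def d\<^sub>m_def split: if_splits)
    also have "\<dots> \<in> sets (\<F> t)"
      using W sets_F_mono[of "enat _" t] by (intro sets.countable_UN') auto
    finally show "{\<omega> \<in> {\<omega> \<in> ?\<Omega>. d\<^sub>m a b \<omega> = 1}. \<tau>\<^sub>m a b \<omega> \<le> t} \<in> sets (\<F> t)" .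
  qed
  then have [measurable]: "Measurable.pred (pre_sigma (\<tau>\<^sub>m a b)) (\<lambda>\<omega>. d\<^sub>m a b \<omega> = 1)"
    by (simp add: pred_def space_pre_sigma)
  have "(\<lambda>\<omega>. if d\<^sub>m a b \<omega> = 1 then 1 else 0) \<in> measurable (pre_sigma (\<tau>\<^sub>m a b)) (count_space {0, 1 :: nat})"
    by measurable
  also have "(\<lambda>\<omega>. if d\<^sub>m a b \<omega> = 1 then 1 else 0) = d\<^sub>m a b"
    by (auto simp: d\<^sub>m_def fun_eq_iff)
  finally show ?thesis
    using st by (simp add: sequential_test_def one_le_mslrt_time)
qed

end

context multichannel_problem
begin

lemma emeasure_selects:
  assumes "sequential_test K S \<tau> d" "i \<in> {0, 1}"
  shows "emeasure (law A) (selects K S \<tau> d i) = (\<Sum>s. emeasure (law A) {\<omega> \<in> selects K S \<tau> d i. \<tau> \<omega> = enat s})"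
proof -
  have "emeasure (law A) (\<Union>s. {\<omega> \<in> selects K S \<tau> d i. \<tau> \<omega> = enat s})
      = (\<Sum>s. emeasure (law A) {\<omega> \<in> selects K S \<tau> d i. \<tau> \<omega> = enat s})"
    using sequential_test_measurable(2)[OF assms] sets_joint_filtration_subset[of K S] sets_law
    by (intro suminf_emeasure[symmetric]) (auto simp: disjoint_family_on_def)
  also have "(\<Union>s. {\<omega> \<in> selects K S \<tau> d i. \<tau> \<omega> = enat s}) = selects K S \<tau> d i"
    by (auto simp: selects_def)
  finally show ?thesis .
qed

text \<open>
  On the event that the test stops at \<open>s\<close> and rejects the null hypothesis, the mixture likelihood
  ratio is at least \<open>1 / \<alpha>\<close>. So the null probability of this event is at most \<open>\<alpha>\<close> times its
  probability under the mixture of the signal laws with weights \<open>p\<close>.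
\<close>

lemma mslrt_false_alarm_le:
  assumes "0 < \<alpha>" "\<alpha> < 1"
  shows "measure (law {}) (selects K S (\<tau>\<^sub>m a (mslrt_b \<alpha>)) (d\<^sub>m a (mslrt_b \<alpha>)) 1) \<le> \<alpha>"
proof -
  interpret prob_space "law {}" by (rule prob_space_law)
  let ?\<tau> = "\<tau>\<^sub>m a (mslrt_b \<alpha>)" and ?d = "d\<^sub>m a (mslrt_b \<alpha>)"
  note T = sequential_test_mslrt[of a "mslrt_b \<alpha>"]
  have b: "mslrt_b \<alpha> = - ln \<alpha>" using assms by (simp add: mslrt_b_def)
  define W where "W s = {\<omega> \<in> selects K S ?\<tau> ?d 1. ?\<tau> \<omega> = enat s}" for s
  have W: "W s \<in> sets (\<F> (enat s))" for s
    unfolding W_def using sequential_test_measurable(2)[OF T, of 1] by simp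
  have WL[measurable]: "W s \<in> sets (law {})" for s
    using W sets_joint_filtration_subset sets_law by blast
  have [measurable]: "A \<in> \<P> \<Longrightarrow> LLR A s \<in> borel_measurable (law {})" for A s
    by (intro measurable_LLR family_subset)
  have Ws: "emeasure (law {}) (W s) \<le> (\<Sum>A\<in>\<P>. ennreal (\<alpha> * p A) * emeasure (law A) (W s))" for s
  proof -
    have "emeasure (law {}) (W s) = (\<integral>\<^sup>+\<omega>. indicator (W s) \<omega> \<partial>law {})" by simp
    also have "\<dots> \<le> (\<integral>\<^sup>+\<omega>. (\<Sum>A\<in>\<P>. ennreal (\<alpha> * p A) * (ennreal (exp (LLR A s \<omega>)) * indicator (W s) \<omega>)) \<partial>law {})"
    proof (rule nn_integral_mono_AE)
      show "AE \<omega> in law {}. indicator (W s) \<omega> \<le> (\<Sum>A\<in>\<P>. ennreal (\<alpha> * p A) * (ennreal (exp (LLR A s \<omega>)) * indicator (W s) \<omega>))"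
        using AE_mix[OF empty_subsetI, of s]
      proof eventually_elim
        case (elim \<omega>)
        show ?case
        proof (cases "\<omega> \<in> W s")
          case True
          then have "- ln \<alpha> \<le> mix s \<omega>" by (auto simp: W_def selects_def d\<^sub>m_def b split: if_splits)
          then have "exp (- ln \<alpha>) \<le> exp (ln (\<Sum>A\<in>\<P>. p A * exp (LLR A s \<omega>)))" unfolding elim by simp
          then have "1 / \<alpha> \<le> (\<Sum>A\<in>\<P>. p A * exp (LLR A s \<omega>))"
            using mixture_pos assms by (simp add: exp_minus field_simps)
          then have "1 \<le> (\<Sum>A\<in>\<P>. \<alpha> * p A * exp (LLR A s \<omega>))"
            using assms by (simp add: field_simps sum_distrib_left)
          then have "ennreal 1 \<le> ennreal (\<Sum>A\<in>\<P>. \<alpha> * p A * exp (LLR A s \<omega>))" by (rule ennreal_leI)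
          also have "\<dots> = (\<Sum>A\<in>\<P>. ennreal (\<alpha> * p A) * ennreal (exp (LLR A s \<omega>)))"
            using assms weights(1) by (subst sum_ennreal[symmetric]) (auto simp: ennreal_mult less_imp_le intro!: sum.cong)
          finally show ?thesis using True by simp
        qed simp
      qed
    qed
    also have "\<dots> = (\<Sum>A\<in>\<P>. ennreal (\<alpha> * p A) * (\<integral>\<^sup>+\<omega>. ennreal (exp (LLR A s \<omega>)) * indicator (W s) \<omega> \<partial>law {}))"
      by (subst nn_integral_sum) (auto intro!: sum.cong nn_integral_cmult)
    also have "\<dots> = (\<Sum>A\<in>\<P>. ennreal (\<alpha> * p A) * emeasure (law A) (W s))"
      using emeasure_law[OF family_subset W] by (intro sum.cong) auto
    finally show ?thesis .
  qed
  have "emeasure (law {}) (selects K S ?\<tau> ?d 1) = (\<Sum>s. emeasure (law {}) (W s))"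
    unfolding W_def using T by (intro emeasure_selects) auto
  also have "\<dots> \<le> (\<Sum>s. \<Sum>A\<in>\<P>. ennreal (\<alpha> * p A) * emeasure (law A) (W s))"
    by (intro suminf_le Ws) auto
  also have "\<dots> = (\<Sum>A\<in>\<P>. \<Sum>s. ennreal (\<alpha> * p A) * emeasure (law A) (W s))"
    by (rule suminf_sum) auto
  also have "\<dots> = (\<Sum>A\<in>\<P>. ennreal (\<alpha> * p A) * emeasure (law A) (selects K S ?\<tau> ?d 1))"
    unfolding W_def using emeasure_selects[OF T] by (intro sum.cong) auto
  also have "\<dots> \<le> (\<Sum>A\<in>\<P>. ennreal (\<alpha> * p A) * 1)"
    by (intro sum_mono mult_left_mono prob_space.emeasure_le_1 prob_space_law) auto
  also have "\<dots> = ennreal (\<Sum>A\<in>\<P>. \<alpha> * p A)"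
    using assms weights(1) by (subst sum_ennreal[symmetric]) (auto simp: less_imp_le)
  also have "(\<Sum>A\<in>\<P>. \<alpha> * p A) = \<alpha>" using weights(2) by (simp add: sum_distrib_left[symmetric])
  finally show ?thesis using assms by (simp add: emeasure_eq_measure)
qed

text \<open>
  The threshold is chosen so that acceptance of the null hypothesis at time \<open>s\<close> forces
  \<open>p A * exp (LLR A s)\<close>, a single term of the mixture, to be at most \<open>\<beta> * p A\<close>.
\<close>

lemma mslrt_missed_detection_le:
  assumes "0 < \<beta>" "\<beta> < 1" "A \<in> \<P>"
  shows "measure (law A) (selects K S (\<tau>\<^sub>m (mslrt_a \<P> p \<beta>) b) (d\<^sub>m (mslrt_a \<P> p \<beta>) b) 0) \<le> \<beta>"
proof -
  interpret prob_space "law A" by (rule prob_space_law)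
  interpret N: prob_space "law {}" by (rule prob_space_law)
  let ?\<tau> = "\<tau>\<^sub>m (mslrt_a \<P> p \<beta>) b" and ?d = "d\<^sub>m (mslrt_a \<P> p \<beta>) b"
  note T = sequential_test_mslrt[of "mslrt_a \<P> p \<beta>" b]
  have a: "- mslrt_a \<P> p \<beta> \<le> ln \<beta> + ln (p A)"
  proof -
    have "(MIN A\<in>\<P>. ln (p A)) \<le> ln (p A)" using finite_family assms by (intro Min_le) auto
    then show ?thesis using assms by (simp add: mslrt_a_def)
  qed
  define W where "W s = {\<omega> \<in> selects K S ?\<tau> ?d 0. ?\<tau> \<omega> = enat s}" for s
  have W: "W s \<in> sets (\<F> (enat s))" for s
    unfolding W_def using sequential_test_measurable(2)[OF T, of 0] by simp
  have WL[measurable]: "W s \<in> sets (law {})" for s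
    using W sets_joint_filtration_subset sets_law by blast
  have Ws: "emeasure (law A) (W s) \<le> ennreal \<beta> * emeasure (law {}) (W s)" for s
  proof -
    have "emeasure (law A) (W s) = (\<integral>\<^sup>+\<omega>. ennreal (exp (LLR A s \<omega>)) * indicator (W s) \<omega> \<partial>law {})"
      by (rule emeasure_law[OF family_subset[OF assms(3)] W])
    also have "\<dots> \<le> (\<integral>\<^sup>+\<omega>. ennreal \<beta> * indicator (W s) \<omega> \<partial>law {})"
    proof (rule nn_integral_mono_AE)
      show "AE \<omega> in law {}. ennreal (exp (LLR A s \<omega>)) * indicator (W s) \<omega> \<le> ennreal \<beta> * indicator (W s) \<omega>"
        using AE_mix[OF empty_subsetI, of s]
      proof eventually_elim
        case (elim \<omega>)
        show ?case
        proof (cases "\<omega> \<in> W s")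
          case True
          then have \<tau>: "?\<tau> \<omega> = enat s" and "?d \<omega> = 0" by (auto simp: W_def selects_def)
          then have "mix s \<omega> < b" by (auto simp: d\<^sub>m_def split: if_splits)
          then have "mix s \<omega> \<le> - mslrt_a \<P> p \<beta>" using mslrt_time_eqD[OF \<tau>] by auto
          then have "ln (\<Sum>A\<in>\<P>. p A * exp (LLR A s \<omega>)) \<le> ln (\<beta> * p A)"
            using a assms weights(1)[OF assms(3)] by (simp add: elim ln_mult)
          then have "(\<Sum>A\<in>\<P>. p A * exp (LLR A s \<omega>)) \<le> \<beta> * p A"
            using mixture_pos assms weights(1)[OF assms(3)] by (subst (asm) ln_le_cancel_iff) auto
          moreover have "p A * exp (LLR A s \<omega>) \<le> (\<Sum>A\<in>\<P>. p A * exp (LLR A s \<omega>))"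
            using finite_family assms weights(1)
            by (intro member_le_sum[where f = "\<lambda>A. p A * exp (LLR A s \<omega>)"]) (auto simp: less_imp_le)
          ultimately have "p A * exp (LLR A s \<omega>) \<le> p A * \<beta>" by (simp add: mult.commute)
          then have "exp (LLR A s \<omega>) \<le> \<beta>" using weights(1)[OF assms(3)] by simp
          then show ?thesis using True by (simp add: ennreal_leI)
        qed simp
      qed
    qed
    also have "\<dots> = ennreal \<beta> * emeasure (law {}) (W s)" by (rule nn_integral_cmult_indicator) (rule WL)
    finally show ?thesis .
  qed
  have "emeasure (law A) (selects K S ?\<tau> ?d 0) = (\<Sum>s. emeasure (law A) (W s))"
    unfolding W_def using T by (intro emeasure_selects) auto
  also have "\<dots> \<le> (\<Sum>s. ennreal \<beta> * emeasure (law {}) (W s))" by (intro suminf_le Ws) auto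
  also have "\<dots> = ennreal \<beta> * emeasure (law {}) (selects K S ?\<tau> ?d 0)"
    unfolding W_def using emeasure_selects[OF T, of 0 "{}"] by simp
  also have "\<dots> \<le> ennreal \<beta> * 1" by (intro mult_left_mono N.emeasure_le_1) auto
  finally show ?thesis using assms by (simp add: emeasure_eq_measure)
qed

lemma mslrt_in_test_class:
  assumes "0 < \<alpha>" "\<alpha> < 1" "0 < \<beta>" "\<beta> < 1"
  shows "(\<tau>\<^sub>m (mslrt_a \<P> p \<beta>) (mslrt_b \<alpha>), d\<^sub>m (mslrt_a \<P> p \<beta>) (mslrt_b \<alpha>)) \<in> test_class K S P0 P1 \<P> \<alpha> \<beta>"
  using assms finite_family family(1)
  by (auto simp: test_class_def sequential_test_mslrt mslrt_missed_detection_le Max_le_iff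
      null_law_eq_signal_law[of K P0 P1] mslrt_false_alarm_le[simplified])

end

section \<open>Asymptotic optimality\<close>

context multichannel_problem
begin

abbreviation \<tau>\<^sub>e :: "real \<Rightarrow> real \<Rightarrow> (nat \<Rightarrow> nat \<Rightarrow> 'a) \<Rightarrow> enat" where
  "\<tau>\<^sub>e \<alpha> \<beta> \<equiv> \<tau>\<^sub>m (mslrt_a \<P> p \<beta>) (mslrt_b \<alpha>)"

abbreviation best_moment :: "nat set \<Rightarrow> real \<Rightarrow> real \<Rightarrow> real \<Rightarrow> ennreal" where
  "best_moment B q \<alpha> \<beta> \<equiv> INF (\<tau>, d)\<in>test_class K S P0 P1 \<P> \<alpha> \<beta>. moment (law B) \<tau> q"

abbreviation Z :: "nat \<Rightarrow> nat \<Rightarrow> (nat \<Rightarrow> 'a) \<Rightarrow> real" where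
  "Z k \<equiv> channel_llr (S k) (P0 k) (P1 k)"

lemma prob_space_channel:
  assumes "k \<in> {1..K}" shows "prob_space (P0 k)" "prob_space (P1 k)"
  using channels[OF assms] by (auto simp: channel_model_def)

lemma measurable_channel_llr:
  assumes "k \<in> {1..K}"
  shows "Z k t \<in> borel_measurable (P0 k)"
    and "Z k t \<in> borel_measurable (P1 k)"
  using llr_process_measurable(1)[OF llr_process_swap[OF llr_process_channel[OF channels[OF assms]]], of t]
    llr_process_measurable(1)[OF llr_process_channel[OF channels[OF assms]], of t] by simp_all

lemma measurable_component_llr:
  assumes "k \<in> {1..K}"
  shows "(\<lambda>\<omega>. Z k t (\<omega> k)) \<in> borel_measurable (law B)"
  unfolding signal_law_def
  by (rule measurable_compose[OF measurable_component_singleton[OF assms]])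
     (use measurable_channel_llr[OF assms] in auto)

lemma AE_LLR_div_tendsto:
  assumes A: "A \<subseteq> {1..K}"
    and conv: "\<And>k. k \<in> A \<Longrightarrow> AE x in (if k \<in> B then P1 k else P0 k).
        (\<lambda>t. Z k t x / real t) \<longlonglongrightarrow> c k"
  shows "AE \<omega> in law B. (\<lambda>t. LLR A t \<omega> / real t) \<longlonglongrightarrow> (\<Sum>k\<in>A. c k)"
proof -
  have p: "prob_space (if k \<in> B then P1 k else P0 k)" if "k \<in> {1..K}" for k
    using channels[OF that] by (auto simp: channel_model_def)
  have "AE \<omega> in law B. \<forall>k\<in>A. (\<lambda>t. Z k t (\<omega> k) / real t) \<longlonglongrightarrow> c k"
  proof (rule AE_finite_allI)
    show "finite A" using A finite_subset by blast
    fix k assume k: "k \<in> A"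
    show "AE \<omega> in law B. (\<lambda>t. Z k t (\<omega> k) / real t) \<longlonglongrightarrow> c k"
      unfolding signal_law_def using k A
      by (intro AE_PiM_component[where P = "\<lambda>x. (\<lambda>t. Z k t x / real t) \<longlonglongrightarrow> c k"] p conv) auto
  qed
  then show ?thesis
    by eventually_elim (auto simp: LLR_def sum_divide_distrib intro!: tendsto_sum)
qed

text \<open>
  The common form of the two relations. The moment is taken under \<open>law B\<close>, \<open>law C\<close> is the
  alternative that is hardest to tell from it, and \<open>Q\<close> consists of index sets such that the mixture
  test stops once their likelihood ratios have all become extreme. The error probability \<open>e\<close>, committed under \<open>law C\<close>, determines
  the order of the moment; \<open>e'\<close> is the other one, about which only its convergence to \<open>0\<close> matters.
\<close>

lemma moment_asymptotics:
  fixes e e' :: "real \<Rightarrow> real \<Rightarrow> real" and I :: "nat \<Rightarrow> real" and Y :: "nat \<Rightarrow> nat \<Rightarrow> (nat \<Rightarrow> nat \<Rightarrow> 'a) \<Rightarrow> real"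
  assumes A: "A \<in> Q" and Q: "finite Q" "\<Union>Q \<subseteq> {1..K}" "{} \<notin> Q"
    and J: "(\<Sum>k\<in>A. I k) = (MIN A\<in>Q. \<Sum>k\<in>A. I k)" and I: "\<And>k. k \<in> {1..K} \<Longrightarrow> 0 < I k"
    and llr: "llr_process (law B) (law C) (\<lambda>t. \<F> (enat t)) (\<lambda>t \<omega>. \<Sum>k\<in>A. Y k t \<omega>)"
    and conv: "AE \<omega> in law B. (\<lambda>t. (\<Sum>k\<in>A. Y k t \<omega>) / real t) \<longlonglongrightarrow> (\<Sum>k\<in>A. I k)"
    and Ym: "\<And>k n. k \<in> \<Union>Q \<Longrightarrow> Y k n \<in> borel_measurable (law B)"
    and tail: "\<And>k. k \<in> \<Union>Q \<Longrightarrow> tail_negligible (law B) (Y k) (I k) r"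
    and q: "1 \<le> r" "0 < q" "q \<le> real r"
    and ij: "{i, j} = {0, 1}"
    and e: "(\<forall>\<alpha> \<beta>. e \<alpha> \<beta> = \<alpha> \<and> e' \<alpha> \<beta> = \<beta>) \<or> (\<forall>\<alpha> \<beta>. e \<alpha> \<beta> = \<beta> \<and> e' \<alpha> \<beta> = \<alpha>)"
    and err: "\<And>\<alpha> \<beta> \<tau> d. (\<tau>, d) \<in> test_class K S P0 P1 \<P> \<alpha> \<beta> \<Longrightarrow>
       measure (law B) (selects K S \<tau> d j) \<le> e' \<alpha> \<beta> \<and> measure (law C) (selects K S \<tau> d i) \<le> e \<alpha> \<beta>"
    and upper: "\<And>\<alpha> \<beta> n. 0 < \<alpha> \<Longrightarrow> \<alpha> < 1 \<Longrightarrow> 0 < \<beta> \<Longrightarrow> \<beta> < 1 \<Longrightarrow> 1 \<le> n \<Longrightarrow>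
       AE \<omega> in law B. enat n < \<tau>\<^sub>e \<alpha> \<beta> \<omega> \<longrightarrow>
         (\<exists>A\<in>Q. (\<Sum>k\<in>A. Y k n \<omega>) < \<bar>ln (e \<alpha> \<beta>)\<bar> + c0)"
  defines "g \<equiv> \<lambda>\<alpha> \<beta>. (\<bar>ln (e \<alpha> \<beta>)\<bar> / (MIN A\<in>Q. \<Sum>k\<in>A. I k)) powr q"
  shows "ratio_to_one (\<lambda>\<alpha> \<beta>. moment (law B) (\<tau>\<^sub>e \<alpha> \<beta>) q) (\<lambda>\<alpha> \<beta>. ennreal (g \<alpha> \<beta>))
    \<and> ratio_to_one (\<lambda>\<alpha> \<beta>. ennreal (g \<alpha> \<beta>)) (best_moment B q)"
proof (rule ratio_to_one_sandwich)
  define L where "L = (\<Sum>k\<in>A. I k)"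
  have L: "(MIN A\<in>Q. \<Sum>k\<in>A. I k) = L" using J by (simp add: L_def)
  have AK: "A \<subseteq> {1..K}" "A \<noteq> {}" "finite A" using A Q by (auto intro: finite_subset)
  have "0 < L" unfolding L_def using AK I by (intro sum_pos) auto
  have open_unit: "\<forall>\<^sub>F z in errors_to_zero. fst z \<in> {0<..<1} \<and> snd z \<in> {0<..<1}"
    by (rule errors_to_zeroI[of 1]) auto
  have e01: "0 < e \<alpha> \<beta> \<and> e \<alpha> \<beta> < 1" if "0 < \<alpha>" "\<alpha> < 1" "0 < \<beta>" "\<beta> < 1" for \<alpha> \<beta>
    using e that by auto
  show "\<forall>\<^sub>F (\<alpha>, \<beta>) in errors_to_zero. 0 < g \<alpha> \<beta> \<and>
      best_moment B q \<alpha> \<beta> \<le> moment (law B) (\<tau>\<^sub>e \<alpha> \<beta>) q"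
    using open_unit
  proof eventually_elim
    case (elim z)
    obtain \<alpha> \<beta> where z: "z = (\<alpha>, \<beta>)" by (cases z)
    then have u: "0 < \<alpha>" "\<alpha> < 1" "0 < \<beta>" "\<beta> < 1" using elim by auto
    have "0 < g \<alpha> \<beta>" using e01[OF u] \<open>0 < L\<close> by (simp add: g_def L)
    moreover have "best_moment B q \<alpha> \<beta> \<le> moment (law B) (\<tau>\<^sub>e \<alpha> \<beta>) q"
      by (rule INF_lower2[OF mslrt_in_test_class[OF u]]) simp
    ultimately show ?case by (simp add: z)
  qed
  show "\<forall>\<^sub>F (\<alpha>, \<beta>) in errors_to_zero.
      moment (law B) (\<tau>\<^sub>e \<alpha> \<beta>) q \<le> ennreal ((1 + \<eta>) * g \<alpha> \<beta>)" if "0 < \<eta>" for \<eta>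
  proof -
    have "\<forall>\<^sub>F x in at_top. \<forall>T.
      (\<forall>n. {\<omega> \<in> space (law B). enat n < T \<omega>} \<in> sets (law B)) \<longrightarrow>
      (\<forall>n\<ge>1. AE \<omega> in law B. enat n < T \<omega> \<longrightarrow> (\<exists>A\<in>Q. (\<Sum>k\<in>A. Y k n \<omega>) < x + c0)) \<longrightarrow>
      moment (law B) T q \<le> ennreal ((1 + \<eta>) * (x / (MIN A\<in>Q. \<Sum>k\<in>A. I k)) powr q)"
    proof (rule moment_upper_bound[OF prob_space_law Q(1)])
      fix D assume "D \<in> Q"
      then have "D \<subseteq> {1..K}" using Q by blast
      then show "finite D \<and> D \<noteq> {}" using Q \<open>D \<in> Q\<close> by (auto intro: finite_subset)
    next
      fix k assume "k \<in> \<Union>Q"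
      then show "0 < I k" using Q by (intro I) auto
      show "tail_negligible (law B) (Y k) (I k) r" by (rule tail) fact
      show "Y k n \<in> borel_measurable (law B)" for n by (rule Ym) fact
    qed (use A q that in auto)
    from eventually_errors_to_zero_ln[OF this] open_unit show ?thesis
    proof eventually_elim
      case (elim z)
      obtain \<alpha> \<beta> where z: "z = (\<alpha>, \<beta>)" by (cases z)
      then have u: "0 < \<alpha>" "\<alpha> < 1" "0 < \<beta>" "\<beta> < 1" using elim by auto
      have "e \<alpha> \<beta> = \<alpha> \<or> e \<alpha> \<beta> = \<beta>" using e by blast
      then have ev: "\<forall>T. (\<forall>n. {\<omega> \<in> space (law B). enat n < T \<omega>} \<in> sets (law B)) \<longrightarrow>
        (\<forall>n\<ge>1. AE \<omega> in law B. enat n < T \<omega> \<longrightarrow> (\<exists>A\<in>Q. (\<Sum>k\<in>A. Y k n \<omega>) < \<bar>ln (e \<alpha> \<beta>)\<bar> + c0)) \<longrightarrow>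
        moment (law B) T q \<le> ennreal ((1 + \<eta>) * (\<bar>ln (e \<alpha> \<beta>)\<bar> / (MIN A\<in>Q. \<Sum>k\<in>A. I k)) powr q)"
        using elim(1) unfolding z prod.case by (elim disjE conjE) (simp_all only:)
      have "moment (law B) (\<tau>\<^sub>e \<alpha> \<beta>) q
          \<le> ennreal ((1 + \<eta>) * (\<bar>ln (e \<alpha> \<beta>)\<bar> / (MIN A\<in>Q. \<Sum>k\<in>A. I k)) powr q)"
        using upper[OF u] sequential_test_measurable(1)[OF sequential_test_mslrt, of 0]
        by (intro ev[rule_format]) (auto simp: space_law sets_law)
      then show ?case by (simp add: z g_def)
    qed
  qed
  show "\<forall>\<^sub>F (\<alpha>, \<beta>) in errors_to_zero. ennreal ((1 - \<eta>) * g \<alpha> \<beta>)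
      \<le> best_moment B q \<alpha> \<beta>" if \<eta>: "0 < \<eta>" "\<eta> < 1" for \<eta>
  proof -
    obtain \<delta> where \<delta>: "0 < \<delta>" and bound: "\<And>\<alpha> \<beta> \<tau> D D'. \<alpha> < \<delta> \<Longrightarrow> 0 < \<beta> \<Longrightarrow> \<beta> < \<delta> \<Longrightarrow>
        (\<forall>n. {x \<in> space (law B). enat n < \<tau> x} \<in> sets (law B)) \<Longrightarrow>
        D \<in> sets (law B) \<Longrightarrow> D \<in> sets (law C) \<Longrightarrow> D' \<in> sets (law B) \<Longrightarrow>
        (\<forall>t. {x \<in> D. \<tau> x = enat t} \<in> sets (\<F> (enat t))) \<Longrightarrow>
        (\<forall>x\<in>space (law B). 1 \<le> \<tau> x \<and> (\<tau> x < \<infinity> \<longrightarrow> x \<in> D \<union> D')) \<Longrightarrow>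
        measure (law B) D' \<le> \<alpha> \<Longrightarrow> measure (law C) D \<le> \<beta> \<Longrightarrow>
        ennreal ((1 - \<eta>) * (\<bar>ln \<beta>\<bar> / L) powr q) \<le> moment (law B) \<tau> q"
      using moment_lower_bound[OF prob_space_law prob_space_law llr conv _ q(2) \<eta>] \<open>0 < L\<close>
      unfolding L_def by blast
    show ?thesis
    proof (rule errors_to_zeroI[OF \<delta>], unfold prod.case, rule INF_greatest)
      fix \<alpha> \<beta> td
      assume u: "0 < \<alpha>" "\<alpha> < \<delta>" "\<alpha> < 1" "0 < \<beta>" "\<beta> < \<delta>" "\<beta> < 1" and "td \<in> test_class K S P0 P1 \<P> \<alpha> \<beta>"
      then obtain \<tau> d where td: "td = (\<tau>, d)" and T: "(\<tau>, d) \<in> test_class K S P0 P1 \<P> \<alpha> \<beta>" by (cases td) auto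
      then have st: "sequential_test K S \<tau> d" by (simp add: test_class_def)
      have i: "i \<in> {0, 1}" "j \<in> {0, 1}" using ij by auto
      note m = sequential_test_measurable[OF st]
      have d01: "d \<omega> \<in> {0, 1}" if "\<omega> \<in> space (sample_space K S)" for \<omega>
      proof -
        interpret filtration "space (sample_space K S)" \<F> by (rule filtration_joint)
        have "d \<in> measurable (pre_sigma \<tau>) (count_space {0, 1})" using st by (simp add: sequential_test_def)
        from measurable_space[OF this, of \<omega>] that show ?thesis by (simp add: space_pre_sigma)
      qed
      have "ennreal ((1 - \<eta>) * (\<bar>ln (e \<alpha> \<beta>)\<bar> / L) powr q) \<le> moment (law B) \<tau> q"
      proof (rule bound)
        show "e' \<alpha> \<beta> < \<delta>" "0 < e \<alpha> \<beta>" "e \<alpha> \<beta> < \<delta>" using e u by auto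
        show "\<forall>n. {x \<in> space (law B). enat n < \<tau> x} \<in> sets (law B)"
          using m(1)[OF i(1)] by (simp add: space_law sets_law)
        show "selects K S \<tau> d i \<in> sets (law B)" "selects K S \<tau> d i \<in> sets (law C)" "selects K S \<tau> d j \<in> sets (law B)"
          using m(3) i by (simp_all add: sets_law)
        show "\<forall>t. {x \<in> selects K S \<tau> d i. \<tau> x = enat t} \<in> sets (\<F> (enat t))"
          using m(2)[OF i(1)] by simp
        show "\<forall>x\<in>space (law B). 1 \<le> \<tau> x \<and> (\<tau> x < \<infinity> \<longrightarrow> x \<in> selects K S \<tau> d i \<union> selects K S \<tau> d j)"
          using st d01 ij by (auto simp: sequential_test_def selects_def space_law)
        show "measure (law B) (selects K S \<tau> d j) \<le> e' \<alpha> \<beta>" "measure (law C) (selects K S \<tau> d i) \<le> e \<alpha> \<beta>"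
          using err[OF T] by auto
      qed
      then show "ennreal ((1 - \<eta>) * g \<alpha> \<beta>) \<le> (case td of (\<tau>, d) \<Rightarrow> moment (law B) \<tau> q)"
        by (simp add: td g_def L)
    qed
  qed
qed

lemma test_class_error_bounds:
  assumes "(\<tau>, d) \<in> test_class K S P0 P1 \<P> \<alpha> \<beta>"
  shows "measure (law {}) (selects K S \<tau> d 1) \<le> \<alpha>"
    and "A \<in> \<P> \<Longrightarrow> measure (law A) (selects K S \<tau> d 0) \<le> \<beta>"
proof -
  show "measure (law {}) (selects K S \<tau> d 1) \<le> \<alpha>"
    using assms by (simp add: test_class_def null_law_eq_signal_law[of K P0 P1])
  assume "A \<in> \<P>"
  then have "measure (law A) (selects K S \<tau> d 0) \<le> (MAX A\<in>\<P>. measure (law A) (selects K S \<tau> d 0))"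
    using finite_family by (intro Max_ge) auto
  also have "\<dots> \<le> \<beta>" using assms by (simp add: test_class_def)
  finally show "measure (law A) (selects K S \<tau> d 0) \<le> \<beta>" .
qed

text \<open>
  The mixture falls below its lower threshold once every likelihood ratio of the family is small
  enough, and any test must rule out the signal set that is closest to the null hypothesis.
  Hence \<open>Q\<close> is the whole family and \<open>C\<close> is a minimizer of the total drift.
\<close>

lemma null_moment_asymptoticsI:
  assumes I0: "\<And>k. k \<in> {1..K} \<Longrightarrow> 0 < I0 k"
    and conv: "\<And>k. k \<in> {1..K} \<Longrightarrow> AE x in P0 k. (\<lambda>t. Z k t x / real t) \<longlonglongrightarrow> - I0 k"
    and tail: "\<And>k. k \<in> {1..K} \<Longrightarrow> tail_negligible (P0 k) (\<lambda>t x. - Z k t x) (I0 k) r"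
    and q: "1 \<le> r" "0 < q" "q \<le> real r"
  shows "null_moment_asymptotics K S P0 P1 \<P> p I0 q"
proof -
  have "(MIN A\<in>\<P>. \<Sum>k\<in>A. I0 k) \<in> (\<lambda>A. \<Sum>k\<in>A. I0 k) ` \<P>"
    using finite_family family(1) by (intro Min_in) auto
  then obtain A where A: "A \<in> \<P>" "(\<Sum>k\<in>A. I0 k) = (MIN A\<in>\<P>. \<Sum>k\<in>A. I0 k)" by auto
  note AK = family_subset[OF A(1)]
  define Y where "Y k t \<omega> = - Z k t (\<omega> k)" for k t and \<omega> :: "nat \<Rightarrow> nat \<Rightarrow> 'a"
  have Y: "(\<Sum>k\<in>D. Y k t \<omega>) = - LLR D t \<omega>" for D t \<omega> by (simp add: Y_def LLR_def sum_negf)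
  show ?thesis
    unfolding null_moment_asymptotics_def null_law_eq_signal_law[of K P0 P1]
  proof (rule moment_asymptotics[where A = A and C = A and Y = Y and e' = "\<lambda>\<alpha> \<beta>. \<alpha>" and i = 0 and j = 1
        and r = r and ?c0.0 = "- (MIN A\<in>\<P>. ln (p A))"])
    show "llr_process (law {}) (law A) (\<lambda>t. \<F> (enat t)) (\<lambda>t \<omega>. \<Sum>k\<in>A. Y k t \<omega>)"
      unfolding Y by (rule llr_process_null[OF AK])
    have "AE \<omega> in law {}. (\<lambda>t. LLR A t \<omega> / real t) \<longlonglongrightarrow> (\<Sum>k\<in>A. - I0 k)"
      using AK conv by (intro AE_LLR_div_tendsto) auto
    then show "AE \<omega> in law {}. (\<lambda>t. (\<Sum>k\<in>A. Y k t \<omega>) / real t) \<longlonglongrightarrow> (\<Sum>k\<in>A. I0 k)"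
      unfolding Y
    proof eventually_elim
      case (elim \<omega>)
      from tendsto_minus[OF elim] show ?case by (simp add: sum_negf)
    qed
    fix k assume "k \<in> \<Union>\<P>"
    then have k: "k \<in> {1..K}" using family_subset by blast
    show "Y k n \<in> borel_measurable (law {})" for n
      unfolding Y_def using measurable_component_llr[OF k, of n "{}"] by measurable
    show "tail_negligible (law {}) (Y k) (I0 k) r"
      unfolding Y_def signal_law_def
      by (rule tail_negligible_PiM_component[where Y = "\<lambda>t x. - Z k t x"])
         (use k tail measurable_channel_llr(1)[OF k] prob_space_channel in auto)
  next
    fix \<alpha> \<beta> :: real and n :: nat
    assume u: "0 < \<alpha>" "\<alpha> < 1" "0 < \<beta>" "\<beta> < 1" "1 \<le> n"
    show "AE \<omega> in law {}. enat n < \<tau>\<^sub>e \<alpha> \<beta> \<omega> \<longrightarrow>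
         (\<exists>A\<in>\<P>. (\<Sum>k\<in>A. Y k n \<omega>) < \<bar>ln \<beta>\<bar> + - (MIN A\<in>\<P>. ln (p A)))"
      using AE_mix[OF empty_subsetI, of n]
    proof eventually_elim
      case (elim \<omega>)
      show ?case
      proof (intro impI, rule ccontr)
        assume "enat n < \<tau>\<^sub>e \<alpha> \<beta> \<omega>"
          and no: "\<not> (\<exists>A\<in>\<P>. (\<Sum>k\<in>A. Y k n \<omega>) < \<bar>ln \<beta>\<bar> + - (MIN A\<in>\<P>. ln (p A)))"
        then have "mix n \<omega> \<in> {- mslrt_a \<P> p \<beta><..<mslrt_b \<alpha>}"
          using u by (metis atLeastAtMost_iff leD mslrt_time_le_iff order_refl)
        then have "- mslrt_a \<P> p \<beta> < ln (\<Sum>A\<in>\<P>. p A * exp (LLR A n \<omega>))" using elim by simp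
        moreover have "(\<Sum>A\<in>\<P>. p A * exp (LLR A n \<omega>)) \<le> (\<Sum>A\<in>\<P>. p A * exp (- mslrt_a \<P> p \<beta>))"
        proof (intro sum_mono mult_left_mono)
          fix D assume D: "D \<in> \<P>"
          have "mslrt_a \<P> p \<beta> \<le> - LLR D n \<omega>" using no D unfolding Y mslrt_a_def by force
          then show "exp (LLR D n \<omega>) \<le> exp (- mslrt_a \<P> p \<beta>)" by simp
        qed (use weights(1) in \<open>auto simp: less_imp_le\<close>)
        then have "(\<Sum>A\<in>\<P>. p A * exp (LLR A n \<omega>)) \<le> exp (- mslrt_a \<P> p \<beta>)"
          using weights(2) by (simp add: sum_distrib_right[symmetric])
        then have "ln (\<Sum>A\<in>\<P>. p A * exp (LLR A n \<omega>)) \<le> ln (exp (- mslrt_a \<P> p \<beta>))"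
          using mixture_pos by (subst ln_le_cancel_iff) auto
        ultimately show False by simp
      qed
    qed
  next
    fix \<alpha> \<beta> :: real and \<tau> d assume "(\<tau>, d) \<in> test_class K S P0 P1 \<P> \<alpha> \<beta>"
    then show "measure (law {}) (selects K S \<tau> d 1) \<le> \<alpha> \<and> measure (law A) (selects K S \<tau> d 0) \<le> \<beta>"
      using test_class_error_bounds A(1) by blast
  qed (use A family finite_family I0 q in auto)
qed

text \<open>
  The likelihood ratio of the true set \<open>A\<close> alone suffices to push the mixture over its upper
  threshold, at the price of the constant \<open>- ln (p A)\<close>. Hence \<open>Q\<close> contains only \<open>A\<close>.
\<close>

lemma signal_moment_asymptoticsI:
  assumes I1: "\<And>k. k \<in> {1..K} \<Longrightarrow> 0 < I1 k"
    and conv: "\<And>k. k \<in> {1..K} \<Longrightarrow> AE x in P1 k. (\<lambda>t. Z k t x / real t) \<longlonglongrightarrow> I1 k"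
    and tail: "\<And>k. k \<in> {1..K} \<Longrightarrow> tail_negligible (P1 k) (Z k) (I1 k) r"
    and q: "1 \<le> r" "0 < q" "q \<le> real r"
  shows "signal_moment_asymptotics K S P0 P1 \<P> p I1 q"
  unfolding signal_moment_asymptotics_def
proof
  fix A assume A: "A \<in> \<P>"
  note AK = family_subset[OF A]
  define Y where "Y k t \<omega> = Z k t (\<omega> k)" for k t and \<omega> :: "nat \<Rightarrow> nat \<Rightarrow> 'a"
  have Y: "(\<Sum>k\<in>D. Y k t \<omega>) = LLR D t \<omega>" for D t \<omega> by (simp add: Y_def LLR_def)
  have J: "(\<Sum>k\<in>A. I1 k) = (MIN D\<in>{A}. \<Sum>k\<in>D. I1 k)" by simp
  show "ratio_to_one (\<lambda>\<alpha> \<beta>. moment (law A) (\<tau>\<^sub>e \<alpha> \<beta>) q)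
          (\<lambda>\<alpha> \<beta>. ennreal ((\<bar>ln \<alpha>\<bar> / (\<Sum>k\<in>A. I1 k)) powr q)) \<and>
        ratio_to_one (\<lambda>\<alpha> \<beta>. ennreal ((\<bar>ln \<alpha>\<bar> / (\<Sum>k\<in>A. I1 k)) powr q))
          (best_moment A q)"
    unfolding J
  proof (rule moment_asymptotics[where A = A and C = "{}" and Y = Y and e' = "\<lambda>\<alpha> \<beta>. \<beta>" and i = 1 and j = 0
        and r = r and ?c0.0 = "- ln (p A)"])
    show "llr_process (law A) (law {}) (\<lambda>t. \<F> (enat t)) (\<lambda>t \<omega>. \<Sum>k\<in>A. Y k t \<omega>)"
      unfolding Y by (rule llr_process_signal[OF AK])
    show "AE \<omega> in law A. (\<lambda>t. (\<Sum>k\<in>A. Y k t \<omega>) / real t) \<longlonglongrightarrow> (\<Sum>k\<in>A. I1 k)"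
      unfolding Y using AK conv by (intro AE_LLR_div_tendsto) auto
    fix k assume "k \<in> \<Union>{A}"
    then have kA: "k \<in> A" and k: "k \<in> {1..K}" using AK by auto
    show "Y k n \<in> borel_measurable (law A)" for n
      unfolding Y_def by (rule measurable_component_llr[OF k])
    show "tail_negligible (law A) (Y k) (I1 k) r"
      unfolding Y_def signal_law_def
      by (rule tail_negligible_PiM_component[where Y = "Z k"])
         (use k kA tail measurable_channel_llr(2)[OF k] prob_space_channel in auto)
  next
    fix \<alpha> \<beta> :: real and n :: nat
    assume u: "0 < \<alpha>" "\<alpha> < 1" "0 < \<beta>" "\<beta> < 1" "1 \<le> n"
    show "AE \<omega> in law A. enat n < \<tau>\<^sub>e \<alpha> \<beta> \<omega> \<longrightarrow>
         (\<exists>D\<in>{A}. (\<Sum>k\<in>D. Y k n \<omega>) < \<bar>ln \<alpha>\<bar> + - ln (p A))"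
      using AE_mix[OF AK, of n]
    proof eventually_elim
      case (elim \<omega>)
      show ?case
      proof
        assume "enat n < \<tau>\<^sub>e \<alpha> \<beta> \<omega>"
        then have "mix n \<omega> \<in> {- mslrt_a \<P> p \<beta><..<mslrt_b \<alpha>}"
          using u by (metis atLeastAtMost_iff leD mslrt_time_le_iff order_refl)
        then have "ln (\<Sum>A\<in>\<P>. p A * exp (LLR A n \<omega>)) < \<bar>ln \<alpha>\<bar>" using elim by (simp add: mslrt_b_def)
        moreover have "p A * exp (LLR A n \<omega>) \<le> (\<Sum>A\<in>\<P>. p A * exp (LLR A n \<omega>))"
          using finite_family A weights(1)
          by (intro member_le_sum[where f = "\<lambda>A. p A * exp (LLR A n \<omega>)"]) (auto simp: less_imp_le)
        then have "ln (p A * exp (LLR A n \<omega>)) \<le> ln (\<Sum>A\<in>\<P>. p A * exp (LLR A n \<omega>))"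
          using mixture_pos weights(1)[OF A] by (subst ln_le_cancel_iff) auto
        moreover have "ln (p A * exp (LLR A n \<omega>)) = ln (p A) + LLR A n \<omega>"
          using weights(1)[OF A] by (simp add: ln_mult)
        ultimately show "\<exists>D\<in>{A}. (\<Sum>k\<in>D. Y k n \<omega>) < \<bar>ln \<alpha>\<bar> + - ln (p A)" by (simp add: Y)
      qed
    qed
  next
    fix \<alpha> \<beta> :: real and \<tau> d assume "(\<tau>, d) \<in> test_class K S P0 P1 \<P> \<alpha> \<beta>"
    then show "measure (law A) (selects K S \<tau> d 0) \<le> \<beta> \<and> measure (law {}) (selects K S \<tau> d 1) \<le> \<alpha>"
      using test_class_error_bounds A by blast
  qed (use A AK family I1 q in auto)
qed

end

theorem theoremV1:
  fixes K :: nat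
    and S :: "nat \<Rightarrow> 'a measure"
    and P0 P1 :: "nat \<Rightarrow> (nat \<Rightarrow> 'a) measure"
    and \<P> :: "nat set set"
    and p :: "nat set \<Rightarrow> real"
    and I0 I1 :: "nat \<Rightarrow> real"
  assumes channels: "\<And>k. k \<in> {1..K} \<Longrightarrow> channel_model (S k) (P0 k) (P1 k)"
    and family: "\<P> \<noteq> {}" "\<P> \<subseteq> Pow {1..K}" "{} \<notin> \<P>"
    and weights: "\<And>A. A \<in> \<P> \<Longrightarrow> 0 < p A" "(\<Sum>A\<in>\<P>. p A) = 1"
    and numbers: "\<And>k. k \<in> {1..K} \<Longrightarrow> 0 < I0 k" "\<And>k. k \<in> {1..K} \<Longrightarrow> 0 < I1 k"
  shows
    "(\<forall>r::nat. 1 \<le> r \<longrightarrow>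
        (\<forall>k\<in>{1..K}. \<forall>\<epsilon>>0.
           summable (\<lambda>n. real (Suc n) ^ (r - 1) *
             measure (P0 k) {x \<in> space (P0 k).
               \<bar>channel_llr (S k) (P0 k) (P1 k) (Suc n) x / real (Suc n) + I0 k\<bar> > \<epsilon>}) \<and>
           summable (\<lambda>n. real (Suc n) ^ (r - 1) *
             measure (P1 k) {x \<in> space (P1 k).
               \<bar>channel_llr (S k) (P0 k) (P1 k) (Suc n) x / real (Suc n) - I1 k\<bar> > \<epsilon>}))
        \<longrightarrow> (\<forall>q::real. 1 \<le> q \<and> q \<le> real r \<longrightarrow>
              null_moment_asymptotics K S P0 P1 \<P> p I0 q \<and>
              signal_moment_asymptotics K S P0 P1 \<P> p I1 q))
     \<and>
     ((\<forall>k\<in>{1..K}.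
         independent_increments (P0 k) (channel_llr (S k) (P0 k) (P1 k)) \<and>
         independent_increments (P1 k) (channel_llr (S k) (P0 k) (P1 k)) \<and>
         (AE x in P1 k. (\<lambda>t. channel_llr (S k) (P0 k) (P1 k) t x / real t) \<longlonglongrightarrow> I1 k) \<and>
         (AE x in P0 k. (\<lambda>t. channel_llr (S k) (P0 k) (P1 k) t x / real t) \<longlonglongrightarrow> - I0 k))
        \<longrightarrow> (\<forall>q::real. 0 < q \<longrightarrow>
              null_moment_asymptotics K S P0 P1 \<P> p I0 q \<and>
              signal_moment_asymptotics K S P0 P1 \<P> p I1 q))"
proof (intro conjI allI impI)
  interpret multichannel_problem K S P0 P1 \<P> p
    using channels family weights by unfold_locales auto
  let ?Z = "\<lambda>k. channel_llr (S k) (P0 k) (P1 k)"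
  note Zm = measurable_channel_llr
  {
    fix r :: nat and q :: real
    assume r: "1 \<le> r" and q: "1 \<le> q \<and> q \<le> real r"
      and sm: "\<forall>k\<in>{1..K}. \<forall>\<epsilon>>0.
           summable (\<lambda>n. real (Suc n) ^ (r - 1) *
             measure (P0 k) {x \<in> space (P0 k). \<bar>?Z k (Suc n) x / real (Suc n) + I0 k\<bar> > \<epsilon>}) \<and>
           summable (\<lambda>n. real (Suc n) ^ (r - 1) *
             measure (P1 k) {x \<in> space (P1 k). \<bar>?Z k (Suc n) x / real (Suc n) - I1 k\<bar> > \<epsilon>})"
    \<comment> \<open>Under the null law the process with positive drift is \<open>- Z\<close>.\<close>
    have abs: "\<bar>- a / b - c\<bar> = \<bar>a / b + c\<bar>" for a b c :: real by simp
    have sm0: "summable (\<lambda>n. real (Suc n) ^ (r - 1) *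
        measure (P0 k) {x \<in> space (P0 k). \<epsilon> < \<bar>- ?Z k (Suc n) x / real (Suc n) - I0 k\<bar>})"
      if "k \<in> {1..K}" "0 < \<epsilon>" for k \<epsilon>
      unfolding abs using sm that by blast
    have sm1: "summable (\<lambda>n. real (Suc n) ^ (r - 1) *
        measure (P1 k) {x \<in> space (P1 k). \<epsilon> < \<bar>?Z k (Suc n) x / real (Suc n) - I1 k\<bar>})"
      if "k \<in> {1..K}" "0 < \<epsilon>" for k \<epsilon>
      using sm that by blast
    show "null_moment_asymptotics K S P0 P1 \<P> p I0 q"
    proof (rule null_moment_asymptoticsI[where r = r])
      fix k assume k: "k \<in> {1..K}"
      have m: "(\<lambda>x. - ?Z k n x) \<in> borel_measurable (P0 k)" for n using Zm(1)[OF k, of n] by measurable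
      show "tail_negligible (P0 k) (\<lambda>t x. - ?Z k t x) (I0 k) r"
        by (rule tail_negligible_of_summable[OF prob_space_channel(1)[OF k] numbers(1)[OF k] r m sm0[OF k]])
      have "AE x in P0 k. (\<lambda>t. - ?Z k t x / real t) \<longlonglongrightarrow> I0 k"
        by (rule AE_tendsto_of_summable_deviations[OF prob_space_channel(1)[OF k] r m sm0[OF k]])
      then show "AE x in P0 k. (\<lambda>t. ?Z k t x / real t) \<longlonglongrightarrow> - I0 k"
      proof eventually_elim
        case (elim x)
        from tendsto_minus[OF elim] show ?case by simp
      qed
    qed (use numbers r q in auto)
    show "signal_moment_asymptotics K S P0 P1 \<P> p I1 q"
    proof (rule signal_moment_asymptoticsI[where r = r])
      fix k assume k: "k \<in> {1..K}"
      show "tail_negligible (P1 k) (?Z k) (I1 k) r"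
        by (rule tail_negligible_of_summable[OF prob_space_channel(2)[OF k] numbers(2)[OF k] r Zm(2)[OF k] sm1[OF k]])
      show "AE x in P1 k. (\<lambda>t. ?Z k t x / real t) \<longlonglongrightarrow> I1 k"
        by (rule AE_tendsto_of_summable_deviations[OF prob_space_channel(2)[OF k] r Zm(2)[OF k] sm1[OF k]])
    qed (use numbers r q in auto)
  next
    fix q :: real
    assume q: "0 < q"
      and *: "\<forall>k\<in>{1..K}.
         independent_increments (P0 k) (?Z k) \<and> independent_increments (P1 k) (?Z k) \<and>
         (AE x in P1 k. (\<lambda>t. ?Z k t x / real t) \<longlonglongrightarrow> I1 k) \<and>
         (AE x in P0 k. (\<lambda>t. ?Z k t x / real t) \<longlonglongrightarrow> - I0 k)"
    define r where "r = max 1 (nat \<lceil>q\<rceil>)"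
    have r: "1 \<le> r" "q \<le> real r" by (auto simp: r_def) linarith
    have Z0: "?Z k 0 x = 0" for k x by (simp add: channel_llr_def)
    show "null_moment_asymptotics K S P0 P1 \<P> p I0 q"
    proof (rule null_moment_asymptoticsI[where r = r])
      fix k assume k: "k \<in> {1..K}"
      note llr = llr_process_channel[OF channels[OF k]]
      show conv: "AE x in P0 k. (\<lambda>t. ?Z k t x / real t) \<longlonglongrightarrow> - I0 k" using * k by blast
      show "tail_negligible (P0 k) (\<lambda>t x. - ?Z k t x) (I0 k) r"
      proof (rule tail_negligible_of_independent_increments)
        show "independent_increments (P0 k) (\<lambda>t x. - ?Z k t x)"
          using * k prob_space_channel(1)[OF k] by (intro independent_increments_uminus) auto
        show "AE x in P0 k. (\<lambda>n. - ?Z k n x / real n) \<longlonglongrightarrow> I0 k"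
          using conv
        proof eventually_elim
          case (elim x)
          from tendsto_minus[OF elim] show ?case by simp
        qed
        show "(\<integral>\<^sup>+x. ennreal (exp (- (- ?Z k n x))) \<partial>P0 k) = 1" for n
          by (rule llr_process_nn_integral_exp[OF llr prob_space_channel(2)[OF k]])
      qed (use Zm(1)[OF k] Z0 numbers(1)[OF k] r prob_space_channel(1)[OF k] in auto)
    qed (use numbers r q in auto)
    show "signal_moment_asymptotics K S P0 P1 \<P> p I1 q"
    proof (rule signal_moment_asymptoticsI[where r = r])
      fix k assume k: "k \<in> {1..K}"
      note llr = llr_process_swap[OF llr_process_channel[OF channels[OF k]], simplified]
      show conv: "AE x in P1 k. (\<lambda>t. ?Z k t x / real t) \<longlonglongrightarrow> I1 k" using * k by blast
      show "tail_negligible (P1 k) (?Z k) (I1 k) r"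
      proof (rule tail_negligible_of_independent_increments[OF _ _ _ _ _ _ _ conv])
        show "independent_increments (P1 k) (?Z k)" using * k by blast
        show "(\<integral>\<^sup>+x. ennreal (exp (- ?Z k n x)) \<partial>P1 k) = 1" for n
          by (rule llr_process_nn_integral_exp[OF llr prob_space_channel(1)[OF k]])
      qed (use Zm(2)[OF k] Z0 numbers(2)[OF k] r prob_space_channel(2)[OF k] in auto)
    qed (use numbers r q in auto)
  }
qed

end
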